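(* Let $F$ be a filtration-preserving automorphism of $\widehat L$ with $\mathrm{gr}\,F=\mathrm{id}$, and assume that the automorphism of $|A|$ induced by $F$ is an automorphism of the Lie algebra $(|A|,[\cdot,\cdot]_{\mathrm{gr}})$. Then $F$ is tangential, i.e. for every $j=1,\ldots,n$ there is a group-like element $f_j\in A$ with $F(z_j)=f_j^{-1}z_jf_j$, and there exists a group-like element $f_0\in A$ such that $F(\omega)=f_0^{-1}\omega f_0$, where $\omega=\sum_{i=1}^g[x_i,y_i]+\sum_{j=1}^n z_j$.
   Context: $\mathbb{K}$ is a field of characteristic zero. $\Sigma$ is a compact connected oriented surface of genus $g$ with $n+1$ boundary components labelled $0,\ldots,n$; $\pi=\pi_1(\Sigma,* )$ (basepoint on boundary component $0$) is free on $\alpha_i,\beta_i$ ($1\le i\le g$), $\gamma_j$ ($1\le j\le n$), $\gamma_j$ freely homotopic to the $j$th boundary component, with $\prod_i\alpha_i\beta_i\alpha_i^{-1}\beta_i^{-1}\prod_j\gamma_j=\gamma_0$ the loop around boundary component $0$. $\mathrm{gr}\,H=H/H^{(2)}\oplus H^{(2)}$ where $H=H_1(\Sigma;\mathbb{K})$ and $H^{(2)}$ is the radical of the intersection pairing, with basis $x_i,y_i$ (classes of $\alpha_i,\beta_i$) and $z_j$ (classes of $\gamma_j$). $A$ is the completed free associative algebra on $x_i,y_i,z_j$ with weights $1,1,2$ (filtered by weight), a complete Hopf algebra with primitive generators; $\widehat L$ is its primitive part (completed free Lie algebra); group-like elements are elements of $\exp(\widehat L)$. Any automorphism of $\widehat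 L$ extends to $A=U(\widehat L)$ and hence acts on $|A|=A/\overline{[A,A]}$. $\widehat{\mathfrak g}=|\widehat{\mathbb{K}\pi}|$, where $\widehat{\mathbb{K}\pi}$ is the completion of $\mathbb{K}\pi$ with respect to the unique multiplicative filtration by two-sided ideals with $\alpha_i-1,\beta_i-1$ in degree $1$ and $\gamma_j-1$ in degree $2$; the completed Goldman bracket on $\widehat{\mathfrak g}$ is filtered (of degree $-2$) and induces the Lie bracket $[\cdot,\cdot]_{\mathrm{gr}}$ on $\mathrm{gr}\,\widehat{\mathfrak g}\cong|A|$ (the necklace Lie bracket). *)

theory Defs
  imports Main
begin

datatype gen = X nat | Y nat | Z nat

definition letters :: "nat \<Rightarrow> nat \<Rightarrow> gen set" where
  "letters g n = {X i | i. 1 \<le> i \<and> i \<le> g} \<union> {Y i | i. 1 \<le> i \<and> i \<le> g}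
                 \<union> {Z j | j. 1 \<le> j \<and> j \<le> n}"

fun wt :: "gen \<Rightarrow> nat" where
  "wt (X _) = 1" | "wt (Y _) = 1" | "wt (Z _) = 2"

definition wtw :: "gen list \<Rightarrow> nat" where
  "wtw w = sum_list (map wt w)"

section \<open>The completed free associative algebra A as formal series in noncommuting letters\<close>

type_synonym 'k ser = "gen list \<Rightarrow> 'k"

definition Aalg :: "nat \<Rightarrow> nat \<Rightarrow> ('k::field_char_0) ser set" where
  "Aalg g n = {a. \<forall>w. a w \<noteq> 0 \<longrightarrow> set w \<subseteq> letters g n}"

definition sone :: "('k::field_char_0) ser" where
  "sone w = (if w = [] then 1 else 0)"

definition lt :: "gen \<Rightarrow> ('k::field_char_0) ser" where
  "lt c w = (if w = [c] then 1 else 0)"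

definition sadd :: "('k::field_char_0) ser \<Rightarrow> 'k ser \<Rightarrow> 'k ser" where
  "sadd a b w = a w + b w"

definition ssub :: "('k::field_char_0) ser \<Rightarrow> 'k ser \<Rightarrow> 'k ser" where
  "ssub a b w = a w - b w"

definition ssc :: "'k \<Rightarrow> ('k::field_char_0) ser \<Rightarrow> 'k ser" where
  "ssc c a w = c * a w"

definition smul :: "('k::field_char_0) ser \<Rightarrow> 'k ser \<Rightarrow> 'k ser" where
  "smul a b w = (\<Sum>i\<le>length w. a (take i w) * b (drop i w))"

definition scomm :: "('k::field_char_0) ser \<Rightarrow> 'k ser \<Rightarrow> 'k ser" where
  "scomm a b = ssub (smul a b) (smul b a)"

fun spow :: "('k::field_char_0) ser \<Rightarrow> nat \<Rightarrow> 'k ser" where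
  "spow a 0 = sone"
| "spow a (Suc k) = smul a (spow a k)"

definition sprod :: "('k::field_char_0) ser list \<Rightarrow> 'k ser" where
  "sprod xs = foldr smul xs sone"

definition filt :: "nat \<Rightarrow> ('k::field_char_0) ser set" where
  "filt m = {a. \<forall>w. wtw w < m \<longrightarrow> a w = 0}"

fun shuf :: "'a list \<Rightarrow> 'a list \<Rightarrow> 'a list list" where
  "shuf [] v = [v]"
| "shuf u [] = [u]"
| "shuf (a # u) (b # v) = map (Cons a) (shuf u (b # v)) @ map (Cons b) (shuf (a # u) v)"

text \<open>Coefficient of u \<otimes> v in the coproduct of a (letters primitive).\<close>
definition cop :: "('k::field_char_0) ser \<Rightarrow> gen list \<Rightarrow> gen list \<Rightarrow> 'k" where
  "cop a u v = sum_list (map a (shuf u v))"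

text \<open>Primitive part: the completed free Lie algebra \<open>\<widehat>L\<close>.\<close>
definition Lhat :: "nat \<Rightarrow> nat \<Rightarrow> ('k::field_char_0) ser set" where
  "Lhat g n = {a \<in> Aalg g n. \<forall>u v. cop a u v =
      (if v = [] then a u else 0) + (if u = [] then a v else 0)}"

text \<open>Exponential of a series with zero constant term (the sum is finite coefficientwise).\<close>
definition sexp :: "('k::field_char_0) ser \<Rightarrow> 'k ser" where
  "sexp a w = (\<Sum>k\<le>length w. spow a k w / of_nat (fact k))"

definition grouplike :: "nat \<Rightarrow> nat \<Rightarrow> ('k::field_char_0) ser \<Rightarrow> bool" where
  "grouplike g n f \<longleftrightarrow> (\<exists>l \<in> Lhat g n. f = sexp l)"

text \<open>For F filtration preserving, F(letter c) lies in filt (wt c), so the product of the images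
  of the letters of u lies in filt (wtw u); hence only words u with wtw u <= wtw w contribute
  to the coefficient at w and this finite sum is the continuous algebra extension of F.\<close>
definition ext :: "nat \<Rightarrow> nat \<Rightarrow> (('k::field_char_0) ser \<Rightarrow> 'k ser) \<Rightarrow> 'k ser \<Rightarrow> 'k ser" where
  "ext g n F a w = (\<Sum>u \<in> {u. set u \<subseteq> letters g n \<and> wtw u \<le> wtw w}.
                      a u * sprod (map (\<lambda>c. F (lt c)) u) w)"

inductive_set cspan :: "nat \<Rightarrow> nat \<Rightarrow> ('k::field_char_0) ser set" for g n where
  cs0: "(\<lambda>w. 0) \<in> cspan g n"
| csc: "a \<in> Aalg g n \<Longrightarrow> b \<in> Aalg g n \<Longrightarrow> scomm a b \<in> cspan g n"
| csa: "x \<in> cspan g n \<Longrightarrow> y \<in> cspan g n \<Longrightarrow> sadd x y \<in> cspan g n"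
| css: "x \<in> cspan g n \<Longrightarrow> ssc c x \<in> cspan g n"

definition ccl :: "nat \<Rightarrow> nat \<Rightarrow> ('k::field_char_0) ser set" where
  "ccl g n = {a \<in> Aalg g n. \<forall>m. \<exists>s \<in> cspan g n. ssub a s \<in> filt m}"

text \<open>Double bracket on generators (Van den Bergh conventions):
  {{x_i,y_i}} = 1\<otimes>1, {{y_i,x_i}} = -1\<otimes>1, {{z_j,z_j}} = z_j\<otimes>1 - 1\<otimes>z_j, all others 0.
  For letters c (from the first word, cyclic remainder P) and d (from the second word,
  cyclic remainder Q), the contribution y' P y'' Q to the bracket, as a coefficient at w.\<close>
fun dbc :: "gen \<Rightarrow> gen \<Rightarrow> gen list \<Rightarrow> gen list \<Rightarrow> gen list \<Rightarrow> 'k::field_char_0" where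
  "dbc (X i) (Y j) P Q w = (if i = j \<and> w = P @ Q then 1 else 0)"
| "dbc (Y i) (X j) P Q w = (if i = j \<and> w = P @ Q then -1 else 0)"
| "dbc (Z i) (Z j) P Q w = (if i = j then (if w = Z i # P @ Q then 1 else 0)
                                         - (if w = P @ Z i # Q then 1 else 0) else 0)"
| "dbc _ _ _ _ _ = 0"

definition rot :: "'a list \<Rightarrow> nat \<Rightarrow> 'a list" where
  "rot u p = drop (Suc p) u @ take p u"

text \<open>Bracket of the cyclic words |u| and |v|, with a chosen linear representative.\<close>
definition wbr :: "gen list \<Rightarrow> gen list \<Rightarrow> ('k::field_char_0) ser" where
  "wbr u v w = (\<Sum>p<length u. \<Sum>q<length v. dbc (u ! p) (v ! q) (rot u p) (rot v q) w)"

text \<open>Bilinear extension to series (only finitely many pairs of words contribute at w).\<close>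
definition nbr :: "nat \<Rightarrow> nat \<Rightarrow> ('k::field_char_0) ser \<Rightarrow> 'k ser \<Rightarrow> 'k ser" where
  "nbr g n a b w = (\<Sum>(u, v) \<in> {(u, v). set u \<subseteq> letters g n \<and> set v \<subseteq> letters g n
                                 \<and> length u + length v \<le> length w + 2}.
                       a u * b v * wbr u v w)"

definition omega :: "nat \<Rightarrow> nat \<Rightarrow> ('k::field_char_0) ser" where
  "omega g n w = (\<Sum>i\<in>{1..g}. scomm (lt (X i)) (lt (Y i)) w) + (\<Sum>j\<in>{1..n}. lt (Z j) w)"

end

theory Submission
  imports Defs
begin

text \<open>
  Let \<open>\<theta>\<close> be one of the \<open>z\<^sub>j\<close> or \<open>\<omega>\<close>. All cyclic words \<open>|\<theta>\<^sup>k|\<close> are central for the necklace bracket,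
  hence so are all \<open>|F(\<theta>)\<^sup>k|\<close>. An element \<open>l\<close> of the completed free Lie algebra with
  \<open>F(\<theta>) = exp(-l) \<theta> exp(l)\<close> is built weight by weight: if equality holds below weight \<open>m\<close> and \<open>u\<close>
  is the error in weight \<open>m\<close>, then the cyclic words \<open>|\<theta>\<^sup>k u|\<close> are central for all \<open>k\<close>, and one has to
  show \<open>u = [\<theta>, h]\<close> for some Lie element \<open>h\<close>, which is then added to \<open>l\<close>.

  Bracketing \<open>|\<theta>\<^sup>k u|\<close> with \<open>|\<theta>\<^sup>l d\<^sup>M|\<close> for a letter \<open>d\<close> gives
  \<open>|\<theta>\<^sup>l ([d\<^sup>M, \<Sum>\<^sub>i \<theta>\<^sup>i u \<theta>\<^bsup>k-1-i\<^esup>] + r)| = 0\<close>, where \<open>r\<close> is spanned by products containing a full run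
  \<open>\<theta>\<^sup>k\<close>. Cyclic derivatives turn this into identities in the free algebra, and comparing coefficients
  in a basis in which the leading word of \<open>\<theta>\<close> is replaced by \<open>\<theta>\<close> itself shows that \<open>u\<close> lies in
  \<open>[\<theta>, A]\<close> up to powers of \<open>\<theta>\<close>. A Dynkin operator argument replaces \<open>A\<close> by the Lie algebra.
\<close>

section \<open>Noncommutative power series\<close>

text \<open>The obstacle is that the remainder \<open>r\<close> is known only by its shape: each
  term is an unbroken run \<open>\<theta>^k\<close> between words of weight at most
  \<open>C\<close>. As \<open>C\<close> does not depend on \<open>k\<close>, the exponent can be
  fixed after \<open>C\<close>. Coefficients are then read at words
  \<open>th^p d^M th^A v th^q\<close>, where \<open>d\<close> is a letter other than the first one
  of \<open>th\<close>: the marker \<open>d^M\<close> and the core \<open>v\<close> interrupt every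
  run that would be long enough, so \<open>r\<close> is invisible there. This reading is done twice,
  because centrality gives only cyclic identities. Bracketing with \<open>\<theta>^l d^M\<close>
  produces an element \<open>E\<close> for which all cyclic words \<open>|\<theta>^l E|\<close>
  vanish. A cyclic derivative turns this into \<open>[d, Sk l E] + r' = 0\<close> in the free
  algebra. Marker words give the vanishing of the relevant sums of coefficients of \<open>E\<close>;
  those at words that contain a marker themselves are the sums wanted for \<open>u\<close>. With a
  single letter there is no marker \<open>d\<close>, but then every word is a power of
  \<open>\<theta>\<close>. Since F induces the identity on the graded level, the first error has
  weight at least 3; the Dynkin argument divides by \<open>m - 2\<close>.\<close>

typedef ('a, 'k) ncs = "UNIV :: ('a list \<Rightarrow> 'k) set" morphisms cf Ncs
  by simp

lemma cf_Ncs [simp]: "cf (Ncs f) = f"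
  by (simp add: Ncs_inverse)

lemma Ncs_cf [simp]: "Ncs (cf a) = a"
  by (simp add: cf_inverse)

lemma ncs_eqI: "(\<And>w. cf a w = cf b w) \<Longrightarrow> a = b"
  by (metis cf_inject ext)

definition conv :: "('a list \<Rightarrow> 'k) \<Rightarrow> ('a list \<Rightarrow> 'k) \<Rightarrow> 'a list \<Rightarrow> 'k::comm_ring_1" where
  "conv a b w = (\<Sum>i\<le>length w. a (take i w) * b (drop i w))"

lemma conv_Nil: "conv a b [] = a [] * b []"
  by (simp add: conv_def)

lemma conv_Cons: "conv a b (c # w) = a [] * b (c # w) + conv (\<lambda>v. a (c # v)) b w"
  by (simp add: conv_def sum.atMost_Suc_shift del: sum.atMost_Suc)

lemma conv_add_left: "conv (\<lambda>w. a w + b w) c w = conv a c w + conv b c w"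
  by (simp add: conv_def sum.distrib distrib_right)

lemma conv_add_right: "conv c (\<lambda>w. a w + b w) w = conv c a w + conv c b w"
  by (simp add: conv_def sum.distrib distrib_left)

lemma conv_scale_left: "conv (\<lambda>w. k * a w) c w = k * conv a c w"
  by (simp add: conv_def sum_distrib_left mult.assoc)

lemma conv_assoc: "conv (conv a b) c w = conv a (conv b c) w"
proof (induction w arbitrary: a)
  case Nil
  show ?case by (simp add: conv_Nil mult.assoc)
next
  case (Cons x w)
  have "conv (\<lambda>v. conv a b (x # v)) c w
      = a [] * conv (\<lambda>v. b (x # v)) c w + conv (conv (\<lambda>v. a (x # v)) b) c w"
    by (simp add: conv_Cons conv_add_left conv_scale_left)
  then show ?case
    by (simp add: conv_Cons conv_Nil Cons.IH algebra_simps)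
qed

lemma conv_one_left: "conv (\<lambda>w. if w = [] then 1 else 0) a w = a w"
proof -
  have "conv (\<lambda>w. if w = [] then 1 else 0) a w = (\<Sum>i\<le>length w. if i = 0 then a w else 0)"
    unfolding conv_def by (intro sum.cong) (auto simp: take_eq_Nil)
  then show ?thesis by simp
qed

lemma conv_one_right: "conv a (\<lambda>w. if w = [] then 1 else 0) w = a w"
proof -
  have "conv a (\<lambda>w. if w = [] then 1 else 0) w = (\<Sum>i\<le>length w. if i = length w then a w else 0)"
    unfolding conv_def by (intro sum.cong) auto
  then show ?thesis by simp
qed

text \<open>The product is convolution over the splittings of a word, not pointwise, so series get a
  type of their own; powers, finite sums and ring simplification then come for free.
  \<open>cf\<close> leads back to the raw functions of the statement.\<close>

instantiation ncs :: (type, comm_ring_1) ring_1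
begin

definition "0 = Ncs (\<lambda>_. 0)"
definition "1 = Ncs (\<lambda>w. if w = [] then 1 else 0)"
definition "a + b = Ncs (\<lambda>w. cf a w + cf b w)"
definition "a - b = Ncs (\<lambda>w. cf a w - cf b w)"
definition "- a = Ncs (\<lambda>w. - cf a w)"
definition "a * b = Ncs (conv (cf a) (cf b))"

instance
proof
  fix a b c :: "('a, 'b) ncs"
  show "a + b + c = a + (b + c)" "a + b = b + a" "0 + a = a" "- a + a = 0" "a - b = a + - b"
    by (simp_all add: zero_ncs_def plus_ncs_def minus_ncs_def uminus_ncs_def algebra_simps)
  show "a * b * c = a * (b * c)"
    by (rule ncs_eqI) (simp add: times_ncs_def conv_assoc)
  show "1 * a = a" "a * 1 = a"
    by (auto intro!: ncs_eqI simp: times_ncs_def one_ncs_def conv_one_left conv_one_right)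
  show "(a + b) * c = a * c + b * c" "a * (b + c) = a * b + a * c"
    by (auto intro!: ncs_eqI simp: times_ncs_def plus_ncs_def conv_add_left conv_add_right)
  show "(0 :: ('a, 'b) ncs) \<noteq> 1"
  proof
    assume "(0 :: ('a, 'b) ncs) = 1"
    then have "cf (0 :: ('a, 'b) ncs) [] = cf 1 []" by simp
    then show False by (simp add: zero_ncs_def one_ncs_def)
  qed
qed

end

lemma cf_zero [simp]: "cf 0 w = 0"
  and cf_one: "cf 1 w = (if w = [] then 1 else 0)"
  and cf_add [simp]: "cf (a + b) w = cf a w + cf b w"
  and cf_diff [simp]: "cf (a - b) w = cf a w - cf b w"
  and cf_uminus [simp]: "cf (- a) w = - cf a w"
  and cf_mult: "cf (a * b) w = (\<Sum>i\<le>length w. cf a (take i w) * cf b (drop i w))"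
  by (simp_all add: zero_ncs_def one_ncs_def plus_ncs_def minus_ncs_def uminus_ncs_def
      times_ncs_def conv_def)

lemma cf_sum [simp]: "cf (sum f S) w = (\<Sum>i\<in>S. cf (f i) w)"
  by (induction S rule: infinite_finite_induct) auto

definition scl :: "'k::comm_ring_1 \<Rightarrow> ('a, 'k) ncs \<Rightarrow> ('a, 'k) ncs" where
  "scl k a = Ncs (\<lambda>w. k * cf a w)"

lemma cf_scl [simp]: "cf (scl k a) w = k * cf a w"
  by (simp add: scl_def)

lemma scl_simps [simp]:
  "scl 0 a = 0" "scl 1 a = a" "scl k 0 = 0" "scl k (scl l a) = scl (k * l) a"
  "scl k a * b = scl k (a * b)" "a * scl k b = scl k (a * b)"
  "scl (- k) a = - scl k a" "scl k (- a) = - scl k a"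
  by (auto intro!: ncs_eqI simp: cf_mult sum_distrib_left mult_ac)

lemma scl_distrib:
  "scl k (a + b) = scl k a + scl k b" "scl (k + l) a = scl k a + scl l a"
  "scl k (a - b) = scl k a - scl k b" "scl (k - l) a = scl k a - scl l a"
  by (auto intro!: ncs_eqI simp: algebra_simps)

lemma scl_sum: "scl k (sum f S) = (\<Sum>i\<in>S. scl k (f i))"
  by (auto intro!: ncs_eqI simp: sum_distrib_left)

lemma scl_of_nat: "scl (of_nat n) a = of_nat n * a"
  by (induction n) (auto simp: scl_distrib algebra_simps)

definition monom :: "'a list \<Rightarrow> ('a, 'k::comm_ring_1) ncs" where
  "monom u = Ncs (\<lambda>w. if w = u then 1 else 0)"

lemma cf_monom: "cf (monom u) w = (if w = u then 1 else 0)"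
  by (simp add: monom_def)

lemma cf_monom_mult:
  "cf (monom u * a) w = (if take (length u) w = u then cf a (drop (length u) w) else 0)"
proof -
  have "cf (monom u * a) w = (\<Sum>i\<le>length w. if i = length u then
      (if take (length u) w = u then cf a (drop (length u) w) else 0) else 0)"
    unfolding cf_mult by (intro sum.cong) (auto simp: cf_monom)
  also have "\<dots> = (if take (length u) w = u then cf a (drop (length u) w) else 0)"
    by (auto simp: sum.delta dest: arg_cong[where f = length])
  finally show ?thesis .
qed

lemma cf_monom_mult_append [simp]: "cf (monom u * a) (u @ w) = cf a w"
  by (simp add: cf_monom_mult)

lemma cf_mult_monom:
  "cf (a * monom u) w = (if \<exists>v. w = v @ u then cf a (take (length w - length u) w) else 0)"
proof -
  have "cf (a * monom u) w = (\<Sum>i\<le>length w. if i = length w - length u then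
      (if \<exists>v. w = v @ u then cf a (take (length w - length u) w) else 0) else 0)"
    unfolding cf_mult
  proof (intro sum.cong refl)
    fix i assume i: "i \<in> {..length w}"
    have "drop i w = u \<longleftrightarrow> i = length w - length u \<and> (\<exists>v. w = v @ u)"
      using i by (auto intro: exI[of _ "take i w"])
    then show "cf a (take i w) * cf (monom u) (drop i w) = (if i = length w - length u then
      (if \<exists>v. w = v @ u then cf a (take (length w - length u) w) else 0) else 0)"
      by (auto simp: cf_monom)
  qed
  also have "\<dots> = (if \<exists>v. w = v @ u then cf a (take (length w - length u) w) else 0)"
    by (simp add: sum.delta)
  finally show ?thesis .
qed

lemma cf_mult_monom_append [simp]: "cf (a * monom u) (w @ u) = cf a w"
  by (auto simp: cf_mult_monom)

lemma monom_Nil [simp]: "monom [] = 1"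
  by (auto intro!: ncs_eqI simp: cf_monom cf_one)

lemma monom_append: "monom (u @ v) = monom u * monom v"
proof (rule ncs_eqI)
  fix w
  show "cf (monom (u @ v)) w = cf (monom u * monom v) w"
    by (auto simp: cf_monom_mult cf_monom) (metis append_take_drop_id)
qed

definition vr :: "'a \<Rightarrow> ('a, 'k::comm_ring_1) ncs" where
  "vr c = monom [c]"

lemma monom_Cons: "monom (c # v) = vr c * monom v"
  using monom_append[of "[c]" v] by (simp add: vr_def)

section \<open>Finitely supported series and linear extension from words\<close>

definition fin :: "('a, 'k::comm_ring_1) ncs \<Rightarrow> bool" where
  "fin a \<longleftrightarrow> finite {w. cf a w \<noteq> 0}"

lemma fin_subset: "finite S \<Longrightarrow> (\<And>w. cf a w \<noteq> 0 \<Longrightarrow> w \<in> S) \<Longrightarrow> fin a"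
  unfolding fin_def by (rule finite_subset) auto

lemma fin_0 [simp]: "fin 0" and fin_monom [simp]: "fin (monom u)"
  by (auto simp: fin_def cf_monom)

lemma fin_vr [simp]: "fin (vr c)"
  by (simp add: vr_def)

lemma fin_1 [simp]: "fin 1"
  using fin_monom[of "[]"] by simp

lemma fin_add [simp]: "fin a \<Longrightarrow> fin b \<Longrightarrow> fin (a + b)"
  by (rule fin_subset[of "{w. cf a w \<noteq> 0} \<union> {w. cf b w \<noteq> 0}"]) (auto simp: fin_def)

lemma fin_uminus [simp]: "fin a \<Longrightarrow> fin (- a)"
  by (simp add: fin_def)

lemma fin_diff [simp]: "fin a \<Longrightarrow> fin b \<Longrightarrow> fin (a - b)"
  using fin_add[of a "- b"] by simp

lemma fin_scl [simp]: "fin a \<Longrightarrow> fin (scl k a)"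
  by (rule fin_subset[of "{w. cf a w \<noteq> 0}"]) (auto simp: fin_def)

lemma fin_sum [simp]: "(\<And>i. i \<in> S \<Longrightarrow> fin (f i)) \<Longrightarrow> fin (sum f S)"
  by (induction S rule: infinite_finite_induct) auto

lemma fin_mult [simp]:
  assumes "fin a" "fin b" shows "fin (a * b)"
proof (rule fin_subset)
  show "finite ((\<lambda>(u, v). u @ v) ` ({w. cf a w \<noteq> 0} \<times> {w. cf b w \<noteq> 0}))"
    using assms by (auto simp: fin_def)
  fix w assume "cf (a * b) w \<noteq> 0"
  then obtain i where "cf a (take i w) * cf b (drop i w) \<noteq> 0"
    unfolding cf_mult by (meson sum.neutral)
  then have "cf a (take i w) \<noteq> 0" "cf b (drop i w) \<noteq> 0"
    by auto
  then show "w \<in> (\<lambda>(u, v). u @ v) ` ({w. cf a w \<noteq> 0} \<times> {w. cf b w \<noteq> 0})"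
    by (auto intro!: image_eqI[of _ _ "(take i w, drop i w)"])
qed

lemma fin_power [simp]: "fin a \<Longrightarrow> fin (a ^ k)"
  by (induction k) auto

text \<open>On series of infinite support the value is the junk \<open>0\<close>.\<close>

definition lin :: "('a list \<Rightarrow> ('b, 'k) ncs) \<Rightarrow> ('a, 'k::comm_ring_1) ncs \<Rightarrow> ('b, 'k) ncs" where
  "lin f a = (\<Sum>u | cf a u \<noteq> 0. scl (cf a u) (f u))"

lemma lin_superset:
  assumes "finite S" "\<And>w. cf a w \<noteq> 0 \<Longrightarrow> w \<in> S"
  shows "lin f a = (\<Sum>u\<in>S. scl (cf a u) (f u))"
  unfolding lin_def by (rule sum.mono_neutral_left) (use assms in auto)

lemma lin_0 [simp]: "lin f 0 = 0"
  by (simp add: lin_def)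

lemma lin_monom [simp]: "lin f (monom u) = f u"
  by (subst lin_superset[of "{u}"]) (auto simp: cf_monom split: if_splits)

lemma lin_vr [simp]: "lin f (vr c) = f [c]"
  by (simp add: vr_def)

lemma lin_1 [simp]: "lin f 1 = f []"
  using lin_monom[of f "[]"] by simp

lemma lin_add [simp]:
  assumes "fin a" "fin b" shows "lin f (a + b) = lin f a + lin f b"
proof -
  let ?S = "{w. cf a w \<noteq> 0} \<union> {w. cf b w \<noteq> 0}"
  have S: "finite ?S" using assms by (auto simp: fin_def)
  have "lin f c = (\<Sum>u\<in>?S. scl (cf c u) (f u))" if "c \<in> {a, b, a + b}" for c
    by (rule lin_superset[OF S]) (use that in auto)
  then show ?thesis by (simp add: scl_distrib sum.distrib)
qed

lemma lin_scl [simp]: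
  assumes "fin a" shows "lin f (scl k a) = scl k (lin f a)"
proof -
  let ?S = "{w. cf a w \<noteq> 0}"
  have S: "finite ?S" using assms by (auto simp: fin_def)
  have "lin f c = (\<Sum>u\<in>?S. scl (cf c u) (f u))" if "c \<in> {a, scl k a}" for c
    by (rule lin_superset[OF S]) (use that in auto)
  then show ?thesis by (simp add: scl_sum)
qed

lemma lin_uminus [simp]: "fin a \<Longrightarrow> lin f (- a) = - lin f a"
  using lin_scl[of a f "-1"] by simp

lemma lin_diff [simp]: "fin a \<Longrightarrow> fin b \<Longrightarrow> lin f (a - b) = lin f a - lin f b"
  using lin_add[of a "- b" f] by simp

lemma lin_sum [simp]: "(\<And>i. i \<in> S \<Longrightarrow> fin (g i)) \<Longrightarrow> lin f (sum g S) = (\<Sum>i\<in>S. lin f (g i))"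
  by (induction S rule: infinite_finite_induct) auto

lemma fin_lin [simp]: "(\<And>w. fin (f w)) \<Longrightarrow> fin (lin f a)"
  by (simp add: lin_def)

lemma lin_monom_id:
  assumes "fin a" shows "lin monom a = a"
proof (rule ncs_eqI)
  fix w
  have "cf (lin monom a) w = (\<Sum>u | cf a u \<noteq> 0. if u = w then cf a w else 0)"
    unfolding lin_def cf_sum by (intro sum.cong) (auto simp: cf_monom)
  also have "\<dots> = cf a w"
    using assms by (simp add: fin_def sum.delta)
  finally show "cf (lin monom a) w = cf a w" .
qed

lemma cf_lin: "cf (lin f a) w = (\<Sum>u | cf a u \<noteq> 0. cf a u * cf (f u) w)"
  by (simp add: lin_def)

lemma lin_cong: "(\<And>w. cf a w \<noteq> 0 \<Longrightarrow> f w = g w) \<Longrightarrow> lin f a = lin g a"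
  unfolding lin_def by (intro sum.cong) auto

lemma fin_induct [consumes 1, case_names zero monom add scl]:
  assumes "fin a" and "P 0" and "\<And>w. cf a w \<noteq> 0 \<Longrightarrow> P (monom w)"
    and "\<And>a b. fin a \<Longrightarrow> fin b \<Longrightarrow> P a \<Longrightarrow> P b \<Longrightarrow> P (a + b)"
    and "\<And>k a. fin a \<Longrightarrow> P a \<Longrightarrow> P (scl k a)"
  shows "P a"
proof -
  have "fin (\<Sum>u\<in>S. scl (cf a u) (monom u)) \<and> P (\<Sum>u\<in>S. scl (cf a u) (monom u))"
    if "finite S" "S \<subseteq> {u. cf a u \<noteq> 0}" for S
    using that by (induction S rule: finite_induct) (auto intro!: assms)
  then have "P (lin monom a)"
    using assms(1) unfolding lin_def fin_def by blast
  then show ?thesis using assms(1) by (simp add: lin_monom_id)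
qed

lemma lin_mult_hom:
  assumes "fin a" "fin b" and "\<And>u v. f (u @ v) = f u * f v"
  shows "lin f (a * b) = lin f a * lin f b"
  using assms(1)
proof (induction rule: fin_induct)
  case (monom u)
  show ?case using assms(2)
    by (induction rule: fin_induct)
      (auto simp: assms(3) distrib_left simp flip: monom_append)
qed (use assms in \<open>auto simp: distrib_right\<close>)

abbreviation cm :: "'a::ring \<Rightarrow> 'a \<Rightarrow> 'a" where
  "cm a b \<equiv> a * b - b * a"

section \<open>Primitive elements and the Dynkin operator\<close>

definition hm :: "gen set \<Rightarrow> nat \<Rightarrow> (gen, 'k::comm_ring_1) ncs \<Rightarrow> bool" where
  "hm S m a \<longleftrightarrow> (\<forall>w. cf a w \<noteq> 0 \<longrightarrow> set w \<subseteq> S \<and> wtw w = m)"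

lemma wtw_Nil [simp]: "wtw [] = 0"
  and wtw_Cons [simp]: "wtw (c # w) = wt c + wtw w"
  and wtw_append [simp]: "wtw (u @ v) = wtw u + wtw v"
  by (simp_all add: wtw_def)

lemma wt_pos [simp]: "0 < wt c"
  by (cases c) auto

lemma length_le_wtw: "length w \<le> wtw w"
proof (induction w)
  case (Cons c w)
  then show ?case using wt_pos[of c] by (simp add: Suc_le_eq add_strict_increasing del: wt_pos)
qed simp

lemma wtw_eq_0 [simp]: "wtw w = 0 \<longleftrightarrow> w = []"
  by (cases w) auto

lemma finite_words: "finite S \<Longrightarrow> finite {w. set w \<subseteq> S \<and> wtw w \<le> m}"
  by (rule finite_subset[OF _ finite_lists_length_le[of S m]])
    (auto intro: le_trans[OF length_le_wtw])

lemma hm_fin: "finite S \<Longrightarrow> hm S m a \<Longrightarrow> fin a"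
  by (rule fin_subset[OF finite_words[of S m]]) (auto simp: hm_def)

lemma hm_0 [simp]: "hm S m 0"
  by (simp add: hm_def)

lemma hm_monom: "set w \<subseteq> S \<Longrightarrow> wtw w = m \<Longrightarrow> hm S m (monom w)"
  by (simp add: hm_def cf_monom)

lemma cf_vr: "cf (vr c) w = (if w = [c] then 1 else 0)"
  by (simp add: vr_def cf_monom)

lemma hm_vr: "c \<in> S \<Longrightarrow> wt c = m \<Longrightarrow> hm S m (vr c)"
  by (simp add: hm_def cf_vr)

lemma hm_add [simp]: "hm S m a \<Longrightarrow> hm S m b \<Longrightarrow> hm S m (a + b)"
  unfolding hm_def by (metis add.right_neutral cf_add)

lemma hm_uminus [simp]: "hm S m a \<Longrightarrow> hm S m (- a)"
  by (simp add: hm_def)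

lemma hm_diff [simp]: "hm S m a \<Longrightarrow> hm S m b \<Longrightarrow> hm S m (a - b)"
  using hm_add[of S m a "- b"] by simp

lemma hm_scl [simp]: "hm S m a \<Longrightarrow> hm S m (scl k a)"
  unfolding hm_def cf_scl by (metis mult_zero_right)

lemma hm_sum: "(\<And>i. i \<in> I \<Longrightarrow> hm S m (f i)) \<Longrightarrow> hm S m (sum f I)"
  by (induction I rule: infinite_finite_induct) auto

lemma hm_mult:
  assumes "hm S m a" "hm S n b" shows "hm S (m + n) (a * b)"
  unfolding hm_def
proof (intro allI impI)
  fix w assume "cf (a * b) w \<noteq> 0"
  then obtain i where "cf a (take i w) * cf b (drop i w) \<noteq> 0"
    unfolding cf_mult by (meson sum.neutral)
  then have "cf a (take i w) \<noteq> 0" "cf b (drop i w) \<noteq> 0"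
    by auto
  with assms have "set (take i w) \<subseteq> S" "set (drop i w) \<subseteq> S" "wtw (take i w) + wtw (drop i w) = m + n"
    by (auto simp: hm_def)
  then show "set w \<subseteq> S \<and> wtw w = m + n"
    by (metis Un_least append_take_drop_id set_append wtw_append)
qed

lemma hm_power: "hm S m a \<Longrightarrow> hm S (k * m) (a ^ k)"
proof (induction k)
  case 0
  show ?case by (auto simp: hm_def cf_one)
next
  case (Suc k)
  then show ?case using hm_mult[of S m a "k * m" "a ^ k"] by (metis mult_Suc power_Suc)
qed

lemma hm_lin:
  assumes "hm S m a" and f: "\<And>w. set w \<subseteq> S \<Longrightarrow> wtw w = m \<Longrightarrow> hm S n (f w)"
  shows "hm S n (lin f a)"
  unfolding lin_def
proof (rule hm_sum)
  fix w assume "w \<in> {w. cf a w \<noteq> 0}"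
  with assms(1) have "set w \<subseteq> S" "wtw w = m" unfolding hm_def by auto
  then show "hm S n (scl (cf a w) (f w))" using f by simp
qed

lemma hm_cm: "hm S m a \<Longrightarrow> hm S n b \<Longrightarrow> hm S (m + n) (cm a b)"
  using hm_mult[of S m a n b] hm_mult[of S n b m a] by (simp add: add.commute)

section \<open>Shuffle coproduct and primitive elements\<close>

lemma shuf_Nil_right [simp]: "shuf u [] = [u]"
  by (cases u) auto

lemma cop_Nil [simp]: "cop a [] v = a v" "cop a u [] = a u"
  by (simp_all add: cop_def)

lemma cop_Cons: "cop a (c # u) (d # v) = cop (\<lambda>w. a (c # w)) u (d # v) + cop (\<lambda>w. a (d # w)) (c # u) v"
  by (simp add: cop_def o_def)

lemma sum_list_map_add: "(\<Sum>x\<leftarrow>xs. f x + g x) = (\<Sum>x\<leftarrow>xs. f x) + (\<Sum>x\<leftarrow>xs. g x :: 'a::comm_monoid_add)"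
  by (induction xs) (auto simp: algebra_simps)

lemma cop_add: "cop (\<lambda>w. a w + b w) u v = cop a u v + cop b u v"
  by (simp add: cop_def sum_list_map_add)

lemma cop_scale: "cop (\<lambda>w. k * a w) u v = k * cop a u v"
  by (simp add: cop_def sum_list_const_mult)

text \<open>Multiplicativity of the coproduct,
  \<open>\<Delta>(ab) = \<Delta>(a) \<Delta>(b)\<close>. A shuffle starts with the first letter of
  \<open>u\<close> or of \<open>v\<close>, so the induction strips that letter from the argument
  \<open>a\<close>.\<close>

lemma cop_conv:
  "cop (conv a b) u v = (\<Sum>i\<le>length u. \<Sum>j\<le>length v.
     cop a (take i u) (take j v) * cop b (drop i u) (drop j v))"
proof (induction "length u + length v" arbitrary: a u v rule: less_induct)
  case less
  show ?case
  proof (cases u)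
    case Nil
    then show ?thesis by (simp add: conv_def)
  next
    case u: (Cons c u')
    show ?thesis
    proof (cases v)
      case Nil
      then show ?thesis by (simp add: conv_def)
    next
      case v: (Cons d v')
      define G where "G i j = cop b (drop i u) (drop j v)" for i j
      define ac ad where "ac = (\<lambda>w. a (c # w))" and "ad = (\<lambda>w. a (d # w))"
      have H: "cop a (take i u) (take j v) =
          (case i of 0 \<Rightarrow> 0 | Suc i' \<Rightarrow> cop ac (take i' u') (take j v))
        + (case j of 0 \<Rightarrow> 0 | Suc j' \<Rightarrow> cop ad (take i u) (take j' v'))
        + (if i = 0 \<and> j = 0 then a [] else 0)" for i j
        by (auto simp: u v ac_def ad_def cop_Cons split: nat.split)
      have "cop (conv a b) u v = cop (\<lambda>w. conv a b (c # w)) u' v + cop (\<lambda>w. conv a b (d # w)) u v'"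
        by (simp add: u v cop_Cons)
      also have "\<dots> = a [] * cop b u v + cop (conv ac b) u' v + cop (conv ad b) u v'"
        by (simp add: u v cop_Cons conv_Cons cop_add cop_scale ac_def ad_def algebra_simps)
      also have "cop (conv ac b) u' v
          = (\<Sum>i\<le>length u'. \<Sum>j\<le>length v. cop ac (take i u') (take j v) * G (Suc i) j)"
        by (subst less) (auto simp: u G_def)
      also have "cop (conv ad b) u v'
          = (\<Sum>i\<le>length u. \<Sum>j\<le>length v'. cop ad (take i u) (take j v') * G i (Suc j))"
        by (subst less) (auto simp: v G_def)
      also have "a [] * cop b u v
          = (\<Sum>i\<le>length u. \<Sum>j\<le>length v. (if i = 0 \<and> j = 0 then a [] else 0) * G i j)"
      proof -
        have "(\<Sum>i\<le>length u. \<Sum>j\<le>length v. (if i = 0 \<and> j = 0 then a [] else 0) * G i j)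
            = (\<Sum>i\<le>length u. if i = 0 then a [] * G 0 0 else 0)"
        proof (intro sum.cong refl)
          fix i
          have "(\<Sum>j\<le>length v. (if i = 0 \<and> j = 0 then a [] else 0) * G i j)
              = (\<Sum>j\<le>length v. if j = 0 then (if i = 0 then a [] * G 0 0 else 0) else 0)"
            by (intro sum.cong) auto
          then show "(\<Sum>j\<le>length v. (if i = 0 \<and> j = 0 then a [] else 0) * G i j)
              = (if i = 0 then a [] * G 0 0 else 0)" by simp
        qed
        then show ?thesis by (simp add: G_def)
      qed
      also have "(\<Sum>i\<le>length u'. \<Sum>j\<le>length v. cop ac (take i u') (take j v) * G (Suc i) j)
         = (\<Sum>i\<le>length u. \<Sum>j\<le>length v.
              (case i of 0 \<Rightarrow> 0 | Suc i' \<Rightarrow> cop ac (take i' u') (take j v)) * G i j)"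
        by (simp add: u sum.atMost_Suc_shift del: sum.atMost_Suc)
      also have "(\<Sum>i\<le>length u. \<Sum>j\<le>length v'. cop ad (take i u) (take j v') * G i (Suc j))
         = (\<Sum>i\<le>length u. \<Sum>j\<le>length v.
              (case j of 0 \<Rightarrow> 0 | Suc j' \<Rightarrow> cop ad (take i u) (take j' v')) * G i j)"
        by (simp add: v sum.atMost_Suc_shift del: sum.atMost_Suc)
      finally show ?thesis
        by (simp add: H distrib_right sum.distrib G_def algebra_simps)
    qed
  qed
qed

definition prim :: "(gen, 'k::field_char_0) ncs \<Rightarrow> bool" where
  "prim a \<longleftrightarrow> (\<forall>u v. cop (cf a) u v = (if v = [] then cf a u else 0) + (if u = [] then cf a v else 0))"

lemma prim_Nil: "prim a \<Longrightarrow> cf a [] = 0"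
proof -
  assume "prim a"
  then have "cop (cf a) [] [] = cf a [] + cf a []"
    unfolding prim_def by (auto simp del: cop_Nil)
  then show ?thesis by simp
qed

lemma cop_cf_add: "cop (cf (a + b)) u v = cop (cf a) u v + cop (cf b) u v"
  using cop_add[of "cf a" "cf b"] by (simp add: plus_ncs_def)

lemma cop_cf_scl: "cop (cf (scl k a)) u v = k * cop (cf a) u v"
  using cop_scale[of k "cf a"] by (simp add: scl_def)

lemma prim_0 [simp]: "prim 0"
proof -
  have "cf (0 :: (gen, 'a) ncs) = (\<lambda>_. 0)" by (rule ext) simp
  then show ?thesis by (simp add: prim_def cop_def)
qed

lemma prim_add [simp]: "prim a \<Longrightarrow> prim b \<Longrightarrow> prim (a + b)"
  by (simp add: prim_def cop_cf_add)

lemma prim_scl [simp]: "prim a \<Longrightarrow> prim (scl k a)"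
  by (simp add: prim_def cop_cf_scl)

lemma prim_uminus [simp]: "prim a \<Longrightarrow> prim (- a)"
  using prim_scl[of a "-1"] by simp

lemma prim_diff [simp]: "prim a \<Longrightarrow> prim b \<Longrightarrow> prim (a - b)"
  using prim_add[of a "- b"] by simp

lemma prim_sum: "(\<And>i. i \<in> I \<Longrightarrow> prim (f i)) \<Longrightarrow> prim (sum f I)"
  by (induction I rule: infinite_finite_induct) auto

lemma length_shuf: "w \<in> set (shuf u v) \<Longrightarrow> length w = length u + length v"
  by (induction u v arbitrary: w rule: shuf.induct) auto

lemma wtw_shuf: "w \<in> set (shuf u v) \<Longrightarrow> wtw w = wtw u + wtw v"
  by (induction u v arbitrary: w rule: shuf.induct) auto

lemma prim_letter [simp]: "prim (vr c :: (gen, 'k::field_char_0) ncs)"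
  unfolding prim_def
proof (intro allI)
  fix u v
  let ?V = "vr c :: (gen, 'k) ncs"
  show "cop (cf ?V) u v = (if v = [] then cf ?V u else 0) + (if u = [] then cf ?V v else 0)"
  proof (cases "u = [] \<or> v = []")
    case True
    then show ?thesis by (auto simp: cf_vr)
  next
    case False
    then have "length u + length v \<noteq> 1" by (cases u; cases v) auto
    then have "cf ?V w = 0" if "w \<in> set (shuf u v)" for w
      using length_shuf[OF that] by (auto simp: cf_vr)
    then have "map (cf ?V) (shuf u v) = map (\<lambda>_. 0) (shuf u v)"
      by (intro map_cong refl)
    then have "cop (cf ?V) u v = sum_list (map (\<lambda>_. 0) (shuf u v))"
      unfolding cop_def by (rule arg_cong)
    then have "cop (cf ?V) u v = 0" by simp
    then show ?thesis using False by simp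
  qed
qed

text \<open>The mixed part of \<open>(a \<otimes> 1 + 1 \<otimes> a)(b \<otimes> 1 + 1 \<otimes>
  b)\<close>. Its symmetry in \<open>a\<close> and \<open>b\<close> is what makes commutators
  primitive.\<close>

lemma cop_mult_prim:
  assumes "prim a" "prim b" "u \<noteq> []" "v \<noteq> []"
  shows "cop (cf (a * b)) u v = cf a u * cf b v + cf a v * cf b u"
proof -
  have "cop (cf (a * b)) u v = (\<Sum>i\<le>length u. \<Sum>j\<le>length v.
     cop (cf a) (take i u) (take j v) * cop (cf b) (drop i u) (drop j v))"
    using cop_conv[of "cf a" "cf b"] by (simp add: times_ncs_def)
  also have "\<dots> = (\<Sum>i\<le>length u. \<Sum>j\<le>length v.
      (if i = length u then (if j = 0 then cf a u * cf b v else 0) else 0)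
    + (if i = 0 then (if j = length v then cf a v * cf b u else 0) else 0))"
    using assms(3,4) prim_Nil[OF assms(1)] prim_Nil[OF assms(2)]
    by (intro sum.cong refl)
      (auto simp: assms(1,2)[unfolded prim_def, rule_format] take_eq_Nil)
  also have "\<dots> = cf a u * cf b v + cf a v * cf b u"
    by (subst sum.swap) (simp add: sum.distrib)
  finally show ?thesis .
qed

lemma prim_cm [simp]:
  assumes "prim a" "prim b" shows "prim (cm a b)"
  unfolding prim_def
proof (intro allI)
  fix u v
  have "cop (cf (cm a b)) u v = cop (cf (a * b)) u v - cop (cf (b * a)) u v"
    using cop_cf_add[of "a * b" "scl (-1) (b * a)"] cop_cf_scl[of "-1" "b * a"] by simp
  moreover have "cf (cm a b) [] = 0"
    by (simp add: cf_mult)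
  ultimately show "cop (cf (cm a b)) u v = (if v = [] then cf (cm a b) u else 0) + (if u = [] then cf (cm a b) v else 0)"
    using cop_mult_prim[OF assms] cop_mult_prim[OF assms(2,1)]
    by (cases "u = []"; cases "v = []") (auto simp: algebra_simps)
qed

text \<open>The coproduct of the single word \<open>w\<close>: all splittings into complementary
  subsequences, with multiplicity. Dual to \<open>shuf\<close> by
  \<open>count_unshuf\<close>.\<close>

fun unshuf :: "'a list \<Rightarrow> ('a list \<times> 'a list) list" where
  "unshuf [] = [([], [])]"
| "unshuf (c # w) = map (\<lambda>(p, q). (c # p, q)) (unshuf w) @ map (\<lambda>(p, q). (p, c # q)) (unshuf w)"

lemma count_map_Cons: "count_list (map (Cons a) L) w = (case w of [] \<Rightarrow> 0 | c # w' \<Rightarrow> if a = c then count_list L w' else 0)"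
  by (induction L) (auto split: list.split)

lemma count_map_fst: "count_list (map (\<lambda>(p, q). (c # p, q)) L) (p, q)
    = (case p of [] \<Rightarrow> 0 | a # p' \<Rightarrow> if a = c then count_list L (p', q) else 0)"
  by (induction L) (auto split: list.split)

lemma count_map_snd: "count_list (map (\<lambda>(p, q). (p, c # q)) L) (p, q)
    = (case q of [] \<Rightarrow> 0 | a # q' \<Rightarrow> if a = c then count_list L (p, q') else 0)"
  by (induction L) (auto split: list.split)

lemma count_unshuf: "count_list (unshuf w) (p, q) = count_list (shuf p q) w"
proof (induction w arbitrary: p q)
  case Nil
  show ?case by (cases p; cases q) (auto simp: count_map_Cons)
next
  case (Cons c w)
  show ?case
    by (cases p; cases q) (auto simp: count_map_Cons count_map_fst count_map_snd Cons.IH)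
qed

lemma sum_list_count:
  fixes f :: "'b \<Rightarrow> ('a, 'k::comm_ring_1) ncs"
  assumes "finite D" "set xs \<subseteq> D"
  shows "sum_list (map f xs) = (\<Sum>y\<in>D. scl (of_nat (count_list xs y)) (f y))"
  using assms(2)
proof (induction xs)
  case (Cons x xs)
  have "(\<Sum>y\<in>D. scl (of_nat (count_list (x # xs) y)) (f y))
      = (\<Sum>y\<in>D. (if y = x then f x else 0) + scl (of_nat (count_list xs y)) (f y))"
    by (intro sum.cong) (auto simp: scl_distrib)
  also have "\<dots> = f x + (\<Sum>y\<in>D. scl (of_nat (count_list xs y)) (f y))"
    using assms(1) Cons.prems by (simp add: sum.distrib sum.delta)
  finally show ?case using Cons by simp
qed simp

lemma sum_list_count_ring:
  fixes f :: "'b \<Rightarrow> 'k::comm_ring_1"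
  assumes "finite D" "\<And>x. x \<in> set xs \<Longrightarrow> f x \<noteq> 0 \<Longrightarrow> x \<in> D"
  shows "sum_list (map f xs) = (\<Sum>y\<in>D. of_nat (count_list xs y) * f y)"
  using assms(2)
proof (induction xs)
  case (Cons x xs)
  have "(\<Sum>y\<in>D. of_nat (count_list (x # xs) y) * f y)
      = (\<Sum>y\<in>D. (if y = x then f x else 0) + of_nat (count_list xs y) * f y)"
    by (intro sum.cong) (auto simp: algebra_simps)
  also have "\<dots> = f x + (\<Sum>y\<in>D. of_nat (count_list xs y) * f y)"
    using assms(1) Cons.prems by (auto simp: sum.distrib sum.delta)
  finally show ?case using Cons by simp
qed simp

text \<open>Exchanging the sums turns the left side into \<open>\<Delta>(a)\<close> evaluated on the
  bilinear map \<open>f\<close>, and \<open>\<Delta>(a) = a \<otimes> 1 + 1 \<otimes> a\<close>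
  leaves only the terms with an empty side.\<close>

lemma lin_unshuf_prim:
  fixes f :: "gen list \<Rightarrow> gen list \<Rightarrow> (gen, 'k::field_char_0) ncs"
  assumes "fin a" "prim a"
  shows "lin (\<lambda>w. \<Sum>(p, q)\<leftarrow>unshuf w. f p q) a = lin (\<lambda>p. f p []) a + lin (\<lambda>q. f [] q) a"
proof -
  define W where "W = {w. cf a w \<noteq> 0}"
  define D where "D = W \<union> {[]} \<union> (\<Union>w\<in>W. fst ` set (unshuf w)) \<union> (\<Union>w\<in>W. snd ` set (unshuf w))"
  have W: "finite W" using assms(1) by (simp add: W_def fin_def)
  then have D: "finite D" by (simp add: D_def)
  have sub: "set (unshuf w) \<subseteq> D \<times> D" if "w \<in> W" for w
    using that by (force simp: D_def)
  have "lin (\<lambda>w. \<Sum>(p, q)\<leftarrow>unshuf w. f p q) a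
      = (\<Sum>w\<in>W. scl (cf a w) (\<Sum>y\<in>D \<times> D. scl (of_nat (count_list (unshuf w) y)) (case y of (p, q) \<Rightarrow> f p q)))"
    unfolding lin_def W_def[symmetric]
    using D sub by (intro sum.cong refl arg_cong[of _ _ "scl _"] sum_list_count) auto
  also have "\<dots> = (\<Sum>(p, q)\<in>D \<times> D. scl (\<Sum>w\<in>W. of_nat (count_list (shuf p q) w) * cf a w) (f p q))"
    unfolding scl_sum
    by (subst sum.swap, intro sum.cong refl ncs_eqI)
      (auto simp: count_unshuf sum_distrib_left mult_ac intro!: sum.cong)
  also have "\<dots> = (\<Sum>(p, q)\<in>D \<times> D. scl (cop (cf a) p q) (f p q))"
    unfolding cop_def using W by (intro sum.cong refl) (auto simp: W_def sum_list_count_ring[of "{w. cf a w \<noteq> 0}"])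
  also have "\<dots> = (\<Sum>p\<in>D. \<Sum>q\<in>D. (if q = [] then scl (cf a p) (f p []) else 0) + (if p = [] then scl (cf a q) (f [] q) else 0))"
    unfolding sum.cartesian_product[symmetric] using prim_Nil[OF assms(2)]
    by (intro sum.cong refl) (auto simp: assms(2)[unfolded prim_def, rule_format])
  also have "\<dots> = (\<Sum>p\<in>D. scl (cf a p) (f p [])) + (\<Sum>q\<in>D. scl (cf a q) (f [] q))"
  proof -
    have e: "[] \<in> D" by (simp add: D_def)
    have "(\<Sum>p\<in>D. \<Sum>q\<in>D. if q = [] then scl (cf a p) (f p []) else 0) = (\<Sum>p\<in>D. scl (cf a p) (f p []))"
      using D e by (simp add: sum.delta)
    moreover have "(\<Sum>p\<in>D. \<Sum>q\<in>D. if p = [] then scl (cf a q) (f [] q) else 0) = (\<Sum>q\<in>D. scl (cf a q) (f [] q))"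
      using D e by (subst sum.swap) (simp add: sum.delta)
    ultimately show ?thesis by (simp add: sum.distrib)
  qed
  also have "\<dots> = lin (\<lambda>p. f p []) a + lin (\<lambda>q. f [] q) a"
    using D by (simp add: lin_superset[of D] D_def W_def)
  finally show ?thesis .
qed

section \<open>Adjoint action and Dynkin operator\<close>

fun adw :: "gen list \<Rightarrow> (gen, 'k::comm_ring_1) ncs \<Rightarrow> (gen, 'k) ncs" where
  "adw [] x = x"
| "adw (c # w) x = cm (vr c) (adw w x)"

text \<open>Dynkin's right-normed bracketing, with the innermost letter scaled by its weight. The
  eigenvalue on Lie elements is then the weight rather than the word length, as
  \<open>\<omega>\<close> mixes lengths but not weights.\<close>

fun rw :: "gen list \<Rightarrow> (gen, 'k::comm_ring_1) ncs" where
  "rw [] = 0"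
| "rw (c # w) = cm (vr c) (rw w) + (if w = [] then scl (of_nat (wt c)) (vr c) else 0)"

definition ad :: "(gen, 'k::comm_ring_1) ncs \<Rightarrow> (gen, 'k) ncs \<Rightarrow> (gen, 'k) ncs" where
  "ad a x = lin (\<lambda>w. adw w x) a"

definition dynkin :: "(gen, 'k::comm_ring_1) ncs \<Rightarrow> (gen, 'k) ncs" where
  "dynkin a = lin rw a"

lemma adw_append: "adw (u @ v) x = adw u (adw v x)"
  by (induction u) auto

lemma adw_linear [simp]: "adw w 0 = 0" "adw w (x + y) = adw w x + adw w y"
  "adw w (scl k x) = scl k (adw w x)"
  by (induction w) (auto simp: algebra_simps scl_distrib)

lemma adw_sum: "adw w (sum f S) = (\<Sum>i\<in>S. adw w (f i))"
  by (induction S rule: infinite_finite_induct) auto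

lemma adw_lin: "adw w (lin f b) = lin (\<lambda>v. adw w (f v)) b"
  by (simp add: lin_def adw_sum)

lemma rw_append: "v \<noteq> [] \<Longrightarrow> rw (u @ v) = adw u (rw v)"
  by (induction u) auto

lemma lin_lin_mult:
  assumes "fin a" "fin b"
  shows "lin f (a * b) = lin (\<lambda>u. lin (\<lambda>v. f (u @ v)) b) a"
  using assms(1)
proof (induction rule: fin_induct)
  case (monom u)
  show ?case using assms(2)
    by (induction rule: fin_induct) (auto simp: distrib_left simp flip: monom_append)
qed (use assms in \<open>auto simp: distrib_right\<close>)

lemma ad_mult: "fin a \<Longrightarrow> fin b \<Longrightarrow> ad (a * b) x = ad a (ad b x)"
  by (simp add: ad_def lin_lin_mult adw_append adw_lin)

lemma dynkin_mult:
  assumes "fin a" "fin b" "cf b [] = 0" shows "dynkin (a * b) = ad a (dynkin b)"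
proof -
  have "lin (\<lambda>v. rw (u @ v)) b = lin (\<lambda>v. adw u (rw v)) b" for u
    by (rule lin_cong, rule rw_append) (use assms(3) in auto)
  then show ?thesis using assms by (simp add: dynkin_def ad_def lin_lin_mult adw_lin)
qed

lemma sum_list_distrib: "(\<Sum>x\<leftarrow>xs. (c::'a::semiring_0) * f x) = c * (\<Sum>x\<leftarrow>xs. f x)"
  "(\<Sum>x\<leftarrow>xs. f x * c) = (\<Sum>x\<leftarrow>xs. f x) * c"
  by (induction xs) (auto simp: algebra_simps)

lemma sum_list_neg: "(\<Sum>x\<leftarrow>xs. - f x) = - (\<Sum>x\<leftarrow>xs. f x :: 'a::ab_group_add)"
  by (induction xs) auto

text \<open>Each letter of \<open>w\<close> acts either from the left or, with a sign and in
  reversed order, from the right: \<open>ad_w x\<close> is the sum of \<open>w' x S(w'')\<close>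
  with \<open>S\<close> the antipode.\<close>

lemma adw_unshuf:
  "adw w x = (\<Sum>(p, q)\<leftarrow>unshuf w. scl ((-1) ^ length q) (monom p * x * monom (rev q)))"
proof (induction w)
  case (Cons c w)
  have "(\<Sum>(p, q)\<leftarrow>unshuf (c # w). scl ((-1) ^ length q) (monom p * x * monom (rev q)))
    = (\<Sum>(p, q)\<leftarrow>unshuf w. vr c * scl ((-1) ^ length q) (monom p * x * monom (rev q)))
    - (\<Sum>(p, q)\<leftarrow>unshuf w. scl ((-1) ^ length q) (monom p * x * monom (rev q)) * vr c)"
    by (simp add: o_def case_prod_unfold monom_Cons monom_append mult.assoc sum_list_neg)
  also have "\<dots> = cm (vr c) (adw w x)"
    by (simp only: Cons.IH case_prod_unfold sum_list_distrib)
  finally show ?case by simp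
qed simp

lemma adw_1: "adw w 1 = (if w = [] then 1 else 0)"
  by (induction w) auto

text \<open>The Dynkin operator as the convolution of the grading derivation with the antipode. The
  weight of a new letter multiplies the sum of \<open>p S(q)\<close>, which is
  \<open>adw w 1\<close> and so vanishes unless \<open>w\<close> is empty.\<close>

lemma rw_unshuf:
  "(rw w :: (gen, 'k::comm_ring_1) ncs) = (\<Sum>(p, q)\<leftarrow>unshuf w. scl (of_nat (wtw p) * (-1) ^ length q) (monom p * monom (rev q)))"
proof (induction w)
  case (Cons c w)
  have *: "(\<Sum>(p, q)\<leftarrow>map (\<lambda>(p, q). (c # p, q)) xs @ map (\<lambda>(p, q). (p, c # q)) xs.
      scl (of_nat (wtw p) * (-1) ^ length q) (monom p * monom (rev q) :: (gen, 'k) ncs))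
    = scl (of_nat (wt c)) (vr c * (\<Sum>(p, q)\<leftarrow>xs. scl ((-1) ^ length q) (monom p * 1 * monom (rev q))))
    + vr c * (\<Sum>(p, q)\<leftarrow>xs. scl (of_nat (wtw p) * (-1) ^ length q) (monom p * monom (rev q)))
    - (\<Sum>(p, q)\<leftarrow>xs. scl (of_nat (wtw p) * (-1) ^ length q) (monom p * monom (rev q))) * vr c"
    for xs :: "(gen list \<times> gen list) list"
    by (induction xs) (auto simp: monom_Cons monom_append scl_distrib algebra_simps)
  have "(\<Sum>(p, q)\<leftarrow>unshuf (c # w). scl (of_nat (wtw p) * (-1) ^ length q) (monom p * monom (rev q) :: (gen, 'k) ncs))
    = scl (of_nat (wt c)) (vr c * (\<Sum>(p, q)\<leftarrow>unshuf w. scl ((-1) ^ length q) (monom p * 1 * monom (rev q))))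
    + vr c * (\<Sum>(p, q)\<leftarrow>unshuf w. scl (of_nat (wtw p) * (-1) ^ length q) (monom p * monom (rev q)))
    - (\<Sum>(p, q)\<leftarrow>unshuf w. scl (of_nat (wtw p) * (-1) ^ length q) (monom p * monom (rev q))) * vr c"
    using * by simp
  also have "\<dots> = rw (c # w)"
    unfolding Cons.IH[symmetric] adw_unshuf[symmetric] adw_1 by simp
  finally show ?case by simp
qed simp


lemma prim_ad:
  assumes "fin a" "prim a" shows "ad a x = cm a x"
proof -
  define S where "S = lin (\<lambda>q. scl ((-1) ^ length q) (monom (rev q))) a"
  have main: "ad a y = a * y + y * S" for y
  proof -
    have "ad a y = lin (\<lambda>p. monom p * y) a + lin (\<lambda>q. scl ((-1) ^ length q) (y * monom (rev q))) a"
      unfolding ad_def adw_unshuf lin_unshuf_prim[OF assms] by simp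
    also have "lin (\<lambda>p. monom p * y) a = lin monom a * y"
      by (simp add: lin_def sum_distrib_right)
    also have "lin (\<lambda>q. scl ((-1) ^ length q) (y * monom (rev q))) a = y * S"
      by (simp add: S_def lin_def sum_distrib_left)
    finally show ?thesis by (simp add: lin_monom_id assms)
  qed
  \<comment> \<open>Evaluation at 1 identifies the antipode value \<open>S\<close> as
    \<open>- a\<close>.\<close>
  have "ad a 1 = lin (\<lambda>_. 0) a"
    unfolding ad_def by (rule lin_cong) (use prim_Nil[OF assms(2)] in \<open>auto simp: adw_1\<close>)
  then have "ad a 1 = 0" by (simp add: lin_def)
  then have "S = - a" using main[of 1] by (simp add: add_eq_0_iff)
  then show ?thesis using main[of x] by simp
qed

text \<open>Dynkin-Specht-Wever for weights: for primitive \<open>a\<close> only the terms with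
  \<open>q = []\<close> or \<open>p = []\<close> of \<open>rw_unshuf\<close> survive; the former
  multiply by the weight, the latter have weight 0.\<close>

lemma dynkin_prim:
  assumes "finite S" "hm S m a" "prim a" shows "dynkin a = scl (of_nat m) a"
proof -
  have f: "fin a" using hm_fin assms by blast
  have "dynkin a = lin (\<lambda>p. scl (of_nat (wtw p)) (monom p)) a + lin (\<lambda>q. 0) a"
    unfolding dynkin_def rw_unshuf lin_unshuf_prim[OF f assms(3)] by simp
  also have "\<dots> = lin (\<lambda>p. scl (of_nat m) (monom p)) a + lin (\<lambda>q. 0) a"
    using assms(2) by (auto simp: hm_def cong: lin_cong)
  also have "\<dots> = scl (of_nat m) (lin monom a)"
    by (simp add: lin_def scl_sum mult.commute)
  finally show ?thesis by (simp add: f lin_monom_id)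
qed

lemma prim_rw: "prim (rw w)"
  by (induction w) auto

lemma prim_adw: "prim x \<Longrightarrow> prim (adw w x)"
  by (induction w) auto

lemma prim_lin: "(\<And>w. prim (f w)) \<Longrightarrow> prim (lin f a)"
  unfolding lin_def by (rule prim_sum) auto

lemma hm_adw: "set w \<subseteq> S \<Longrightarrow> hm S m x \<Longrightarrow> hm S (wtw w + m) (adw w x)"
proof (induction w)
  case (Cons c w)
  then have "hm S (wt c + (wtw w + m)) (cm (vr c) (adw w x))"
    by (intro hm_cm hm_vr) auto
  then show ?case by (simp add: add.assoc)
qed simp

lemma hm_rw: "set w \<subseteq> S \<Longrightarrow> hm S (wtw w) (rw w :: (gen, 'k::comm_ring_1) ncs)"
proof (induction w)
  case (Cons c w)
  then have "hm S (wt c + wtw w) (cm (vr c) (rw w :: (gen, 'k) ncs))"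
    by (intro hm_cm hm_vr) auto
  moreover have "hm S (wt c + wtw w) (if w = [] then scl (of_nat (wt c)) (vr c) else 0 :: (gen, 'k) ncs)"
    using Cons.prems by (auto intro: hm_scl hm_vr)
  ultimately show ?case unfolding rw.simps wtw_Cons by (rule hm_add)
qed simp

text \<open>Writing \<open>u = [\<theta>, h] + \<pi>\<close>, the Dynkin operator gives \<open>m u = [\<theta>, dynkin h] - 2 ad_h \<theta>\<close>,
  while \<open>ad_u = [u, -]\<close> forces \<open>ad_h \<theta> + u\<close> to commute with \<open>\<theta>\<close>, that is \<open>ad_h \<theta> = - u\<close>.\<close>

lemma lie_preimage:
  fixes \<theta> u h :: "(gen, 'k::field_char_0) ncs"
  assumes S: "finite S" and \<theta>: "hm S 2 \<theta>" "prim \<theta>" and u: "hm S m u" "prim u" and m: "2 < m"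
    and h: "hm S (m - 2) h" and eq: "u = cm \<theta> h + \<pi>"
    and \<pi>: "fin \<pi>" "cm \<theta> \<pi> = 0" "ad \<pi> \<theta> = 0" "dynkin \<pi> = 0"
    and centralizer: "\<And>b. hm S m b \<Longrightarrow> prim b \<Longrightarrow> cm \<theta> b = 0 \<Longrightarrow> b = 0"
  shows "\<exists>h'. hm S (m - 2) h' \<and> prim h' \<and> u = cm \<theta> h'"
proof -
  have fin: "fin \<theta>" "fin u" "fin h"
    using hm_fin[OF S] \<theta> u h by blast+
  have h0: "cf h [] = 0" "cf \<theta> [] = 0"
    using h m \<theta> by (auto simp: hm_def)
  define b where "b = ad h \<theta>"
  have b: "hm S m b" "prim b"
  proof -
    show "prim b" unfolding b_def ad_def by (intro prim_lin prim_adw \<theta>)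
    have "hm S m (adw w \<theta>)" if "set w \<subseteq> S" "wtw w = m - 2" for w
      using hm_adw[OF that(1) \<theta>(1)] that(2) m by (metis le_add_diff_inverse2 less_imp_le_nat)
    then show "hm S m b" unfolding b_def ad_def by (rule hm_lin[OF h])
  qed
  have ad_eq: "ad u x = ad \<theta> (ad h x) - ad h (ad \<theta> x) + ad \<pi> x" for x
    unfolding eq using fin \<pi>(1) by (simp add: ad_def) (simp add: ad_def[symmetric] ad_mult)
  \<comment> \<open>The operator identity is evaluated at \<open>\<theta>\<close> itself, where the
    middle term is \<open>ad h\<close> of \<open>[\<theta>, \<theta>]\<close>.\<close>
  have "cm u \<theta> = cm \<theta> b - ad h 0"
    using ad_eq[of \<theta>] \<pi>(3) prim_ad[OF fin(2) u(2)] prim_ad[OF fin(1) \<theta>(2)]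
    by (simp add: b_def)
  moreover have "ad h 0 = 0" by (simp add: ad_def lin_def)
  ultimately have "cm \<theta> (b + u) = 0"
    by (simp add: algebra_simps)
  then have "b + u = 0"
    using centralizer b u by simp
  then have bu: "b = - u" by (simp add: add_eq_0_iff)
  have "scl (of_nat m) u = dynkin u"
    using dynkin_prim[OF S u] by simp
  also have "dynkin u = dynkin (\<theta> * h) - dynkin (h * \<theta>) + dynkin \<pi>"
    unfolding eq using fin \<pi>(1) by (simp add: dynkin_def)
  also have "dynkin (\<theta> * h) = cm \<theta> (dynkin h)"
    using fin h0 \<theta>(2) by (simp add: dynkin_mult prim_ad)
  \<comment> \<open>The 2 is the weight of \<open>\<theta>\<close>: \<open>dynkin \<theta>\<close>
    is twice \<open>\<theta>\<close>.\<close>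
  also have "dynkin (h * \<theta>) = scl 2 b"
    using fin h0 dynkin_prim[OF S \<theta>]
    by (simp add: dynkin_mult b_def ad_def) (simp add: lin_def scl_sum mult.commute)
  finally have "scl (of_nat m) u = cm \<theta> (dynkin h) + scl 2 u"
    by (simp add: bu \<pi>(4))
  then have e: "scl (of_nat m - 2) u = cm \<theta> (dynkin h)"
    by (simp add: scl_distrib)
  have "scl (1 / (of_nat m - 2) * (of_nat m - 2)) u = scl (1 / (of_nat m - 2)) (scl (of_nat m - 2) u)"
    by (rule scl_simps(4)[symmetric])
  then have "scl (1 / (of_nat m - 2) * (of_nat m - 2)) u = cm \<theta> (scl (1 / (of_nat m - 2)) (dynkin h))"
    unfolding e by (simp only: scl_distrib scl_simps)
  moreover have "(of_nat m - 2 :: 'k) \<noteq> 0"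
    using m by (metis diff_eq_diff_eq diff_self eq_iff_diff_eq_0 nat_neq_iff of_nat_eq_iff of_nat_numeral)
  ultimately have "u = cm \<theta> (scl (1 / (of_nat m - 2)) (dynkin h))"
    by simp
  moreover have "prim (dynkin h)"
    unfolding dynkin_def by (intro prim_lin prim_rw)
  moreover have "hm S (m - 2) (dynkin h)"
    unfolding dynkin_def using hm_lin[OF h] hm_rw by metis
  ultimately show ?thesis
    by (intro exI[of _ "scl (1 / (of_nat m - 2)) (dynkin h)"] conjI hm_scl prim_scl)
qed

section \<open>Normal forms with respect to a leading word\<close>

text \<open>For \<open>x\<close> the first letter of the leading word of \<open>\<theta>\<close>, this measure strictly decreases when the leading
  word is replaced by any other word of \<open>\<theta>\<close>.\<close>

fun mu :: "gen \<Rightarrow> gen list \<Rightarrow> nat" where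
  "mu x [] = 0"
| "mu x (c # w) = (if c = x then wt c + wtw w else 0) + mu x w"

lemma mu_append: "mu x (u @ v) = mu x u + count_list u x * wtw v + mu x v"
  by (induction u) (auto simp: algebra_simps)

lemma cf_mult_nonzeroE:
  assumes "cf (a * b) w \<noteq> 0"
  obtains u v where "w = u @ v" "cf a u \<noteq> 0" "cf b v \<noteq> 0"
proof -
  obtain i where "cf a (take i w) * cf b (drop i w) \<noteq> 0"
    using assms unfolding cf_mult by (meson sum.neutral)
  then have "cf a (take i w) \<noteq> 0" "cf b (drop i w) \<noteq> 0" by auto
  then show thesis using that[of "take i w" "drop i w"] by simp
qed

text \<open>The words \<open>th\<close> that occur are \<open>[z\<^sub>j]\<close> and \<open>[x\<^sub>1, y\<^sub>1]\<close>, the leading words of \<open>z\<^sub>j\<close> and \<open>\<omega>\<close>. They do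
  not overlap with themselves, so each word has well defined \<open>th\<close>-blocks; \<open>nfw\<close> below replaces
  them by \<open>\<theta>\<close>.\<close>

locale block =
  fixes S :: "gen set" and th :: "gen list" and \<theta> :: "(gen, 'k::field_char_0) ncs"
  assumes S: "finite S"
    and th_cases: "(\<exists>z. th = [z]) \<or> (\<exists>x y. th = [x, y] \<and> x \<noteq> y)"
    and th_S: "set th \<subseteq> S" and th_wt: "wtw th = 2"
    and \<theta>_hm: "hm S 2 \<theta>" and \<theta>_prim: "prim \<theta>"
    and \<theta>_lead: "\<And>t. cf (\<theta> - monom th) t \<noteq> 0 \<Longrightarrow> mu (hd th) t < 2 \<and> count_list t (hd th) \<le> 1"
begin

lemma th_Nil [simp]: "th \<noteq> []"
  using th_cases by auto

lemma mu_th: "mu (hd th) th = 2" and count_th: "count_list th (hd th) = 1"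
  using th_cases th_wt by auto

lemma th_unbordered:
  "u \<noteq> [] \<Longrightarrow> take (length th) (u @ th @ v) = th \<Longrightarrow> take (length th) u = th"
  using th_cases by (cases u; cases "tl u") auto

function nfw :: "gen list \<Rightarrow> (gen, 'k) ncs" where
  "nfw w = (if take (length th) w = th then \<theta> * nfw (drop (length th) w)
            else (case w of [] \<Rightarrow> 1 | c # v \<Rightarrow> vr c * nfw v))"
  by auto
termination
proof (relation "measure length")
  fix w assume "take (length th) w = th"
  then have "w \<noteq> []" by auto
  then show "(drop (length th) w, w) \<in> measure length" by simp
qed auto

declare nfw.simps [simp del]

lemma nfw_Nil [simp]: "nfw [] = 1"
  using th_Nil by (subst nfw.simps) (auto simp del: th_Nil)

lemma nfw_th [simp]: "nfw (th @ w) = \<theta> * nfw w"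
  by (simp add: nfw.simps[of "th @ w"])

lemma nfw_Cons: "take (length th) (c # w) \<noteq> th \<Longrightarrow> nfw (c # w) = vr c * nfw w"
  by (subst nfw.simps) simp

lemma nfw_Cons_hd: "c \<noteq> hd th \<Longrightarrow> nfw (c # w) = vr c * nfw w"
  by (rule nfw_Cons) (metis hd_append2 append_take_drop_id list.sel(1) th_Nil)

text \<open>\<open>nfw\<close> parses greedily from the left, but as \<open>th\<close> does not
  overlap itself the parse never cuts through an occurrence of \<open>th\<close>. Away from blocks
  \<open>nfw\<close> need not be multiplicative, since two factors may join to a new block.\<close>

lemma nfw_mid: "nfw (u @ th @ v) = nfw u * \<theta> * nfw v"
proof (induction u rule: length_induct)
  case (1 u)
  show ?case
  proof (cases "take (length th) u = th")
    case True
    then obtain u' where u: "u = th @ u'" by (metis append_take_drop_id)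
    then have "nfw (u' @ th @ v) = nfw u' * \<theta> * nfw v"
      using 1 by simp
    then show ?thesis by (simp add: u mult.assoc)
  next
    case False
    show ?thesis
    proof (cases u)
      case (Cons c u')
      then have "take (length th) (u @ th @ v) \<noteq> th"
        using False th_unbordered by blast
      then have "nfw (u @ th @ v) = vr c * nfw (u' @ th @ v)"
        using Cons nfw_Cons by simp
      moreover have "nfw u = vr c * nfw u'"
        using Cons False nfw_Cons by simp
      ultimately show ?thesis using 1 Cons by (simp add: mult.assoc)
    qed simp
  qed
qed

lemma hm_nfw: "set w \<subseteq> T \<Longrightarrow> S \<subseteq> T \<Longrightarrow> hm T (wtw w) (nfw w)"
proof (induction w rule: nfw.induct)
  case (1 w)
  show ?case
  proof (cases "take (length th) w = th")
    case True
    then obtain w' where w: "w = th @ w'" by (metis append_take_drop_id)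
    have "hm T 2 \<theta>" using \<theta>_hm 1(4) by (auto simp: hm_def)
    moreover have "hm T (wtw w') (nfw w')" using 1 True w by simp
    ultimately show ?thesis using hm_mult w th_wt by fastforce
  next
    case False
    show ?thesis
    proof (cases w)
      case Nil
      then show ?thesis by (simp add: hm_def cf_one)
    next
      case (Cons c v)
      then have "hm T (wt c) (vr c :: (gen, 'k) ncs)" "hm T (wtw v) (nfw v)"
        using 1 False by (auto intro: hm_vr)
      then show ?thesis using hm_mult False Cons nfw_Cons by fastforce
    qed
  qed
qed

text \<open>Exchanging a block for another word of \<open>\<theta>\<close> keeps all weights, so
  letters before the block contribute as before to \<open>mu\<close>, while the block itself
  contributes less. Hence \<open>nf\<close> is unitriangular and a bijection in each weight.\<close>

lemma nfw_triangular: "cf (nfw w - monom w) v \<noteq> 0 \<Longrightarrow> mu (hd th) v < mu (hd th) w"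
proof (induction w arbitrary: v rule: nfw.induct)
  case (1 w)
  let ?mu = "mu (hd th)"
  have hm: "wtw v = wtw u" if "cf (nfw u) v \<noteq> 0" for u v
    using hm_nfw[of u UNIV] that by (auto simp: hm_def)
  show ?case
  proof (cases "take (length th) w = th")
    case True
    then obtain w' where w: "w = th @ w'" by (metis append_take_drop_id)
    have IH: "?mu v < ?mu w'" if "cf (nfw w' - monom w') v \<noteq> 0" for v
      using 1(1)[OF True] that w by simp
    have IH': "?mu v \<le> ?mu w' \<and> wtw v = wtw w'" if "cf (nfw w') v \<noteq> 0" for v
      using IH[of v] hm[OF that] by (cases "v = w'") (auto simp: cf_monom that)
    have "nfw w - monom w = monom th * (nfw w' - monom w') + (\<theta> - monom th) * nfw w'"
      by (simp add: w monom_append algebra_simps)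
    then have "cf (monom th * (nfw w' - monom w')) v \<noteq> 0 \<or> cf ((\<theta> - monom th) * nfw w') v \<noteq> 0"
      using 1(3) by auto
    then show ?thesis
    proof
      assume "cf (monom th * (nfw w' - monom w')) v \<noteq> 0"
      then obtain v' where v: "v = th @ v'" "cf (nfw w' - monom w') v' \<noteq> 0"
        by (elim cf_mult_nonzeroE) (auto simp: cf_monom split: if_splits)
      then have "wtw v' = wtw w'"
        using hm[of w' v'] by (cases "v' = w'") (auto simp: cf_monom)
      then show ?thesis using IH[OF v(2)] by (simp add: w v mu_append)
    next
      assume "cf ((\<theta> - monom th) * nfw w') v \<noteq> 0"
      then obtain t v' where v: "v = t @ v'" "cf (\<theta> - monom th) t \<noteq> 0" "cf (nfw w') v' \<noteq> 0"
        by (rule cf_mult_nonzeroE)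
      \<comment> \<open>The first letter occurs exactly once in \<open>th\<close> and at most once
        in \<open>t\<close>, so the part of \<open>mu\<close> that involves the weight behind the
        block cannot grow.\<close>
      have "count_list t (hd th) * wtw v' \<le> 1 * wtw w'"
        using \<theta>_lead[OF v(2)] IH'[OF v(3)] by (intro mult_le_mono) auto
      moreover have "mu (hd th) t < 2" "mu (hd th) v' \<le> mu (hd th) w'"
        using \<theta>_lead[OF v(2)] IH'[OF v(3)] by auto
      ultimately show ?thesis
        unfolding w v mu_append mu_th count_th by linarith
    qed
  next
    case False
    show ?thesis
    proof (cases w)
      case Nil
      then show ?thesis using 1(3) by simp
    next
      case (Cons c w')
      have "nfw w - monom w = vr c * (nfw w' - monom w')"
        using Cons False nfw_Cons by (simp add: monom_Cons algebra_simps)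
      then obtain v' where v: "v = c # v'" "cf (nfw w' - monom w') v' \<noteq> 0"
        using 1(3) by (auto elim!: cf_mult_nonzeroE simp: cf_vr split: if_splits)
      then have "wtw v' = wtw w'"
        using hm[of w' v'] by (cases "v' = w'") (auto simp: cf_monom)
      then show ?thesis using 1(2)[OF False Cons v(2)] by (simp add: Cons v)
    qed
  qed
qed

text \<open>A change of basis, not an algebra map. The coordinates of \<open>u\<close> are the
  coefficients of the \<open>a\<close> with \<open>nf a = u\<close>; multiplication by
  \<open>\<theta>\<close> becomes concatenation with \<open>th\<close> in these coordinates
  (\<open>nf_mid\<close>).\<close>

definition nf :: "(gen, 'k) ncs \<Rightarrow> (gen, 'k) ncs" where
  "nf a = lin nfw a"

lemma nf_simps [simp]: "nf 0 = 0" "nf (monom w) = nfw w"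
  "fin a \<Longrightarrow> fin b \<Longrightarrow> nf (a + b) = nf a + nf b" "fin a \<Longrightarrow> fin b \<Longrightarrow> nf (a - b) = nf a - nf b"
  "fin a \<Longrightarrow> nf (scl k a) = scl k (nf a)" "fin a \<Longrightarrow> nf (- a) = - nf a"
  "(\<And>i. i \<in> I \<Longrightarrow> fin (f i)) \<Longrightarrow> nf (sum f I) = (\<Sum>i\<in>I. nf (f i))"
  by (simp_all add: nf_def)

lemma nf_1 [simp]: "nf 1 = 1"
  by (simp add: nf_def)

lemma fin_nf [simp]: "fin (nf a)"
proof -
  have "fin (nfw w)" for w
    using hm_fin[OF _ hm_nfw[of w "S \<union> set w"]] S by simp
  then show ?thesis by (simp add: nf_def)
qed

lemma nf_inj:
  assumes "fin a" "nf a = 0" shows "a = 0"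
proof (rule ccontr)
  assume "a \<noteq> 0"
  let ?W = "{w. cf a w \<noteq> 0}" and ?mu = "mu (hd th)"
  have W: "finite ?W" "?W \<noteq> {}"
    using assms(1) \<open>a \<noteq> 0\<close> ncs_eqI[of a 0] by (auto simp: fin_def)
  then obtain w where w: "w \<in> ?W" "\<And>v. v \<in> ?W \<Longrightarrow> ?mu v \<le> ?mu w"
    using Max_in[of "?mu ` ?W"] Max_ge[of "?mu ` ?W"] by (smt (verit) finite_imageI image_iff image_is_empty)
  have "cf (nf a) w = (\<Sum>u\<in>?W. if u = w then cf a w else 0)"
    unfolding nf_def cf_lin
  proof (intro sum.cong refl)
    fix u assume u: "u \<in> ?W"
    have "cf (nfw u - monom u) w = 0"
      using nfw_triangular[of u w] w(2)[OF u] by fastforce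
    then show "cf a u * cf (nfw u) w = (if u = w then cf a w else 0)"
      by (auto simp: cf_monom)
  qed
  also have "\<dots> = cf a w" using W w by (simp add: sum.delta)
  finally show False using assms(2) w by simp
qed

lemma nf_lift:
  assumes "fin b" "\<And>v. cf b v \<noteq> 0 \<Longrightarrow> fin (f v) \<and> nf (f v) = monom v"
  shows "fin (lin f b)" "nf (lin f b) = b"
proof -
  show "fin (lin f b)" unfolding lin_def by (rule fin_sum) (use assms in auto)
  have "nf (lin f b) = lin monom b"
    unfolding lin_def by (subst nf_simps(7)) (use assms in \<open>auto intro!: sum.cong\<close>)
  then show "nf (lin f b) = b" using assms by (simp add: lin_monom_id)
qed

lemma nf_surj_monom: "set w \<subseteq> S \<Longrightarrow> \<exists>a. hm S (wtw w) a \<and> nf a = monom w"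
proof (induction "mu (hd th) w" arbitrary: w rule: less_induct)
  case less
  define r where "r = nfw w - monom w"
  have r: "hm S (wtw w) r"
    unfolding r_def using less.prems hm_nfw[of w S] by (auto intro!: hm_diff hm_monom)
  have "\<exists>a. hm S (wtw w) a \<and> nf a = monom v" if "cf r v \<noteq> 0" for v
    using less.hyps[of v] nfw_triangular[of w v] that r by (fastforce simp: r_def hm_def)
  then obtain g where g: "\<And>v. cf r v \<noteq> 0 \<Longrightarrow> hm S (wtw w) (g v) \<and> nf (g v) = monom v"
    by metis
  define a where "a = monom w - lin g r"
  have "nf (lin g r) = r"
    by (rule nf_lift[OF hm_fin[OF S r]]) (use g hm_fin[OF S] in blast)
  moreover have l: "hm S (wtw w) (lin g r)"
    unfolding lin_def by (rule hm_sum) (use g in auto)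
  ultimately have "nf a = monom w"
    using hm_fin[OF S l] by (simp add: a_def r_def)
  moreover have "hm S (wtw w) a"
    using l less.prems by (auto simp: a_def intro!: hm_diff hm_monom)
  ultimately show ?case by blast
qed

lemma nf_surj:
  assumes "hm S m b" obtains a where "hm S m a" "nf a = b"
proof -
  have "\<exists>a. hm S m a \<and> nf a = monom v" if "cf b v \<noteq> 0" for v
    using nf_surj_monom[of v] that assms by (auto simp: hm_def)
  then obtain g where g: "\<And>v. cf b v \<noteq> 0 \<Longrightarrow> hm S m (g v) \<and> nf (g v) = monom v"
    by metis
  have "nf (lin g b) = b"
    by (rule nf_lift[OF hm_fin[OF S assms]]) (use g hm_fin[OF S] in blast)
  moreover have l: "hm S m (lin g b)"
    unfolding lin_def by (rule hm_sum) (use g in auto)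
  ultimately show thesis using that by blast
qed

lemma nf_mid:
  assumes "fin a" "fin b" shows "nf (a * monom th * b) = nf a * \<theta> * nf b"
proof -
  have "nf (a * monom th * b) = lin (\<lambda>u. lin (\<lambda>v. nfw (u @ th @ v)) b) a"
    using assms by (simp add: nf_def lin_lin_mult)
  also have "\<dots> = nf a * \<theta> * nf b"
    by (simp add: nfw_mid nf_def lin_def sum_distrib_left sum_distrib_right scl_sum)
      (subst sum.swap, simp add: mult.commute)
  finally show ?thesis .
qed

text \<open>At least one block must separate the factors: otherwise the end of a word of
  \<open>a\<close> and the start of a word of \<open>b\<close> could form a new one.\<close>

lemma nf_power_mid:
  "fin a \<Longrightarrow> fin b \<Longrightarrow> nf (a * monom th ^ Suc k * b) = nf a * \<theta> ^ Suc k * nf b"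
proof (induction k arbitrary: a)
  case 0
  then show ?case by (simp add: nf_mid)
next
  case (Suc k)
  have "nf (a * monom th ^ Suc (Suc k) * b) = nf (a * monom th * (1 * monom th ^ Suc k * b))"
    by (simp add: mult.assoc)
  also have "\<dots> = nf a * \<theta> * nf (1 * monom th ^ Suc k * b)"
    by (rule nf_mid) (use Suc in auto)
  also have "nf (1 * monom th ^ Suc k * b) = 1 * \<theta> ^ Suc k * nf b"
    using Suc(1)[of 1] Suc by simp
  finally show ?case by (simp add: mult.assoc)
qed

lemma nf_power_left: "fin b \<Longrightarrow> nf (monom th ^ k * b) = \<theta> ^ k * nf b"
  using nf_power_mid[of 1 b "k - 1"] by (cases k) auto

lemma nf_power_right: "fin a \<Longrightarrow> nf (a * monom th ^ k) = nf a * \<theta> ^ k"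
  using nf_power_mid[of a 1 "k - 1"] by (cases k) auto

text \<open>Such a letter cannot open a block. On the right it could close one, so there is no
  counterpart for multiplication by \<open>d\<close> from the right.\<close>

lemma nf_vr_left: "d \<noteq> hd th \<Longrightarrow> fin a \<Longrightarrow> nf (vr d * a) = vr d * nf a"
  by (simp add: nf_def lin_lin_mult nfw_Cons_hd) (simp add: lin_def sum_distrib_left)

end

definition pol :: "gen set \<Rightarrow> (gen, 'k::comm_ring_1) ncs \<Rightarrow> bool" where
  "pol T a \<longleftrightarrow> fin a \<and> (\<forall>w. cf a w \<noteq> 0 \<longrightarrow> set w \<subseteq> T)"

lemma pol_fin [simp]: "pol T a \<Longrightarrow> fin a"
  by (simp add: pol_def)

lemma pol_0 [simp]: "pol T 0" and pol_1 [simp]: "pol T 1"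
  by (auto simp: pol_def cf_one)

lemma pol_monom: "set w \<subseteq> T \<Longrightarrow> pol T (monom w)"
  by (simp add: pol_def cf_monom)

lemma pol_vr [simp]: "c \<in> T \<Longrightarrow> pol T (vr c)"
  by (simp add: pol_def cf_vr)

lemma pol_add [simp]: "pol T a \<Longrightarrow> pol T b \<Longrightarrow> pol T (a + b)"
  unfolding pol_def by (metis add.right_neutral cf_add fin_add)

lemma pol_scl [simp]: "pol T a \<Longrightarrow> pol T (scl k a)"
  unfolding pol_def by (metis cf_scl fin_scl mult_zero_right)

lemma pol_uminus [simp]: "pol T a \<Longrightarrow> pol T (- a)"
  using pol_scl[of T a "-1"] by simp

lemma pol_diff [simp]: "pol T a \<Longrightarrow> pol T b \<Longrightarrow> pol T (a - b)"
  using pol_add[of T a "- b"] by simp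

lemma pol_sum [simp]: "(\<And>i. i \<in> I \<Longrightarrow> pol T (f i)) \<Longrightarrow> pol T (sum f I)"
  by (induction I rule: infinite_finite_induct) auto

lemma pol_mult [simp]: "pol T a \<Longrightarrow> pol T b \<Longrightarrow> pol T (a * b)"
  unfolding pol_def by (intro conjI fin_mult allI impI) (auto elim!: cf_mult_nonzeroE, blast+)

lemma pol_power [simp]: "pol T a \<Longrightarrow> pol T (a ^ k)"
  by (induction k) auto

lemma hm_pol: "finite T \<Longrightarrow> hm T m a \<Longrightarrow> pol T a"
  using hm_fin by (auto simp: pol_def hm_def)

lemma monom_replicate: "monom (replicate k d) = vr d ^ k"
  by (induction k) (auto simp: monom_Cons)

section \<open>Powers of the leading word and the words between them\<close>

context block
begin

definition pw :: "nat \<Rightarrow> gen list" where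
  "pw k = concat (replicate k th)"

lemma pw_0 [simp]: "pw 0 = []" and pw_Suc: "pw (Suc k) = th @ pw k"
  by (simp_all add: pw_def)

lemma pw_Suc2: "pw (Suc k) = pw k @ th"
  by (induction k) (auto simp: pw_Suc)

lemma length_pw [simp]: "length (pw k) = k * length th"
  by (induction k) (auto simp: pw_Suc)

lemma wtw_pw [simp]: "wtw (pw k) = 2 * k"
  by (induction k) (auto simp: pw_Suc th_wt)

lemma set_pw: "set (pw k) \<subseteq> S"
  using th_S by (induction k) (auto simp: pw_Suc)

lemma monom_pw: "monom (pw k) = monom th ^ k"
  by (induction k) (auto simp: pw_Suc monom_append)

lemma nfw_pw [simp]: "nfw (pw k) = \<theta> ^ k"
  by (induction k) (auto simp: pw_Suc)

lemma nth_pw: "i < k * length th \<Longrightarrow> pw k ! i = th ! (i mod length th)"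
proof (induction k arbitrary: i)
  case (Suc k)
  show ?case
  proof (cases "i < length th")
    case True
    then show ?thesis by (simp add: pw_Suc nth_append)
  next
    case False
    then show ?thesis using Suc.IH[of "i - length th"] Suc.prems
      by (simp add: pw_Suc nth_append le_mod_geq)
  qed
qed simp

lemma length_th: "1 \<le> length th" "length th \<le> 2"
  using th_cases by auto

lemma th_nth_0: "i < length th \<Longrightarrow> th ! i = hd th \<Longrightarrow> i = 0"
  using th_cases by (auto simp: less_Suc_eq)

text \<open>A word that is not a power of \<open>th\<close> is \<open>pw p @ v @ pw q\<close> for
  exactly one core \<open>v\<close> and one pair \<open>p\<close>, \<open>q\<close>
  (\<open>core_decomp\<close>, \<open>core_unique\<close>). Left and right multiplication by
  \<open>th\<close> only move along this pair.\<close>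

definition core :: "gen list \<Rightarrow> bool" where
  "core v \<longleftrightarrow> v \<noteq> [] \<and> (\<forall>r. v \<noteq> th @ r) \<and> (\<forall>r. v \<noteq> r @ th)"

lemma core_left: "core v \<Longrightarrow> v @ pw q \<noteq> th @ r"
proof
  assume v: "core v" and e: "v @ pw q = th @ r"
  have "take (length th) v = th"
  proof (cases q)
    case 0
    then show ?thesis using e by simp
  next
    case (Suc q')
    then have "take (length th) (v @ th @ pw q') = th" using e by (simp add: pw_Suc)
    then show ?thesis using th_unbordered v by (auto simp: core_def)
  qed
  then show False using v by (metis append_take_drop_id core_def)
qed

lemma th_unbordered_right: "v \<noteq> [] \<Longrightarrow> th @ v = r @ th \<Longrightarrow> \<exists>r'. v = r' @ th"
  using th_cases
  by (elim disjE exE conjE; cases v rule: rev_cases; cases "butlast v" rule: rev_cases)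
    (auto simp: append_eq_Cons_conv Cons_eq_append_conv)

lemma core_right: "core v \<Longrightarrow> pw q @ v \<noteq> r @ th"
proof
  assume v: "core v" and e: "pw q @ v = r @ th"
  have "\<exists>r'. v = r' @ th"
  proof (cases q)
    case 0
    then show ?thesis using e by auto
  next
    case (Suc q')
    then have "pw q' @ (th @ v) = r @ th" using e by (simp add: pw_Suc2)
    then have "drop (length (pw q')) (pw q' @ (th @ v)) = drop (length (pw q')) (r @ th)"
      by (rule arg_cong)
    moreover have "length (pw q') + length (th @ v) = length r + length th"
      using \<open>pw q' @ (th @ v) = r @ th\<close> by (metis length_append)
    moreover have "length th \<le> length (th @ v)" by simp
    ultimately have "length (pw q') \<le> length r" "th @ v = drop (length (pw q')) (r @ th)"
      by (auto simp del: length_pw)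
    then have "th @ v = drop (length (pw q')) r @ th" by simp
    then have "\<exists>r'. th @ v = r' @ th" by blast
    then show ?thesis using th_unbordered_right v by (auto simp: core_def)
  qed
  then show False using v by (auto simp: core_def)
qed

lemma cf_th_left:
  assumes "\<And>r. z \<noteq> th @ r"
  shows "cf (monom th ^ i * a) (pw p @ z) = (if i \<le> p then cf a (pw (p - i) @ z) else 0)"
proof (induction i arbitrary: p)
  case (Suc i)
  show ?case
  proof (cases p)
    case 0
    have "cf (monom th * (monom th ^ i * a)) z = 0"
      by (simp add: cf_monom_mult) (metis append_take_drop_id assms)
    then show ?thesis using 0 by (simp add: mult.assoc)
  next
    case (Suc p')
    then show ?thesis using Suc.IH[of p'] by (simp add: mult.assoc pw_Suc)
  qed
qed simp

lemma cf_th_right: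
  assumes "\<And>r. z \<noteq> r @ th"
  shows "cf (a * monom th ^ i) (z @ pw q) = (if i \<le> q then cf a (z @ pw (q - i)) else 0)"
proof (induction i arbitrary: q)
  case (Suc i)
  have p: "a * monom th ^ Suc i = a * monom th ^ i * monom th"
    by (simp only: power_Suc2 mult.assoc)
  show ?case
  proof (cases q)
    case 0
    have "cf (a * monom th ^ i * monom th) z = 0"
      using assms by (auto simp: cf_mult_monom)
    then show ?thesis unfolding p using 0 by simp
  next
    case (Suc q')
    have "cf (a * monom th ^ i * monom th) (z @ pw (Suc q')) = cf (a * monom th ^ i) (z @ pw q')"
      using cf_mult_monom_append[of "a * monom th ^ i" th "z @ pw q'"] by (simp add: pw_Suc2)
    then show ?thesis unfolding p using Suc Suc.IH[of q'] by simp
  qed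
qed simp

lemma cf_th_sandwich:
  assumes "core v"
  shows "cf (monom th ^ i * a * monom th ^ j) (pw p @ v @ pw q)
       = (if i \<le> p \<and> j \<le> q then cf a (pw (p - i) @ v @ pw (q - j)) else 0)"
  using cf_th_left[of "v @ pw q" i "a * monom th ^ j" p] core_left[OF assms]
    cf_th_right[of "pw (p - i) @ v" a j q] core_right[OF assms]
  by (simp add: mult.assoc)

text \<open>Modulo \<open>[th, -]\<close> all words \<open>th\<^sup>p v th\<^sup>q\<close> with \<open>p + q = N\<close> coincide, so \<open>Tsum\<close> is a coefficient of the
  class of \<open>a\<close>.\<close>

definition Tsum :: "(gen, 'k) ncs \<Rightarrow> gen list \<Rightarrow> nat \<Rightarrow> 'k" where
  "Tsum a v N = (\<Sum>p\<le>N. cf a (pw p @ v @ pw (N - p)))"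

lemma core_decomp: "(\<exists>r. w = pw r) \<or> (\<exists>p v q. core v \<and> w = pw p @ v @ pw q)"
proof (induction w rule: length_induct)
  case (1 w)
  consider w' where "w = th @ w'" | w' where "w = w' @ th" | "w = []" | "core w"
    unfolding core_def by blast
  then show ?case
  proof cases
    case (1 w')
    then have "(\<exists>r. w' = pw r) \<or> (\<exists>p v q. core v \<and> w' = pw p @ v @ pw q)"
      using "1.IH" by simp
    then show ?thesis using 1 by (metis append.assoc pw_Suc)
  next
    case (2 w')
    then have "(\<exists>r. w' = pw r) \<or> (\<exists>p v q. core v \<and> w' = pw p @ v @ pw q)"
      using "1.IH" by simp
    then show ?thesis using 2 by (metis append.assoc pw_Suc2)
  next
    case 3
    then show ?thesis by (metis pw_0)
  next
    case 4
    then show ?thesis by (metis append_Nil append_Nil2 pw_0)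
  qed
qed

lemma core_unique_left:
  assumes "core v" "core v'" "pw p @ v @ pw q = pw p' @ v' @ pw q'" shows "p = p'"
  using assms(3)
proof (induction p arbitrary: p')
  case 0
  then show ?case using core_left[OF assms(1), of q] by (cases p') (auto simp: pw_Suc)
next
  case (Suc p)
  show ?case
  proof (cases p')
    case 0
    then have "v' @ pw q' = th @ pw p @ v @ pw q" using Suc.prems by (simp add: pw_Suc)
    then show ?thesis using core_left[OF assms(2)] by blast
  next
    case (Suc p'')
    then show ?thesis using Suc.IH[of p''] Suc.prems by (simp add: pw_Suc)
  qed
qed

lemma core_unique_right:
  assumes "core v" "core v'" "v @ pw q = v' @ pw q'" shows "q = q'"
  using assms(3)
proof (induction q arbitrary: q')
  case 0
  show ?case
  proof (cases q')
    case (Suc q'')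
    then have "pw 0 @ v = (v' @ pw q'') @ th" using 0 by (simp add: pw_Suc2)
    then show ?thesis using core_right[OF assms(1)] by blast
  qed simp
next
  case (Suc q)
  show ?case
  proof (cases q')
    case 0
    then have "pw 0 @ v' = (v @ pw q) @ th" using Suc.prems by (simp add: pw_Suc2)
    then show ?thesis using core_right[OF assms(2)] by blast
  next
    case (Suc q'')
    then have "(v @ pw q) @ th = (v' @ pw q'') @ th" using Suc.prems by (simp add: pw_Suc2)
    then show ?thesis using Suc.IH[of q''] \<open>q' = Suc q''\<close> by (simp only: append_same_eq)
  qed
qed

lemma core_unique:
  assumes "core v" "core v'" "pw p @ v @ pw q = pw p' @ v' @ pw q'"
  shows "p = p' \<and> v = v' \<and> q = q'"
proof -
  have p: "p = p'" using core_unique_left[OF assms] .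
  then have e: "v @ pw q = v' @ pw q'" using assms(3) by simp
  have "q = q'" using core_unique_right[OF assms(1,2) e] .
  then show ?thesis using p e by simp
qed

lemma core_not_pw: "core v \<Longrightarrow> pw p @ v @ pw q \<noteq> pw r"
proof (induction p arbitrary: r)
  case 0
  show ?case
  proof (cases r)
    case 0
    then show ?thesis using \<open>core v\<close> by (simp add: core_def)
  next
    case (Suc r')
    then show ?thesis using core_left[OF \<open>core v\<close>] by (simp add: pw_Suc)
  qed
next
  case (Suc p)
  then show ?case by (cases r) (simp_all add: pw_Suc)
qed

text \<open>For a core \<open>v\<close> and fixed \<open>p + q\<close> the coefficient of
  \<open>[th, e]\<close> is the difference of two neighbouring coefficients of \<open>e\<close>. So
  \<open>e\<close> is found by partial summation of \<open>u\<close>, and the vanishing of the total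
  sum is the solvability condition. Pure powers of \<open>th\<close> remain in
  \<open>\<pi>\<close>.\<close>

lemma Tsum_zero_decomp:
  assumes u: "hm S m u" and m: "2 \<le> m" and T: "\<And>v N. core v \<Longrightarrow> Tsum u v N = 0"
  shows "\<exists>e \<pi>. hm S (m - 2) e \<and> u = cm (monom th) e + \<pi> \<and> hm S m \<pi> \<and> (\<forall>w. cf \<pi> w \<noteq> 0 \<longrightarrow> (\<exists>r. w = pw r))"
proof -
  \<comment> \<open>Solution of
    \<open>g (p - 1) v q - g p v (q - 1) = cf u (pw p @ v @ pw q)\<close>, with terms of negative
    index read as 0.\<close>
  define g where "g p v q = - (\<Sum>t\<le>p. cf u (pw (p - t) @ v @ pw (q + t + 1)))" for p v q
  define dec where "dec w = (SOME x. case x of (p, v, q) \<Rightarrow> core v \<and> w = pw p @ v @ pw q)" for w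
  define e where "e = Ncs (\<lambda>w. if \<exists>r. w = pw r then 0 else case dec w of (p, v, q) \<Rightarrow> g p v q)"
  have dec: "dec (pw p @ v @ pw q) = (p, v, q)" if "core v" for p v q
    unfolding dec_def
  proof (rule some_equality)
    fix x assume x: "case x of (p', v', q') \<Rightarrow> core v' \<and> pw p @ v @ pw q = pw p' @ v' @ pw q'"
    then show "x = (p, v, q)"
      using core_unique[OF that, of "fst (snd x)" p q "fst x" "snd (snd x)"] by (auto split: prod.splits)
  qed (use that in simp)
  have e: "cf e (pw p @ v @ pw q) = g p v q" if "core v" for p v q
    using dec[OF that] core_not_pw[OF that] by (simp add: e_def)
  have e0: "cf e (pw r) = 0" for r by (auto simp: e_def)
  have hme: "hm S (m - 2) e"
    unfolding hm_def
  proof (intro allI impI)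
    fix w assume w: "cf e w \<noteq> 0"
    then obtain p v q where v: "core v" "w = pw p @ v @ pw q"
      using core_decomp[of w] e0 by auto
    then have "g p v q \<noteq> 0" using w e by simp
    then obtain t where t: "t \<le> p" "cf u (pw (p - t) @ v @ pw (q + t + 1)) \<noteq> 0"
      unfolding g_def by (auto elim: sum.not_neutral_contains_not_neutral)
    then have "set (pw (p - t) @ v @ pw (q + t + 1)) \<subseteq> S" "wtw (pw (p - t) @ v @ pw (q + t + 1)) = m"
      using u unfolding hm_def by blast+
    then have "set v \<subseteq> S" "2 * (p - t) + wtw v + 2 * (q + t + 1) = m" by simp_all
    moreover have "wtw w = 2 * p + wtw v + 2 * q" by (simp add: v)
    moreover have "set w \<subseteq> set (pw p) \<union> set v \<union> set (pw q)" by (auto simp: v)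
    ultimately show "set w \<subseteq> S \<and> wtw w = m - 2"
      using t(1) set_pw[of p] set_pw[of q] by auto
  qed
  define \<pi> where "\<pi> = u - cm (monom th) e"
  have "cf \<pi> (pw p @ v @ pw q) = 0" if v: "core v" for p v q
  proof -
    have 1: "cf (monom th * e) (pw p @ v @ pw q) = (if 1 \<le> p then g (p - 1) v q else 0)"
      using cf_th_sandwich[OF v, of 1 e 0 p q] e[OF v] by simp
    have 2: "cf (e * monom th) (pw p @ v @ pw q) = (if 1 \<le> q then g p v (q - 1) else 0)"
      using cf_th_sandwich[OF v, of 0 e 1 p q] e[OF v] by simp
    have 3: "(if 1 \<le> p then g (p - 1) v q else 0) = - (\<Sum>t<p. cf u (pw (p - Suc t) @ v @ pw (q + Suc t)))"
    proof (cases p)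
      case (Suc p')
      then show ?thesis by (simp add: g_def lessThan_Suc_atMost)
    qed simp
    have 4: "(\<Sum>t\<le>p. cf u (pw (p - t) @ v @ pw (q + t)))
        = cf u (pw p @ v @ pw q) + (\<Sum>t<p. cf u (pw (p - Suc t) @ v @ pw (q + Suc t)))"
      by (subst sum.atMost_shift) simp
    have 5: "- (if 1 \<le> q then g p v (q - 1) else 0) = (\<Sum>t\<le>p. cf u (pw (p - t) @ v @ pw (q + t)))"
    proof (cases q)
      case 0
      \<comment> \<open>At the end of the chain there is no term of \<open>e * monom th\<close> to
        absorb the sum, so it has to vanish by itself.\<close>
      have "(\<Sum>t\<le>p. cf u (pw (p - t) @ v @ pw t)) = Tsum u v p"
        unfolding Tsum_def by (rule sum.reindex_bij_witness[of _ "\<lambda>t. p - t" "\<lambda>t. p - t"]) auto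
      then show ?thesis using 0 T[OF v, of p] by simp
    next
      case (Suc q')
      then show ?thesis by (simp add: g_def)
    qed
    have "cf \<pi> (pw p @ v @ pw q) = cf u (pw p @ v @ pw q)
        - (if 1 \<le> p then g (p - 1) v q else 0) + (if 1 \<le> q then g p v (q - 1) else 0)"
      by (simp only: \<pi>_def cf_diff 1 2) simp
    also have "(if 1 \<le> q then g p v (q - 1) else 0) = - (\<Sum>t\<le>p. cf u (pw (p - t) @ v @ pw (q + t)))"
      unfolding 5[symmetric] by simp
    finally show ?thesis unfolding 3 4 by simp
  qed
  then have "\<forall>w. cf \<pi> w \<noteq> 0 \<longrightarrow> (\<exists>r. w = pw r)"
    using core_decomp by metis
  moreover have "u = cm (monom th) e + \<pi>" by (simp add: \<pi>_def)
  moreover have "hm S m \<pi>"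
    unfolding \<pi>_def using hm_cm[OF hm_monom[OF th_S th_wt] hme] m
    by (intro hm_diff[OF u]) (simp only: le_add_diff_inverse)
  ultimately show ?thesis using hme by blast
qed

lemma nf_pure:
  assumes "hm S m \<pi>" "\<And>w. cf \<pi> w \<noteq> 0 \<Longrightarrow> \<exists>r. w = pw r"
  shows "nf \<pi> = 0 \<or> (\<exists>c r. m = 2 * r \<and> nf \<pi> = scl c (\<theta> ^ r))"
proof (cases "\<pi> = 0")
  case False
  then obtain w where w: "cf \<pi> w \<noteq> 0" using ncs_eqI[of \<pi> 0] by auto
  then obtain r where r: "w = pw r" using assms(2) by blast
  then have m: "m = 2 * r" using assms(1) w by (auto simp: hm_def)
  have "cf \<pi> v = cf (scl (cf \<pi> w) (monom w)) v" for v
  proof (cases "cf \<pi> v = 0")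
    case False
    then obtain r' where "v = pw r'" using assms(2) by blast
    moreover have "wtw v = m" using assms(1) False by (simp add: hm_def)
    ultimately show ?thesis using r m by (simp add: cf_monom)
  next
    case True
    then show ?thesis using w by (auto simp: cf_monom)
  qed
  then have "\<pi> = scl (cf \<pi> w) (monom w)" by (rule ncs_eqI)
  then have "nf \<pi> = nf (scl (cf \<pi> w) (monom w))" by (rule arg_cong)
  then show ?thesis using m r by auto
qed simp

lemma fin_\<theta> [simp]: "fin \<theta>"
  using hm_fin[OF S \<theta>_hm] .

lemma ad_\<theta>_power: "0 < r \<Longrightarrow> ad (\<theta> ^ r) \<theta> = 0"
proof -
  assume "0 < r"
  then obtain k where "r = Suc k" by (cases r) auto
  then have "ad (\<theta> ^ r) \<theta> = ad (\<theta> ^ k) (ad \<theta> \<theta>)"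
    by (simp add: power_Suc2 ad_mult del: power_Suc)
  also have "ad \<theta> \<theta> = 0" by (simp add: prim_ad \<theta>_prim)
  finally show ?thesis by (simp add: ad_def lin_def)
qed

lemma dynkin_\<theta>_power: "2 \<le> r \<Longrightarrow> dynkin (\<theta> ^ r) = 0"
proof -
  assume "2 \<le> r"
  then obtain k where k: "r = Suc k" "0 < k" by (cases r) auto
  have "cf \<theta> [] = 0" using \<theta>_hm by (auto simp: hm_def)
  then have "dynkin (\<theta> ^ r) = ad (\<theta> ^ k) (scl 2 \<theta>)"
    using k dynkin_prim[OF S \<theta>_hm \<theta>_prim] by (simp add: power_Suc2 dynkin_mult del: power_Suc)
  also have "\<dots> = scl 2 (ad (\<theta> ^ k) \<theta>)"
    by (simp add: ad_def lin_def scl_sum mult.commute)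
  finally show ?thesis using ad_\<theta>_power k by simp
qed

text \<open>Commuting with \<open>th\<close> in coordinates moves blocks from the right of a core to
  its left until none is left on the right, where the coefficient is 0. So \<open>b\<close> is a
  multiple of some \<open>\<theta>^r\<close> with \<open>r \<ge> 2\<close>; the Dynkin operator
  kills it but multiplies a primitive \<open>b\<close> by \<open>m\<close>.\<close>

lemma prim_centralizer:
  assumes b: "hm S m b" "prim b" and c: "cm \<theta> b = 0" and m: "2 < m"
  shows "b = 0"
proof -
  obtain a where a: "hm S m a" "nf a = b" using nf_surj[OF b(1)] .
  have fa: "fin a" using hm_fin[OF S a(1)] .
  have "nf (cm (monom th) a) = 0"
    using c a(2) fa nf_mid[of 1 a] nf_mid[of a 1] by simp
  then have comm: "monom th * a = a * monom th"
    using nf_inj[of "cm (monom th) a"] fa by simp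
  have "cf a (pw p @ v @ pw q) = 0" if v: "core v" for p v q
  proof (induction q arbitrary: p)
    case 0
    have "cf (monom th * a) (pw (Suc p) @ v @ pw 0) = cf a (pw p @ v @ pw 0)"
      using cf_th_sandwich[OF v, of 1 a 0 "Suc p" 0] by simp
    moreover have "cf (a * monom th) (pw (Suc p) @ v @ pw 0) = 0"
      using cf_th_sandwich[OF v, of 0 a 1 "Suc p" 0] by simp
    ultimately show ?case using comm by simp
  next
    case (Suc q)
    have "cf (monom th * a) (pw (Suc p) @ v @ pw (Suc q)) = cf a (pw p @ v @ pw (Suc q))"
      using cf_th_sandwich[OF v, of 1 a 0 "Suc p" "Suc q"] by simp
    moreover have "cf (a * monom th) (pw (Suc p) @ v @ pw (Suc q)) = cf a (pw (Suc p) @ v @ pw q)"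
      using cf_th_sandwich[OF v, of 0 a 1 "Suc p" "Suc q"] by simp
    ultimately show ?case using comm Suc.IH[of "Suc p"] by simp
  qed
  then have "\<And>w. cf a w \<noteq> 0 \<Longrightarrow> \<exists>r. w = pw r" using core_decomp by metis
  then consider "b = 0" | c r where "m = 2 * r" "b = scl c (\<theta> ^ r)"
    using nf_pure[OF a(1)] a(2) by blast
  then show ?thesis
  proof cases
    case (2 c r)
    have "dynkin b = scl c (dynkin (\<theta> ^ r))"
      unfolding 2(2) dynkin_def by simp
    then have "dynkin b = 0" using dynkin_\<theta>_power 2 m by simp
    then have "scl (of_nat m) b = 0" using dynkin_prim[OF S b] by simp
    then have "of_nat m * cf b w = 0" for w by (metis cf_scl cf_zero)
    then show ?thesis using m by (auto intro: ncs_eqI)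
  qed
qed

text \<open>The leftover \<open>nf \<pi>\<close> is 0 or a multiple of \<open>\<theta>^r\<close>,
  where \<open>m > 2\<close> forces \<open>r \<ge> 2\<close>; such a power satisfies the side
  conditions of \<open>lie_preimage\<close>.\<close>

lemma lie_bracket_of_Tsum:
  assumes u: "hm S m u" "prim u" and m: "2 < m" and a: "hm S m a" "nf a = u"
    and T: "\<And>v N. core v \<Longrightarrow> Tsum a v N = 0"
  shows "\<exists>h. hm S (m - 2) h \<and> prim h \<and> u = cm \<theta> h"
proof -
  obtain e \<pi> where e: "hm S (m - 2) e" "a = cm (monom th) e + \<pi>" "hm S m \<pi>"
      "\<And>w. cf \<pi> w \<noteq> 0 \<Longrightarrow> \<exists>r. w = pw r"
    using Tsum_zero_decomp[OF a(1) _ T] m by auto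
  have f: "fin e" "fin \<pi>" using hm_fin[OF S] e by blast+
  have "u = nf (cm (monom th) e) + nf \<pi>"
    unfolding a(2)[symmetric] e(2) by (rule nf_simps(3)) (use f in auto)
  also have "nf (cm (monom th) e) = cm \<theta> (nf e)"
    using f nf_mid[of 1 e] nf_mid[of e 1] by simp
  finally have ue: "u = cm \<theta> (nf e) + nf \<pi>" .
  have "nf \<pi> = 0 \<or> (\<exists>c r. m = 2 * r \<and> nf \<pi> = scl c (\<theta> ^ r))"
    by (rule nf_pure[OF e(3)]) (rule e(4))
  then have "cm \<theta> (nf \<pi>) = 0 \<and> ad (nf \<pi>) \<theta> = 0 \<and> dynkin (nf \<pi>) = 0"
  proof (elim disjE exE conjE)
    fix c r assume r: "m = 2 * r" "nf \<pi> = scl c (\<theta> ^ r)"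
    then show ?thesis
      using m ad_\<theta>_power[of r] dynkin_\<theta>_power[of r]
      by (simp add: ad_def dynkin_def power_commutes)
  qed (simp_all add: ad_def dynkin_def)
  moreover have "hm S (m - 2) (nf e)"
    unfolding nf_def by (rule hm_lin[OF e(1)]) (metis hm_nfw order_refl)
  ultimately show ?thesis
    using lie_preimage[OF S \<theta>_hm \<theta>_prim u m _ ue] prim_centralizer[OF _ _ _ m] by auto
qed

end

section \<open>Vanishing of the obstruction\<close>

context block
begin

text \<open>\<open>Sk k e\<close> is the first order variation of \<open>\<theta>\<^sup>k\<close> in direction \<open>e\<close>; \<open>Rsp C k\<close> consists of the error terms
  containing a full run \<open>\<theta>\<^sup>k\<close> between words of weight at most \<open>C\<close>.\<close>

definition Sk :: "nat \<Rightarrow> (gen, 'k) ncs \<Rightarrow> (gen, 'k) ncs" where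
  "Sk k e = (\<Sum>i<k. \<theta> ^ i * e * \<theta> ^ (k - 1 - i))"

inductive Rsp :: "nat \<Rightarrow> nat \<Rightarrow> (gen, 'k) ncs \<Rightarrow> bool" for C k where
  Rsp_0: "Rsp C k 0"
| Rsp_monom: "set a \<subseteq> S \<Longrightarrow> set b \<subseteq> S \<Longrightarrow> wtw a \<le> C \<Longrightarrow> wtw b \<le> C \<Longrightarrow>
    Rsp C k (monom a * \<theta> ^ k * monom b)"
| Rsp_add: "Rsp C k r \<Longrightarrow> Rsp C k s \<Longrightarrow> Rsp C k (r + s)"
| Rsp_scl: "Rsp C k r \<Longrightarrow> Rsp C k (scl x r)"

lemma Rsp_uminus: "Rsp C k r \<Longrightarrow> Rsp C k (- r)"
  using Rsp_scl[of C k r "-1"] by simp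

lemma Rsp_diff: "Rsp C k r \<Longrightarrow> Rsp C k s \<Longrightarrow> Rsp C k (r - s)"
  using Rsp_add[OF _ Rsp_uminus, of C k r s] by simp

lemma Rsp_sum: "(\<And>i. i \<in> I \<Longrightarrow> Rsp C k (f i)) \<Longrightarrow> Rsp C k (sum f I)"
  by (induction I rule: infinite_finite_induct) (auto intro: Rsp_0 Rsp_add)

lemma Rsp_le: "Rsp C k r \<Longrightarrow> C \<le> C' \<Longrightarrow> Rsp C' k r"
  by (induction rule: Rsp.induct) (auto intro: Rsp.intros)

lemma Rsp_mult:
  assumes "Rsp C k r" "set a \<subseteq> S" "set b \<subseteq> S" "wtw a + C \<le> C'" "wtw b + C \<le> C'"
  shows "Rsp C' k (monom a * r * monom b)"
  using assms(1)
proof (induction rule: Rsp.induct)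
  case (Rsp_monom a' b')
  have "monom a * (monom a' * \<theta> ^ k * monom b') * monom b = monom (a @ a') * \<theta> ^ k * monom (b' @ b)"
    by (simp add: monom_append mult.assoc)
  then show ?case using Rsp_monom assms by (auto intro!: Rsp.Rsp_monom)
qed (auto simp: distrib_left distrib_right intro: Rsp.intros)

lemma Rsp_pol: "Rsp C k r \<Longrightarrow> pol S r"
  by (induction rule: Rsp.induct) (use hm_pol[OF S \<theta>_hm] in \<open>auto intro!: pol_mult pol_monom pol_power\<close>)

text \<open>\<open>Rsp\<close> seen in normal form coordinates. Lengths may replace weights because
  no word is longer than its weight.\<close>

definition run :: "nat \<Rightarrow> nat \<Rightarrow> (gen, 'k) ncs \<Rightarrow> bool" where
  "run C k r \<longleftrightarrow> (\<forall>w. cf r w \<noteq> 0 \<longrightarrow> (\<exists>a b. w = a @ pw k @ b \<and> length a \<le> C \<and> length b \<le> C))"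

lemma Rsp_nf:
  assumes "Rsp C (Suc k) r"
  shows "\<exists>s. fin s \<and> nf s = r \<and> run C (Suc k) s"
  using assms
proof (induction rule: Rsp.induct)
  case Rsp_0
  show ?case by (rule exI[of _ 0]) (simp add: run_def)
next
  case (Rsp_monom a b)
  obtain a' where a': "hm S (wtw a) a'" "nf a' = monom a" using nf_surj_monom[OF Rsp_monom(1)] by blast
  obtain b' where b': "hm S (wtw b) b'" "nf b' = monom b" using nf_surj_monom[OF Rsp_monom(2)] by blast
  have f: "fin a'" "fin b'" using hm_fin[OF S] a' b' by blast+
  have "nf (a' * monom th ^ Suc k * b') = monom a * \<theta> ^ Suc k * monom b"
    using nf_power_mid[OF f] a' b' by simp
  moreover have "run C (Suc k) (a' * monom th ^ Suc k * b')"
    unfolding run_def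
  proof (intro allI impI)
    fix w assume "cf (a' * monom th ^ Suc k * b') w \<noteq> 0"
    then obtain s t where w: "w = s @ t" "cf (a' * monom (pw (Suc k))) s \<noteq> 0" "cf b' t \<noteq> 0"
      unfolding monom_pw by (rule cf_mult_nonzeroE)
    from w(2) obtain s1 s2 where s: "s = s1 @ s2" "cf a' s1 \<noteq> 0" "cf (monom (pw (Suc k)) :: (gen, 'k) ncs) s2 \<noteq> 0"
      by (rule cf_mult_nonzeroE)
    have "s2 = pw (Suc k)" using s(3) by (simp add: cf_monom split: if_splits)
    moreover have "length s1 \<le> C" "length t \<le> C"
      using length_le_wtw[of s1] length_le_wtw[of t] s(2) w(3) a'(1) b'(1) Rsp_monom(3,4)
      by (auto simp: hm_def)
    ultimately show "\<exists>a b. w = a @ pw (Suc k) @ b \<and> length a \<le> C \<and> length b \<le> C"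
      using w s by (intro exI[of _ s1] exI[of _ t]) simp
  qed
  ultimately show ?case using f by (intro exI[of _ "a' * monom th ^ Suc k * b'"]) auto
next
  case (Rsp_add r s)
  then obtain r' s' where "fin r'" "nf r' = r" "run C (Suc k) r'" "fin s'" "nf s' = s" "run C (Suc k) s'"
    by blast
  moreover from this have "run C (Suc k) (r' + s')"
    unfolding run_def by (metis add.right_neutral cf_add)
  ultimately show ?case by (intro exI[of _ "r' + s'"]) simp
next
  case (Rsp_scl r x)
  then obtain r' where "fin r'" "nf r' = r" "run C (Suc k) r'" by blast
  moreover from this have "run C (Suc k) (scl x r')"
    unfolding run_def by (metis mult_zero_right cf_scl)
  ultimately show ?case by (intro exI[of _ "scl x r'"]) simp
qed

text \<open>Apart from at most \<open>C\<close> letters at each end the word would be periodic with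
  period \<open>th\<close>. If \<open>pw p\<close> is long, this covers two adjacent letters
  \<open>d\<close>, one of which would have to be the first letter of \<open>th\<close>. Otherwise
  \<open>q\<close> is large, and periodicity across the end of \<open>pw A\<close> makes
  \<open>v @ pw q\<close> start with \<open>th\<close>, which a core forbids.\<close>

lemma no_run:
  assumes v: "core v" and d: "d \<noteq> hd th" and M: "length v + 2 \<le> M" and A: "A = N + 2 * C + length v + 5"
    and pq: "p + q = A" and W: "pw p @ replicate M d @ pw A @ v @ pw q = a @ pw k @ b"
    and ab: "length a \<le> C" "length b \<le> C"
  shows False
proof -
  define t where "t = length th"
  define W where "W = pw p @ replicate M d @ pw A @ v @ pw q"
  define L where "L = length W"
  have t: "t = 1 \<or> t = 2" using length_th by (auto simp: t_def)
  have L1: "L = p * t + M + A * t + length v + q * t" by (simp add: L_def W_def t_def)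
  have L2: "L = length a + k * t + length b" by (simp add: L_def W_def W t_def)
  have reg: "W ! i = th ! ((i - length a) mod t)" if "length a \<le> i" "i + length b < L" for i
  proof -
    have "W ! i = pw k ! (i - length a)"
    proof -
      have "i - length a < k * length th" using that L2 by (simp add: t_def)
      then show ?thesis unfolding W_def W using that by (simp add: nth_append)
    qed
    also have "\<dots> = th ! ((i - length a) mod t)"
      unfolding t_def by (rule nth_pw) (use that L2 in \<open>simp add: t_def\<close>)
    finally show ?thesis .
  qed
  have At: "A \<le> A * t" and qt: "q \<le> q * t" and ptp: "p \<le> p * t" using t by auto
  have th0: "th ! 0 = hd th" by (simp add: hd_conv_nth)
  show False
  proof (cases "C \<le> p * t")
    case True
    have D: "W ! (p * t + j) = d" if "j < 2" for j
      using that M by (auto simp: W_def nth_append t_def)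
    have "th ! ((p * t + j - length a) mod t) = d" if "j < 2" for j
    proof -
      have "p * t + j + length b < L" using that ab L1 At A M by linarith
      then show ?thesis using reg[of "p * t + j"] D[OF that] True ab by simp
    qed
    from this[of 0] this[of 1] have
      *: "th ! ((p * t - length a) mod t) = d" "th ! ((p * t + 1 - length a) mod t) = d" by simp_all
    have "p * t + 1 - length a = Suc (p * t - length a)" using True ab by simp
    \<comment> \<open>Blocks have length at most 2, so one of two adjacent positions starts a
      block.\<close>
    then have "(p * t - length a) mod t = 0 \<or> (p * t + 1 - length a) mod t = 0"
      using t by (elim disjE) (auto, presburger)
    then show False using * th0 d by auto
  next
    case False
    \<comment> \<open>Here \<open>p < C\<close>; the term \<open>2 * C\<close> in \<open>A\<close>
      leaves a second \<open>C\<close> for \<open>q\<close>.\<close>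
    then have q: "C + 5 \<le> q" using pq A ptp by linarith
    define P where "P = pw p @ replicate M d @ pw (A - 1)"
    define Q where "Q = length P"
    have WP: "W = P @ th @ (v @ pw q)"
    proof -
      have "Suc (A - 1) = A" using A by simp
      then have "pw A = pw (A - 1) @ th" using pw_Suc2[of "A - 1"] by simp
      then show ?thesis by (simp add: W_def P_def)
    qed
    have Q1: "length a \<le> Q"
    proof -
      have "A - 1 \<le> (A - 1) * t" using t by auto
      moreover have "Q = p * t + M + (A - 1) * t" by (simp add: Q_def P_def t_def)
      ultimately show ?thesis using ab A by linarith
    qed
    have Q2: "Q + t + length v + q * t = L" by (simp add: L_def WP Q_def t_def)
    have tq: "t + C < q * t"
    proof -
      have "(C + 5) * t \<le> q * t" using q by (rule mult_le_mono1)
      moreover have "t + C < (C + 5) * t" using t by auto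
      ultimately show ?thesis by linarith
    qed
    have "W ! Q = hd th" by (simp add: WP Q_def nth_append th0)
    \<comment> \<open>The first letter of \<open>th\<close> occurs in it only once, so seeing it at
      \<open>Q\<close> fixes the phase of the run.\<close>
    then have "th ! ((Q - length a) mod t) = hd th"
      using reg[OF Q1] Q2 tq ab by simp
    then have al: "(Q - length a) mod t = 0"
      using th_nth_0 t by (auto simp: t_def)
    have "(v @ pw q) ! j = th ! j" if j: "j < t" for j
    proof -
      have "(v @ pw q) ! j = W ! (Q + t + j)" by (simp add: WP Q_def t_def nth_append)
      also have "\<dots> = th ! ((Q + t + j - length a) mod t)"
        by (rule reg) (use Q1 Q2 tq ab j in auto)
      also have "Q + t + j - length a = (Q - length a) + t + j" using Q1 by simp
      also have "(Q - length a + t + j) mod t = j"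
        using al j by (metis add.right_neutral add.commute mod_add_left_eq mod_add_self2 mod_less)
      finally show ?thesis .
    qed
    moreover have "t \<le> length (v @ pw q)" using tq by (simp add: t_def[symmetric])
    ultimately have "take t (v @ pw q) = th"
      by (intro nth_equalityI) (auto simp: t_def simp del: take_append)
    then have "v @ pw q = th @ drop t (v @ pw q)" by (metis append_take_drop_id)
    then show False using core_left[OF v] by blast
  qed
qed

lemma nf_surj_pol:
  assumes "pol S b" obtains a where "fin a" "nf a = b"
proof -
  have "\<exists>a. fin a \<and> nf a = monom v" if "cf b v \<noteq> 0" for v
    using nf_surj_monom[of v] that assms hm_fin[OF S] by (auto simp: pol_def)
  then obtain g where g: "\<And>v. cf b v \<noteq> 0 \<Longrightarrow> fin (g v) \<and> nf (g v) = monom v"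
    by metis
  show thesis using that nf_lift[OF pol_fin[OF assms] g] by blast
qed

lemma nf_vr_power_left: "d \<noteq> hd th \<Longrightarrow> fin a \<Longrightarrow> nf (vr d ^ M * a) = vr d ^ M * nf a"
  by (induction M) (auto simp: nf_vr_left mult.assoc)

text \<open>Of the \<open>A + B = k - 1 + N\<close> blocks around \<open>v\<close> the powers of
  \<open>th\<close> use up \<open>k - 1\<close>. The bounds make each distribution of the remaining
  \<open>N\<close> to the two sides of \<open>v\<close> occur exactly once.\<close>

lemma Tsum_sandwich:
  assumes v: "core v" and N: "N \<le> A" "N \<le> B" and k: "A + B + 1 = k + N" "A < k" "B < k"
  shows "cf (\<Sum>i<k. monom th ^ i * e * monom th ^ (k - 1 - i)) (pw A @ v @ pw B) = Tsum e v N"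
proof -
  have "cf (\<Sum>i<k. monom th ^ i * e * monom th ^ (k - 1 - i)) (pw A @ v @ pw B)
      = (\<Sum>i<k. if i \<le> A \<and> k - 1 - i \<le> B then cf e (pw (A - i) @ v @ pw (B - (k - 1 - i))) else 0)"
    unfolding cf_sum cf_th_sandwich[OF v] ..
  also have "\<dots> = (\<Sum>i\<in>{i. i < k \<and> i \<le> A \<and> k - 1 - i \<le> B}. cf e (pw (A - i) @ v @ pw (B - (k - 1 - i))))"
    by (rule sum.mono_neutral_cong_right) auto
  also have "\<dots> = Tsum e v N"
    unfolding Tsum_def
  proof (rule sum.reindex_bij_witness[of _ "\<lambda>p. A - p" "\<lambda>i. A - i"], goal_cases)
    case (5 i)
    then have "B - (k - 1 - i) = N - (A - i)" using assms by auto
    then show ?case by simp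
  qed (use assms in auto)
  finally show ?thesis .
qed

text \<open>The coefficient of \<open>th\<^sup>p d\<^sup>M th\<^sup>A v th\<^sup>q\<close> in \<open>[d\<^sup>M, Sk k e] + r\<close>: the runs are too short for the
  remainder \<open>r\<close>, and the tail of the word is not a power of \<open>d\<close>.\<close>

lemma cf_commutator_Sk:
  assumes v: "core v" and d: "d \<noteq> hd th" "d \<in> S" and M: "length v + 2 \<le> M"
    and A: "A = N + 2 * C + length v + 5" and k: "k = 2 * A + 1 - N" and pq: "p + q = A"
    and e: "fin e" "pol S (nf e)" and r: "Rsp C k r"
    and y: "fin y" "nf y = vr d ^ M * Sk k (nf e) - Sk k (nf e) * vr d ^ M + r"
  shows "cf y (pw p @ replicate M d @ pw A @ v @ pw q) = (if p = 0 then Tsum e v N else 0)"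
proof -
  define W where "W = pw p @ replicate M d @ pw A @ v @ pw q"
  define s where "s = (\<Sum>i<k. monom th ^ i * e * monom th ^ (k - 1 - i))"
  obtain k' where k': "k = Suc k'" using k A by (cases k) auto
  have fs: "fin s" using e by (simp add: s_def)
  obtain r' where r': "fin r'" "nf r' = r" "run C k r'" using Rsp_nf[of C k' r] r k' by auto
  \<comment> \<open>\<open>nf\<close> does not commute with right multiplication by
    \<open>d\<close>, so the summand of \<open>Sk\<close> that has \<open>e\<close> directly before
    \<open>d^M\<close> needs a preimage of its own.\<close>
  obtain x where x: "fin x" "nf x = nf e * vr d ^ M"
    by (rule nf_surj_pol[of "nf e * vr d ^ M"]) (use e d in simp_all)
  \<comment> \<open>Coordinates of \<open>Sk k (nf e) * vr d ^ M\<close>: for \<open>i < k'\<close>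
    at least one block separates \<open>e\<close> from the marker, and the summand
    \<open>i = k'\<close> is expressed through \<open>x\<close>.\<close>
  define z where "z = (\<Sum>i<k'. monom th ^ i * e * monom th ^ (k' - i)) * vr d ^ M + monom th ^ k' * x"
  have nfs: "nf s = Sk k (nf e)"
    using e by (simp add: s_def Sk_def nf_power_right nf_power_left)
  have nfd: "nf (vr d ^ M) = vr d ^ M" using nf_vr_power_left[OF d(1), of 1 M] by simp
  have "nf z = Sk k (nf e) * vr d ^ M"
  proof -
    have "nf (monom th ^ i * e * monom th ^ (k' - i) * vr d ^ M) = \<theta> ^ i * nf e * \<theta> ^ (k' - i) * vr d ^ M"
      if i: "i < k'" for i
    proof -
      obtain j where "k' - i = Suc j" using i by (cases "k' - i") auto
      then show ?thesis
        using nf_power_mid[of "monom th ^ i * e" "vr d ^ M" j] e nfd by (simp add: nf_power_left)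
    qed
    then have "nf z = (\<Sum>i<k'. \<theta> ^ i * nf e * \<theta> ^ (k' - i) * vr d ^ M) + \<theta> ^ k' * (nf e * vr d ^ M)"
      using e x by (simp add: z_def sum_distrib_right nf_power_left)
    then show ?thesis
      by (simp add: Sk_def k' sum_distrib_right distrib_right mult.assoc)
  qed
  then have "nf (y - (vr d ^ M * s - z + r')) = 0"
    using y r' fs e x nfs nf_vr_power_left[OF d(1) fs] by (simp add: z_def)
  then have y_eq: "y = vr d ^ M * s - z + r'"
    using nf_inj[of "y - (vr d ^ M * s - z + r')"] y r' fs e x by (simp add: z_def)
  have "cf r' W = 0"
  proof (rule ccontr)
    assume "cf r' W \<noteq> 0"
    then obtain a b where "W = a @ pw k @ b" "length a \<le> C" "length b \<le> C"
      using r'(3) by (auto simp: run_def)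
    then show False using no_run[OF v d(1) M A pq] unfolding W_def by blast
  qed
  \<comment> \<open>The summand with \<open>x\<close> begins with \<open>k'\<close> blocks, but only
    \<open>p < k'\<close> precede the marker in \<open>W\<close>. The others end in
    \<open>d^M\<close>, whereas a block lies within the last \<open>M\<close> letters of
    \<open>W\<close>; this is why \<open>M\<close> exceeds the length of \<open>v\<close> by
    2.\<close>
  moreover have "cf z W = 0"
  proof -
    have "cf (monom th ^ k' * x) W = 0"
    proof -
      have "replicate M d @ pw A @ v @ pw q \<noteq> th @ s" for s
      proof
        assume "replicate M d @ pw A @ v @ pw q = th @ s"
        then have "hd (replicate M d @ pw A @ v @ pw q) = hd (th @ s)" by (rule arg_cong)
        then show False using d(1) M by (simp add: hd_append)
      qed
      moreover have "p < k'" using pq k k' A by simp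
      ultimately show ?thesis unfolding W_def by (subst cf_th_left) auto
    qed
    moreover have "cf (a * vr d ^ M) W = 0" for a
    proof -
      have False if "W = u @ replicate M d" for u
      proof -
        have "\<exists>W' v'. W = W' @ th @ v' \<and> length (th @ v') \<le> M"
        proof (cases q)
          case 0
          have "Suc (A - 1) = A" using A by simp
          then have "pw A = pw (A - 1) @ th" using pw_Suc2[of "A - 1"] by simp
          then show ?thesis using 0 M length_th
            by (intro exI[of _ "pw p @ replicate M d @ pw (A - 1)"] exI[of _ v]) (simp add: W_def)
        next
          case (Suc q')
          then show ?thesis using M length_th
            by (intro exI[of _ "pw p @ replicate M d @ pw A @ v @ pw q'"] exI[of _ "[]"])
              (simp add: W_def pw_Suc2)
        qed
        then obtain W' v' where W': "W = W' @ th @ v'" "length (th @ v') \<le> M" by blast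
        have "drop (length W') W = th @ v'" by (simp add: W')
        moreover have "set (drop (length W') W) \<subseteq> {d}"
        proof -
          have "length u \<le> length W'" using W' that by (metis add_le_cancel_right length_append length_replicate nat_add_left_cancel_le add.commute)
          then have "drop (length W') W = drop (length W' - length u) (replicate M d)"
            by (simp add: that)
          then show ?thesis by (metis in_set_dropD in_set_replicate insertI1 subsetI singletonI)
        qed
        ultimately have "hd th \<in> {d}" using th_Nil by (metis hd_in_set in_mono set_append UnCI)
        then show False using d by simp
      qed
      then show ?thesis by (auto simp: cf_mult_monom simp flip: monom_replicate)
    qed
    ultimately show ?thesis by (simp add: z_def)
  qed
  moreover have "cf (vr d ^ M * s) W = (if p = 0 then Tsum e v N else 0)"
  proof (cases p)
    case 0
    then have "cf (vr d ^ M * s) W = cf s (pw A @ v @ pw q)"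
      by (simp add: W_def flip: monom_replicate)
    also have "\<dots> = Tsum e v N"
      unfolding s_def by (rule Tsum_sandwich[OF v]) (use 0 pq A k in auto)
    finally show ?thesis using 0 by simp
  next
    case (Suc p')
    have "take M W \<noteq> replicate M d"
    proof
      assume "take M W = replicate M d"
      moreover obtain M' where "M = Suc M'" using M by (cases M) auto
      ultimately have "hd (take M W) = d" "hd (take M W) = hd W" by (cases W; simp)+
      moreover have "hd W = hd th" by (simp add: W_def Suc pw_Suc hd_append)
      ultimately show False using d by simp
    qed
    then show ?thesis using Suc by (simp add: cf_monom_mult flip: monom_replicate)
  qed
  ultimately show ?thesis unfolding W_def[symmetric] y_eq by simp
qed

lemma Rsp_vr_power:
  assumes "Rsp C k r" "d \<in> S" "i \<le> M" "j \<le> M"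
  shows "Rsp (C + M * wt d) k (vr d ^ i * r * vr d ^ j)"
proof -
  have w: "wtw (replicate i d) = i * wt d" for i by (induction i) auto
  show ?thesis unfolding monom_replicate[symmetric]
    by (rule Rsp_mult[OF assms(1)]) (use assms in \<open>auto simp: w\<close>)
qed

lemma cm_power: "cm (a ^ M) (b::'b::ring_1) = (\<Sum>i<M. a ^ i * cm a b * a ^ (M - Suc i))"
proof (induction M)
  case (Suc M)
  have "(\<Sum>i<Suc M. a ^ i * cm a b * a ^ (Suc M - Suc i)) = (\<Sum>i<M. a ^ i * cm a b * a ^ (M - Suc i)) * a + a ^ M * cm a b"
    by (simp add: sum_distrib_right mult.assoc power_Suc2[symmetric] Suc_diff_Suc del: power_Suc)
  also have "\<dots> = cm (a ^ M) b * a + a ^ M * cm a b" by (simp add: Suc)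
  also have "\<dots> = cm (a ^ Suc M) b" by (simp add: algebra_simps power_Suc2 del: power_Suc)
  finally show ?case by simp
qed simp

text \<open>The case \<open>y = 0\<close>, \<open>p = 0\<close> of \<open>cf_commutator_Sk\<close>.
  The relation for \<open>d\<close> gives one for \<open>d^M\<close> by \<open>cm_power\<close>,
  with \<open>C\<close> enlarged by the weight of the marker; \<open>k\<close> is chosen after that,
  hence the uniform \<open>C\<close> in \<open>rel\<close>.\<close>

lemma Tsum_zero_of_relation:
  assumes d: "d \<noteq> hd th" "d \<in> S" and e: "fin e" "pol S (nf e)"
    and rel: "\<And>l. \<exists>r. Rsp C l r \<and> cm (vr d) (Sk l (nf e)) + r = 0"
    and v: "core v"
  shows "Tsum e v N = 0"
proof -
  define M where "M = length v + 2"
  define C' where "C' = C + M * wt d"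
  define A where "A = N + 2 * C' + length v + 5"
  define k where "k = 2 * A + 1 - N"
  obtain r where r: "Rsp C k r" "cm (vr d) (Sk k (nf e)) = - r"
    using rel[of k] by (auto simp: add_eq_0_iff2)
  define r' where "r' = (\<Sum>i<M. vr d ^ i * r * vr d ^ (M - Suc i))"
  have R: "Rsp C' k r'"
    unfolding r'_def C'_def by (rule Rsp_sum, rule Rsp_vr_power[OF r(1) d(2)]) auto
  have eq: "nf 0 = vr d ^ M * Sk k (nf e) - Sk k (nf e) * vr d ^ M + r'"
    unfolding cm_power r(2) r'_def by (simp add: sum_negf)
  show ?thesis
    using cf_commutator_Sk[OF v d _ A_def k_def _ e R fin_0 eq, of 0 A] by (simp add: M_def)
qed

text \<open>\<open>cyc\<close> stands for the vanishing of the cyclic word and enters only through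
  \<open>rel\<close> and \<open>central\<close>. The marker is used twice: \<open>E\<close> inherits
  a relation from \<open>rel\<close>, so its \<open>Tsum\<close> vanishes at all cores; at a core
  that begins with a marker this sum has a single surviving term, the \<open>Tsum\<close> of
  \<open>u\<close>.\<close>

theorem Tsum_zero:
  assumes d: "d \<noteq> hd th" "d \<in> S" and u: "fin u" "pol S (nf u)"
    and rel: "\<And>E. pol S E \<Longrightarrow> (\<And>l. cyc (\<theta> ^ l * E)) \<Longrightarrow> \<exists>C. \<forall>l. \<exists>r. Rsp C l r \<and> cm (vr d) (Sk l E) + r = 0"
    and central: "\<And>M. \<exists>C. \<forall>k. \<exists>R. Rsp C k R \<and> (\<forall>l. cyc (\<theta> ^ l * (cm (vr d ^ M) (Sk k (nf u)) + R)))"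
    and v: "core v"
  shows "Tsum u v N = 0"
proof -
  define M where "M = length v + 2"
  obtain C where C: "\<And>k. \<exists>R. Rsp C k R \<and> (\<forall>l. cyc (\<theta> ^ l * (cm (vr d ^ M) (Sk k (nf u)) + R)))"
    using central[of M] by blast
  define A where "A = N + 2 * C + length v + 5"
  define k where "k = 2 * A + 1 - N"
  obtain R where R: "Rsp C k R" "\<And>l. cyc (\<theta> ^ l * (cm (vr d ^ M) (Sk k (nf u)) + R))"
    using C[of k] by blast
  define E where "E = cm (vr d ^ M) (Sk k (nf u)) + R"
  have "pol S (Sk k (nf u))"
    using u hm_pol[OF S \<theta>_hm] by (simp add: Sk_def)
  then have E: "pol S E"
    using d Rsp_pol[OF R(1)] by (simp add: E_def)
  obtain y where y: "fin y" "nf y = E" using nf_surj_pol[OF E] .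
  obtain C' where C': "\<And>l. \<exists>r. Rsp C' l r \<and> cm (vr d) (Sk l (nf y)) + r = 0"
    using rel[OF E] R(2) y(2) by (auto simp: E_def)
  \<comment> \<open>The left end is protected by the marker. The right end is that of
    \<open>pw A @ v\<close>, which cannot end in \<open>th\<close> because \<open>v\<close> is a
    core.\<close>
  have core': "core (replicate M d @ pw A @ v)"
    unfolding core_def
  proof (intro conjI allI)
    show "replicate M d @ pw A @ v \<noteq> []" by (simp add: M_def)
    fix s
    show "replicate M d @ pw A @ v \<noteq> th @ s"
    proof
      assume "replicate M d @ pw A @ v = th @ s"
      then have "hd (replicate M d @ pw A @ v) = hd (th @ s)" by (rule arg_cong)
      then show False using d(1) by (simp add: M_def)
    qed
    have *: "pw 1 @ v \<noteq> s' @ th" for s' using core_right[OF v] .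
    show "replicate M d @ pw A @ v \<noteq> s @ th"
    proof
      assume a: "replicate M d @ pw A @ v = s @ th"
      have "0 < A" by (simp add: A_def)
      then have "pw A = pw (A - 1) @ pw 1" using pw_Suc2[of "A - 1"] by (simp add: pw_Suc)
      then have b: "(replicate M d @ pw (A - 1)) @ (pw 1 @ v) = s @ th" using a by simp
      have "length (pw 1 @ v) \<ge> length th" by simp
      then have "length (replicate M d @ pw (A - 1)) \<le> length s"
        using arg_cong[OF b, of length] by simp
      then have "pw 1 @ v = drop (length (replicate M d @ pw (A - 1))) s @ th"
        using arg_cong[OF b, of "drop (length (replicate M d @ pw (A - 1)))"] by simp
      then show False using * by blast
    qed
  qed
  have "Tsum y (replicate M d @ pw A @ v) A = 0"
    using Tsum_zero_of_relation[OF d y(1) _ C' core'] E y(2) by simp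
  \<comment> \<open>Blocks in front of the marker give coefficient 0, so only \<open>p = 0\<close>
    remains.\<close>
  moreover have "Tsum y (replicate M d @ pw A @ v) A = (\<Sum>p\<le>A. if p = 0 then Tsum u v N else 0)"
    unfolding Tsum_def[of y]
  proof (intro sum.cong refl)
    fix p assume "p \<in> {..A}"
    then show "cf y (pw p @ (replicate M d @ pw A @ v) @ pw (A - p)) = (if p = 0 then Tsum u v N else 0)"
      using cf_commutator_Sk[OF v d _ A_def k_def _ u R(1) y(1), of M p "A - p"] y(2)
      by (simp add: M_def E_def)
  qed
  ultimately show ?thesis by simp
qed

end

section \<open>Cyclic words and derivations\<close>

text \<open>\<open>tau w a\<close> is the coefficient of the cyclic word of \<open>w\<close> in \<open>|a|\<close>, multiplied by the order of the
  rotational symmetry of \<open>w\<close>.\<close>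

definition tau :: "'a list \<Rightarrow> ('a, 'k::comm_ring_1) ncs \<Rightarrow> 'k" where
  "tau w a = (\<Sum>r<length w. cf a (rotate r w))"

definition cyc0 :: "('a, 'k::comm_ring_1) ncs \<Rightarrow> bool" where
  "cyc0 a \<longleftrightarrow> (\<forall>w. tau w a = 0)"

lemma tau_simps [simp]: "tau w 0 = 0" "tau w (a + b) = tau w a + tau w b" "tau w (- a) = - tau w a"
  "tau w (a - b) = tau w a - tau w b" "tau w (scl k a) = k * tau w a"
  by (simp_all add: tau_def sum.distrib sum_negf sum_subtractf sum_distrib_left)

lemma tau_sum [simp]: "tau w (sum f I) = (\<Sum>i\<in>I. tau w (f i))"
  by (induction I rule: infinite_finite_induct) auto

lemma sum_rotate_shift: "(\<Sum>r<length w. f (rotate (r + i) w)) = (\<Sum>r<length w. f (rotate r w) :: 'b::ab_group_add)"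
proof (induction i)
  case (Suc i)
  let ?g = "\<lambda>r. f (rotate (r + i) w)"
  have "(\<Sum>r<length w. ?g (Suc r)) + ?g 0 = (\<Sum>r<length w. ?g r) + ?g (length w)"
    using sum.lessThan_Suc_shift[of ?g "length w"] sum.lessThan_Suc[of ?g "length w"]
    by (simp only: add.commute)
  moreover have "?g (length w) = ?g 0"
    by (simp add: rotate_conv_mod[of "length w + i"] rotate_conv_mod[of i])
  ultimately show ?case using Suc by simp
qed simp

text \<open>Cutting \<open>rotate r w\<close> at \<open>i\<close> yields the same two pieces, in
  exchanged order, as cutting \<open>rotate (r + i) w\<close> at
  \<open>length w - i\<close>.\<close>

lemma tau_mult_commute: "tau w (a * b) = tau w (b * a)"
proof -
  let ?L = "length w"
  have "tau w (a * b) = (\<Sum>i\<le>?L. \<Sum>r<?L. cf a (take i (rotate r w)) * cf b (drop i (rotate r w)))"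
    unfolding tau_def cf_mult by (subst sum.swap) simp
  also have "\<dots> = (\<Sum>i\<le>?L. \<Sum>r<?L. cf b (take (?L - i) (rotate r w)) * cf a (drop (?L - i) (rotate r w)))"
  proof (rule sum.cong[OF refl])
    fix i assume "i \<in> {..?L}"
    then have i: "i \<le> ?L" by simp
    have "(\<Sum>r<?L. cf a (take i (rotate r w)) * cf b (drop i (rotate r w)))
        = (\<Sum>r<?L. (\<lambda>v. cf b (take (?L - i) v) * cf a (drop (?L - i) v)) (rotate (r + i) w))"
    proof (intro sum.cong refl)
      fix r
      have "rotate (r + i) w = drop i (rotate r w) @ take i (rotate r w)"
        using i rotate_append[of "take i (rotate r w)" "drop i (rotate r w)"]
        by (simp add: add.commute[of r] min_absorb2 flip: rotate_rotate)
      then show "cf a (take i (rotate r w)) * cf b (drop i (rotate r w))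
          = (\<lambda>v. cf b (take (?L - i) v) * cf a (drop (?L - i) v)) (rotate (r + i) w)"
        using i by (simp add: mult.commute)
    qed
    also have "\<dots> = (\<Sum>r<?L. cf b (take (?L - i) (rotate r w)) * cf a (drop (?L - i) (rotate r w)))"
      by (rule sum_rotate_shift)
    finally show "(\<Sum>r<?L. cf a (take i (rotate r w)) * cf b (drop i (rotate r w)))
        = (\<Sum>r<?L. cf b (take (?L - i) (rotate r w)) * cf a (drop (?L - i) (rotate r w)))" .
  qed
  also have "\<dots> = (\<Sum>i\<le>?L. \<Sum>r<?L. cf b (take i (rotate r w)) * cf a (drop i (rotate r w)))"
    by (rule sum.reindex_bij_witness[of _ "\<lambda>i. ?L - i" "\<lambda>i. ?L - i"]) auto
  also have "\<dots> = tau w (b * a)"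
    unfolding tau_def cf_mult by (subst sum.swap) simp
  finally show ?thesis .
qed

text \<open>Cyclic derivative with respect to \<open>c\<close>, with \<open>p\<close> inserted where the word was cut: each occurrence
  \<open>w = w' c w''\<close> contributes \<open>w'' p w'\<close>.\<close>

definition insw :: "'a \<Rightarrow> ('a, 'k::comm_ring_1) ncs \<Rightarrow> 'a list \<Rightarrow> ('a, 'k) ncs" where
  "insw c p w = (\<Sum>q<length w. if w ! q = c then monom (drop (Suc q) w) * p * monom (take q w) else 0)"

definition ins :: "'a \<Rightarrow> ('a, 'k::comm_ring_1) ncs \<Rightarrow> ('a, 'k) ncs \<Rightarrow> ('a, 'k) ncs" where
  "ins c p a = lin (insw c p) a"

abbreviation cd :: "'a \<Rightarrow> ('a, 'k::comm_ring_1) ncs \<Rightarrow> ('a, 'k) ncs" where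
  "cd c a \<equiv> ins c 1 a"

lemma sum_append_split:
  "(\<Sum>q<m + n. f q) = (\<Sum>q<m. f q) + (\<Sum>q<n. f (m + q :: nat) :: 'b::comm_monoid_add)"
  by (induction n) (auto simp: add.assoc)

lemma insw_append: "insw c p (u @ v) = insw c (monom v * p) u + insw c (p * monom u) v"
proof -
  have "insw c p (u @ v) = (\<Sum>q<length u. if u ! q = c then monom (drop (Suc q) u @ v) * p * monom (take q u) else 0)
      + (\<Sum>q<length v. if v ! q = c then monom (drop (Suc q) v) * p * monom (u @ take q v) else 0)"
    unfolding insw_def length_append sum_append_split
    by (intro arg_cong2[of _ _ _ _ "(+)"] sum.cong refl) (auto simp: nth_append)
  then show ?thesis by (simp add: insw_def monom_append mult.assoc cong: if_cong)
qed

lemma insw_linear [simp]: "insw c 0 w = 0" "insw c (p + q) w = insw c p w + insw c q w"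
  "insw c (scl k p) w = scl k (insw c p w)"
  by (auto simp: insw_def distrib_left distrib_right scl_sum simp flip: sum.distrib intro!: sum.cong sum.neutral)

lemma ins_linear [simp]:
  "fin a \<Longrightarrow> fin b \<Longrightarrow> ins c p (a + b) = ins c p a + ins c p b"
  "fin a \<Longrightarrow> fin b \<Longrightarrow> ins c p (a - b) = ins c p a - ins c p b"
  "fin a \<Longrightarrow> ins c p (scl k a) = scl k (ins c p a)"
  "ins c p 0 = 0"
  "(\<And>i. i \<in> I \<Longrightarrow> fin (f i)) \<Longrightarrow> ins c p (sum f I) = (\<Sum>i\<in>I. ins c p (f i))"
  by (simp_all add: ins_def)

lemma ins_linear_mid:
  "ins c 0 a = 0" "ins c (p + q) a = ins c p a + ins c q a" "ins c (scl k p) a = scl k (ins c p a)"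
  by (simp_all add: ins_def lin_def scl_distrib sum.distrib scl_sum mult.commute)

text \<open>The reason for the parameter \<open>p\<close>: the factor that does not contain the cut
  is absorbed into the inserted element, which gives a product rule that plain cyclic derivatives do
  not have.\<close>

lemma ins_mult:
  assumes "fin a" "fin b"
  shows "ins c p (a * b) = ins c (b * p) a + ins c (p * a) b"
  using assms(1)
proof (induction rule: fin_induct)
  case (monom u)
  show ?case using assms(2)
  proof (induction rule: fin_induct)
    case (monom v)
    show ?case by (simp add: ins_def insw_append flip: monom_append)
  qed (auto simp: distrib_left distrib_right ins_linear_mid scl_distrib)
qed (use assms in \<open>auto simp: distrib_left distrib_right ins_linear_mid scl_distrib\<close>)

lemma ins_vr: "ins c p (vr b) = (if b = c then p else 0)"
  by (simp add: ins_def insw_def)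

lemma ins_1: "ins c p 1 = 0"
  by (simp add: ins_def insw_def)

lemma ins_power:
  assumes "fin t" shows "ins c p (t ^ k) = ins c (\<Sum>i<k. t ^ (k - 1 - i) * p * t ^ i) t"
proof (induction k arbitrary: p)
  case 0
  show ?case by (simp add: ins_1 ins_linear_mid)
next
  case (Suc k)
  have "ins c p (t ^ Suc k) = ins c (t ^ k * p) t + ins c (\<Sum>i<k. t ^ (k - 1 - i) * (p * t) * t ^ i) t"
    using assms by (simp add: ins_mult Suc)
  also have "\<dots> = ins c (t ^ k * p + (\<Sum>i<k. t ^ (k - 1 - i) * (p * t) * t ^ i)) t"
    by (simp add: ins_linear_mid)
  also have "t ^ k * p + (\<Sum>i<k. t ^ (k - 1 - i) * (p * t) * t ^ i) = (\<Sum>i<Suc k. t ^ (Suc k - 1 - i) * p * t ^ i)"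
    unfolding sum.lessThan_Suc_shift by (simp add: mult.assoc)
  finally show ?case .
qed

lemma sum_rotate_inverse:
  assumes "length u = length y"
  shows "(\<Sum>q<length u. if rotate q u = y then 1 else 0 :: 'b::comm_ring_1) = (\<Sum>r<length y. if rotate r y = u then 1 else 0)"
proof -
  let ?L = "length y" and ?g = "\<lambda>v. if v = u then 1 else 0 :: 'b"
  have "rotate q u = y \<longleftrightarrow> rotate (?L - q) y = u" if "q < ?L" for q
  proof
    assume "rotate q u = y"
    then have "rotate (?L - q) y = rotate ?L u" using that by (auto simp: rotate_rotate)
    then show "rotate (?L - q) y = u" using assms by (simp add: rotate_id)
  next
    assume "rotate (?L - q) y = u"
    then have "rotate q u = rotate ?L y" using that by (auto simp: rotate_rotate)
    then show "rotate q u = y" by (simp add: rotate_id)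
  qed
  then have "(\<Sum>q<length u. if rotate q u = y then 1 else 0 :: 'b) = (\<Sum>q<?L. ?g (rotate (Suc (?L - Suc q)) y))"
    using assms by (intro sum.cong) (auto simp: Suc_diff_Suc)
  also have "\<dots> = (\<Sum>r<?L. ?g (rotate (Suc r) y))"
    using sum.nat_diff_reindex[of "\<lambda>r. ?g (rotate (Suc r) y)" ?L] by simp
  also have "\<dots> = (\<Sum>r<?L. ?g (rotate r y))"
    using sum_rotate_shift[of ?g 1 y] by simp
  finally show ?thesis .
qed

lemma rot_rotate: "q < length u \<Longrightarrow> u ! q # rot u q = rotate q u"
  by (simp add: rot_def rotate_drop_take Cons_nth_drop_Suc flip: append_Cons)

text \<open>Cyclic derivatives depend on \<open>a\<close> only through its cyclic word. This is how
  cyclic identities become identities in the free algebra.\<close>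

lemma cf_cd:
  fixes a :: "('a, 'k::comm_ring_1) ncs"
  assumes "fin a" shows "cf (cd c a) w = tau (c # w) a"
  using assms
proof (induction rule: fin_induct)
  case (monom u)
  have "cf (cd c (monom u :: ('a, 'k) ncs)) w = (\<Sum>q<length u. if rotate q u = c # w then 1 else 0)"
    unfolding ins_def lin_monom insw_def cf_sum
  proof (intro sum.cong refl)
    fix q assume "q \<in> {..<length u}"
    then have "rotate q u = u ! q # rot u q" by (simp add: rot_rotate)
    moreover have "monom (drop (Suc q) u) * 1 * monom (take q u) = (monom (rot u q) :: ('a, 'k) ncs)"
      by (simp add: rot_def monom_append)
    ultimately show "cf (if u ! q = c then monom (drop (Suc q) u) * 1 * monom (take q u) else 0 :: ('a, 'k) ncs) w
       = (if rotate q u = c # w then 1 else 0)"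
      by (auto simp: cf_monom)
  qed
  also have "\<dots> = tau (c # w) (monom u :: ('a, 'k) ncs)"
  proof (cases "length u = length (c # w)")
    case True
    then show ?thesis unfolding tau_def cf_monom using sum_rotate_inverse by blast
  next
    case False
    then have "rotate q u \<noteq> c # w" "rotate r (c # w) \<noteq> u" for q r
      by (metis length_rotate)+
    then show ?thesis by (simp add: tau_def cf_monom)
  qed
  finally show ?case .
qed auto

lemma cd_cyc0: "fin a \<Longrightarrow> cyc0 a \<Longrightarrow> cd c a = 0"
  by (rule ncs_eqI) (simp add: cf_cd cyc0_def)

section \<open>Derivations of the free algebra\<close>

definition der :: "('a \<Rightarrow> ('a, 'k::comm_ring_1) ncs) \<Rightarrow> ('a, 'k) ncs \<Rightarrow> ('a, 'k) ncs" where
  "der D b = lin (\<lambda>v. \<Sum>q<length v. monom (take q v) * D (v ! q) * monom (drop (Suc q) v)) b"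

lemma der_linear [simp]:
  "fin a \<Longrightarrow> fin b \<Longrightarrow> der D (a + b) = der D a + der D b"
  "fin a \<Longrightarrow> fin b \<Longrightarrow> der D (a - b) = der D a - der D b"
  "fin a \<Longrightarrow> der D (scl k a) = scl k (der D a)"
  "der D 0 = 0" "der D 1 = 0" "der D (vr c) = D c"
  "(\<And>i. i \<in> I \<Longrightarrow> fin (f i)) \<Longrightarrow> der D (sum f I) = (\<Sum>i\<in>I. der D (f i))"
  by (simp_all add: der_def)

lemma der_mult:
  assumes "fin a" "fin b" shows "der D (a * b) = der D a * b + a * der D b"
  using assms(1)
proof (induction rule: fin_induct)
  case (monom u)
  show ?case using assms(2)
  proof (induction rule: fin_induct)
    case (monom v)
    have "(\<Sum>q<length (u @ v). monom (take q (u @ v)) * D ((u @ v) ! q) * monom (drop (Suc q) (u @ v)))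
        = (\<Sum>q<length u. monom (take q u) * D (u ! q) * monom (drop (Suc q) u @ v))
        + (\<Sum>q<length v. monom (u @ take q v) * D (v ! q) * monom (drop (Suc q) v))"
      unfolding length_append sum_append_split
      by (intro arg_cong2[of _ _ _ _ "(+)"] sum.cong refl) (auto simp: nth_append)
    then show ?case
      by (simp add: der_def monom_append sum_distrib_left sum_distrib_right mult.assoc flip: monom_append)
        (simp add: monom_append mult.assoc)
  qed (auto simp: distrib_left distrib_right scl_distrib)
qed (use assms in \<open>auto simp: distrib_left distrib_right scl_distrib\<close>)

lemma der_power:
  assumes "fin a" shows "der D (a ^ M) = (\<Sum>i<M. a ^ i * der D a * a ^ (M - Suc i))"
proof (induction M)
  case (Suc M)
  have "der D (a ^ Suc M) = der D (a ^ M) * a + a ^ M * der D a"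
    using assms by (simp add: der_mult power_Suc2 del: power_Suc)
  also have "der D (a ^ M) * a = (\<Sum>i<M. a ^ i * der D a * a ^ (Suc M - Suc i))"
    by (simp add: Suc sum_distrib_right mult.assoc power_Suc2[symmetric] Suc_diff_Suc del: power_Suc)
  finally show ?case by simp
qed simp

text \<open>The bracket with \<open>|a|\<close> is induced by the derivation with these values on the letters.\<close>

fun Dn :: "(gen, 'k::comm_ring_1) ncs \<Rightarrow> gen \<Rightarrow> (gen, 'k) ncs" where
  "Dn a (X i) = - cd (Y i) a"
| "Dn a (Y i) = cd (X i) a"
| "Dn a (Z j) = cm (vr (Z j)) (cd (Z j) a)"

definition om :: "nat \<Rightarrow> nat \<Rightarrow> (gen, 'k::comm_ring_1) ncs" where
  "om g n = (\<Sum>i\<in>{1..g}. cm (vr (X i)) (vr (Y i))) + (\<Sum>j\<in>{1..n}. vr (Z j))"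

lemma finite_letters [simp]: "finite (letters g n)"
proof -
  have "letters g n = X ` {1..g} \<union> Y ` {1..g} \<union> Z ` {1..n}" by (auto simp: letters_def)
  then show ?thesis by simp
qed

lemma letters_iff [simp]: "X i \<in> letters g n \<longleftrightarrow> 1 \<le> i \<and> i \<le> g" "Y i \<in> letters g n \<longleftrightarrow> 1 \<le> i \<and> i \<le> g"
  "Z j \<in> letters g n \<longleftrightarrow> 1 \<le> j \<and> j \<le> n"
  by (auto simp: letters_def)

lemma fin_om [simp]: "fin (om g n)"
  by (simp add: om_def)

lemma ins_om:
  "1 \<le> i \<Longrightarrow> i \<le> g \<Longrightarrow> ins (X i) p (om g n) = cm (vr (Y i)) p"
  "1 \<le> i \<Longrightarrow> i \<le> g \<Longrightarrow> ins (Y i) p (om g n) = - cm (vr (X i)) p"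
  "1 \<le> j \<Longrightarrow> j \<le> n \<Longrightarrow> ins (Z j) p (om g n) = p"
proof -
  have om: "ins c p (om g n) = (\<Sum>i\<in>{1..g}. ins c p (cm (vr (X i)) (vr (Y i)))) + (\<Sum>j\<in>{1..n}. ins c p (vr (Z j)))" for c
    unfolding om_def by (subst ins_linear(1)) (auto simp del: ins_linear(2) simp: ins_linear(5))
  have c1: "ins (X i) p (cm (vr (X i')) (vr (Y i'))) = (if i' = i then cm (vr (Y i)) p else 0)"
    and c2: "ins (Y i) p (cm (vr (X i')) (vr (Y i'))) = (if i' = i then - cm (vr (X i)) p else 0)"
    and c3: "ins (Z j) p (cm (vr (X i')) (vr (Y i'))) = 0" for i'
    by (simp_all add: ins_mult ins_vr)
  show "ins (X i) p (om g n) = cm (vr (Y i)) p" if "1 \<le> i" "i \<le> g"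
    unfolding om c1 ins_vr using that by simp
  show "ins (Y i) p (om g n) = - cm (vr (X i)) p" if "1 \<le> i" "i \<le> g"
    unfolding om c2 ins_vr using that by simp
  show "ins (Z j) p (om g n) = p" if "1 \<le> j" "j \<le> n"
    unfolding om c3 ins_vr using that by simp
qed

lemma sum_letters: "(\<Sum>c\<in>letters g n. f c) = (\<Sum>i\<in>{1..g}. f (X i) + f (Y i)) + (\<Sum>j\<in>{1..n}. f (Z j) :: 'b::comm_monoid_add)"
proof -
  have "letters g n = (X ` {1..g} \<union> Y ` {1..g}) \<union> Z ` {1..n}" by (auto simp: letters_def)
  moreover have "sum f ((X ` {1..g} \<union> Y ` {1..g}) \<union> Z ` {1..n}) = sum f (X ` {1..g} \<union> Y ` {1..g}) + sum f (Z ` {1..n})"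
    by (rule sum.union_disjoint) auto
  moreover have "sum f (X ` {1..g} \<union> Y ` {1..g}) = sum f (X ` {1..g}) + sum f (Y ` {1..g})"
    by (rule sum.union_disjoint) auto
  ultimately show ?thesis by (simp add: sum.reindex inj_on_def sum.distrib)
qed

text \<open>Each position \<open>q\<close> of a word contributes the difference of its rotations by
  \<open>q\<close> and \<open>q + 1\<close>, and the sum telescopes around the circle.\<close>

lemma sum_cm_cd:
  fixes a :: "(gen, 'k::comm_ring_1) ncs"
  assumes "pol T a" "finite T" shows "(\<Sum>c\<in>T. cm (vr c) (cd c a)) = 0"
proof -
  have w: "(\<Sum>c\<in>T. cm (vr c) (insw c 1 w :: (gen, 'k) ncs)) = 0" if "set w \<subseteq> T" for w
  proof -
    have "(\<Sum>c\<in>T. cm (vr c) (insw c 1 w :: (gen, 'k) ncs))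
      = (\<Sum>q<length w. \<Sum>c\<in>T. if w ! q = c then cm (vr c) (monom (rot w q)) else 0)"
      unfolding insw_def sum_distrib_left sum_distrib_right sum_subtractf[symmetric]
      by (subst sum.swap) (auto simp: rot_def monom_append intro!: sum.cong)
    also have "\<dots> = (\<Sum>q<length w. cm (vr (w ! q)) (monom (rot w q)))"
      using that assms(2) nth_mem[of _ w] by (intro sum.cong refl) (auto simp: subset_iff)
    also have "\<dots> = (\<Sum>q<length w. monom (rotate q w) - monom (rotate (Suc q) w))"
    proof (intro sum.cong refl)
      fix q assume q: "q \<in> {..<length w}"
      then have r: "rotate q w = w ! q # rot w q" by (simp add: rot_rotate)
      then have "rotate (Suc q) w = rot w q @ [w ! q]" by simp
      then show "cm (vr (w ! q)) (monom (rot w q) :: (gen, 'k) ncs) = monom (rotate q w) - monom (rotate (Suc q) w)"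
        unfolding r by (simp add: monom_append monom_Cons)
    qed
    also have "\<dots> = 0"
      using sum_rotate_shift[of "monom :: _ \<Rightarrow> (gen, 'k) ncs" 1 w] by (simp add: sum_subtractf)
    finally show ?thesis .
  qed
  have "(\<Sum>c\<in>T. cm (vr c) (cd c a)) = (\<Sum>u | cf a u \<noteq> 0. scl (cf a u) (\<Sum>c\<in>T. cm (vr c) (insw c 1 u)))"
    unfolding ins_def lin_def sum_distrib_left sum_distrib_right sum_subtractf[symmetric] scl_sum
    by (subst sum.swap) (simp add: scl_distrib)
  also have "\<dots> = 0"
    using assms(1) w by (simp add: pol_def)
  finally show ?thesis .
qed

text \<open>The values of \<open>Dn\<close> turn the derivative of \<open>\<omega>\<close> into the
  sum of all \<open>[c, cd c a]\<close>: \<open>\<omega>\<close> plays the role of a moment map,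
  annihilated by every bracket derivation.\<close>

lemma der_Dn_om:
  assumes "pol (letters g n) a" shows "der (Dn a) (om g n) = 0"
proof -
  have "der (Dn a) (om g n) = (\<Sum>c\<in>letters g n. cm (vr c) (cd c a))"
    unfolding om_def sum_letters by (simp add: der_mult algebra_simps)
  then show ?thesis using sum_cm_cd[OF assms] by simp
qed

context block
begin

text \<open>The words around the inserted power are pieces of words of \<open>e\<close>, so
  \<open>C\<close> depends on \<open>e\<close> alone and \<open>k\<close> may be chosen
  afterwards.\<close>

lemma Rsp_ins:
  assumes "pol S e" shows "\<exists>C. \<forall>k. Rsp C k (ins c (\<theta> ^ k) e)"
proof -
  define C where "C = (\<Sum>w | cf e w \<noteq> 0. wtw w)"
  have "Rsp C k (ins c (\<theta> ^ k) e)" for k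
    unfolding ins_def lin_def insw_def
  proof (intro Rsp_sum Rsp_scl)
    fix w q assume w: "w \<in> {w. cf e w \<noteq> 0}"
    then have "set w \<subseteq> S" using assms by (auto simp: pol_def)
    moreover have "wtw w \<le> C"
      unfolding C_def using w assms by (intro member_le_sum) (auto simp: pol_def fin_def)
    moreover have "wtw (take q w) \<le> wtw w" "wtw (drop (Suc q) w) \<le> wtw w"
      by (metis append_take_drop_id le_add1 wtw_append, metis append_take_drop_id le_add2 wtw_append)
    ultimately show "Rsp C k (if w ! q = c then monom (drop (Suc q) w) * \<theta> ^ k * monom (take q w) else 0)"
      by (auto intro!: Rsp_monom Rsp_0 dest: in_set_dropD in_set_takeD)
  qed
  then show ?thesis by blast
qed

lemma Sk_rev: "Sk k e = (\<Sum>i<k. \<theta> ^ (k - 1 - i) * e * \<theta> ^ i)"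
  unfolding Sk_def by (rule sum.reindex_bij_witness[of _ "\<lambda>i. k - 1 - i" "\<lambda>i. k - 1 - i"]) auto

text \<open>The cut falls either into one of the factors \<open>\<theta>\<close> or into
  \<open>e\<close>; in the second case the power stays unbroken and gives an error term.\<close>

lemma cd_power_mult:
  assumes "fin e" shows "cd c (\<theta> ^ k * e) = ins c (Sk k e) \<theta> + ins c (\<theta> ^ k) e"
  using assms by (simp add: ins_mult ins_power Sk_rev)

text \<open>The bracket with \<open>\<theta>\<^sup>k u\<close> acts on \<open>\<theta>\<close> as an inner derivation \<open>ad p\<close>; subtracting it leaves
  \<open>[d\<^sup>M, Sk k u]\<close> up to terms with a long run of \<open>\<theta>\<close>.\<close>

lemma central_relation:
  assumes d: "d \<in> S" and D: "der D \<theta> = cm \<theta> p"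
    and cyc: "\<And>b. pol S b \<Longrightarrow> cyc0 (der D b)"
    and R: "Rsp C k R" "D d - cm (vr d) p = scl x (cm (vr d) (Sk k u)) + R" and x: "x * x = 1"
  shows "\<exists>R'. Rsp (C + M * wt d) k R' \<and> (\<forall>l. cyc0 (\<theta> ^ l * (cm (vr d ^ M) (Sk k u) + R')))"
proof -
  define R' where "R' = scl x (\<Sum>i<M. vr d ^ i * R * vr d ^ (M - Suc i))"
  have "Rsp (C + M * wt d) k R'"
    unfolding R'_def by (intro Rsp_scl Rsp_sum Rsp_vr_power R d) auto
  moreover have "cyc0 (\<theta> ^ l * (cm (vr d ^ M) (Sk k u) + R'))" for l
  proof -
    have "der D (vr d ^ M) - cm (vr d ^ M) p = (\<Sum>i<M. vr d ^ i * (D d - cm (vr d) p) * vr d ^ (M - Suc i))"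
      by (subst cm_power) (simp add: der_power sum_subtractf[symmetric] left_diff_distrib right_diff_distrib)
    also have "\<dots> = scl x (\<Sum>i<M. vr d ^ i * cm (vr d) (Sk k u) * vr d ^ (M - Suc i))
        + (\<Sum>i<M. vr d ^ i * R * vr d ^ (M - Suc i))"
      unfolding R(2) by (simp only: distrib_left distrib_right sum.distrib scl_sum scl_simps)
    also have "\<dots> = scl x (cm (vr d ^ M) (Sk k u) + R')"
      by (simp add: R'_def cm_power scl_distrib x)
    finally have e: "der D (vr d ^ M) - cm (vr d ^ M) p = scl x (cm (vr d ^ M) (Sk k u) + R')" .
    have pl: "der D (\<theta> ^ l) = cm (\<theta> ^ l) p"
      by (simp add: der_power D cm_power[of \<theta>])
    have "der D (\<theta> ^ l * vr d ^ M) = cm (\<theta> ^ l) p * vr d ^ M + \<theta> ^ l * der D (vr d ^ M)"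
      by (simp add: der_mult pl)
    moreover have "cyc0 (der D (\<theta> ^ l * vr d ^ M))"
      using d hm_pol[OF S \<theta>_hm] by (intro cyc) simp
    ultimately have "tau w (cm (\<theta> ^ l) p * vr d ^ M + \<theta> ^ l * der D (vr d ^ M)) = 0" for w
      by (simp add: cyc0_def)
    \<comment> \<open>Invariance of the trace moves the inner derivation from the power of
      \<open>\<theta>\<close> to the marker, with a sign.\<close>
    moreover have "tau w (cm (\<theta> ^ l) p * vr d ^ M) = tau w (\<theta> ^ l * - cm (vr d ^ M) p)" for w
      using tau_mult_commute[of w p "\<theta> ^ l * vr d ^ M"] by (simp add: algebra_simps)
    ultimately have "tau w (\<theta> ^ l * (der D (vr d ^ M) - cm (vr d ^ M) p)) = 0" for w
      by (simp add: algebra_simps)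
    then have "x * (x * tau w (\<theta> ^ l * (cm (vr d ^ M) (Sk k u) + R'))) = 0" for w
      unfolding e by simp
    then show ?thesis by (simp add: cyc0_def x flip: mult.assoc)
  qed
  ultimately show ?thesis by blast
qed

end

section \<open>Central elements\<close>

context block
begin

lemma Rsp_cm_vr:
  assumes "Rsp C k R" "d \<in> S" shows "Rsp (C + wt d) k (cm (vr d) R)"
  using Rsp_vr_power[OF assms, of 1 1 0] Rsp_vr_power[OF assms, of 0 1 1]
  by (auto intro: Rsp_diff)

text \<open>\<open>D k\<close> is the derivation given by the bracket with
  \<open>\<theta>^k u\<close>, \<open>p\<close> its inner part on \<open>\<theta>\<close>, and
  \<open>x\<close> a sign. For \<open>\<omega>\<close> they are \<open>p = 0\<close> and
  \<open>x = 1\<close>; for \<open>z_j\<close> they are \<open>p = cd (Z j) (\<theta>^k u)\<close>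
  and \<open>x = -1\<close>.\<close>

lemma central_imp_bracket:
  assumes u: "hm S m u" "prim u" "2 < m" and d: "d \<noteq> hd th" "d \<in> S"
    and rel: "\<And>E. pol S E \<Longrightarrow> (\<And>l. cyc0 (\<theta> ^ l * E)) \<Longrightarrow> \<exists>C. \<forall>l. \<exists>r. Rsp C l r \<and> cm (vr d) (Sk l E) + r = 0"
    and cyc: "\<And>k b. pol S b \<Longrightarrow> cyc0 (der (D k) b)"
    and D: "\<exists>C. \<forall>k. \<exists>p R. der (D k) \<theta> = cm \<theta> p \<and> Rsp C k R \<and>
              D k d - cm (vr d) p = scl x (cm (vr d) (Sk k u)) + R" and x: "x * x = 1"
  shows "\<exists>h. hm S (m - 2) h \<and> prim h \<and> u = cm \<theta> h"
proof -
  obtain a where a: "hm S m a" "nf a = u" using nf_surj[OF u(1)] .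
  obtain C where C: "\<And>k. \<exists>p R. der (D k) \<theta> = cm \<theta> p \<and> Rsp C k R \<and>
              D k d - cm (vr d) p = scl x (cm (vr d) (Sk k u)) + R" using D by blast
  have central: "\<exists>C. \<forall>k. \<exists>R. Rsp C k R \<and> (\<forall>l. cyc0 (\<theta> ^ l * (cm (vr d ^ M) (Sk k (nf a)) + R)))" for M
  proof (intro exI[of _ "C + M * wt d"] allI)
    fix k
    obtain p R where "der (D k) \<theta> = cm \<theta> p" "Rsp C k R"
        "D k d - cm (vr d) p = scl x (cm (vr d) (Sk k u)) + R" using C by blast
    then show "\<exists>R. Rsp (C + M * wt d) k R \<and> (\<forall>l. cyc0 (\<theta> ^ l * (cm (vr d ^ M) (Sk k (nf a)) + R)))"
      unfolding a(2) using central_relation[OF d(2) _ cyc _ _ x] by blast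
  qed
  have "Tsum a v N = 0" if "core v" for v N
    by (rule Tsum_zero[where cyc = cyc0, OF d _ _ rel central that])
      (use a u hm_fin[OF S] hm_pol[OF S] in auto)
  then show ?thesis by (rule lie_bracket_of_Tsum[OF u a])
qed

text \<open>If \<open>c\<close> occurs in \<open>\<theta>\<close> only as a summand with coefficient
  1, the cyclic derivative by \<open>c\<close> returns \<open>Sk l E\<close> itself up to an error;
  the commutator with \<open>d\<close> is taken afterwards.\<close>

lemma relation_of_ins_id:
  assumes d: "d \<in> S" and ins: "\<And>p. ins c p \<theta> = p"
    and E: "pol S E" "\<And>l. cyc0 (\<theta> ^ l * E)"
  shows "\<exists>C. \<forall>l. \<exists>r. Rsp C l r \<and> cm (vr d) (Sk l E) + r = 0"
proof -
  obtain C where C: "\<And>l. Rsp C l (ins c (\<theta> ^ l) E)" using Rsp_ins[OF E(1)] by blast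
  have "cm (vr d) (Sk l E) + cm (vr d) (ins c (\<theta> ^ l) E) = 0" for l
  proof -
    have "Sk l E + ins c (\<theta> ^ l) E = cd c (\<theta> ^ l * E)"
      using E by (simp add: cd_power_mult ins)
    also have "\<dots> = 0" using E by (intro cd_cyc0) auto
    finally have "cm (vr d) (Sk l E + ins c (\<theta> ^ l) E) = 0" by simp
    then show ?thesis by (simp add: algebra_simps)
  qed
  then show ?thesis using Rsp_cm_vr[OF C d] by blast
qed

text \<open>Every core begins with a letter other than \<open>z\<close>, so its words are not in the
  support of \<open>a\<close>. This replaces the marker argument when there is no second
  letter.\<close>

lemma Tsum_single_letter:
  assumes "th = [z]" "S \<subseteq> {z}" "hm S m a" "core v" shows "Tsum a v N = 0"
proof -
  obtain c v' where v: "v = c # v'" using assms(4) by (auto simp: core_def neq_Nil_conv)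
  then have "c \<noteq> z" using assms(1,4) unfolding core_def by force
  then have "cf a (pw p @ v @ pw q) = 0" for p q
    using assms(2,3) v unfolding hm_def by fastforce
  then show ?thesis by (simp add: Tsum_def)
qed

lemma single_letter_bracket:
  assumes "hm S m u" "prim u" "2 < m" "th = [z]" "S \<subseteq> {z}"
  shows "\<exists>h. hm S (m - 2) h \<and> prim h \<and> u = cm \<theta> h"
proof -
  obtain a where a: "hm S m a" "nf a = u" using nf_surj[OF assms(1)] .
  show ?thesis
    by (rule lie_bracket_of_Tsum[OF assms(1-3) a]) (rule Tsum_single_letter[OF assms(4,5) a(1)])
qed

end

section \<open>Blocks for the boundary elements, and the bracket equation for each of them\<close>

lemma hm_om: "hm (letters g n) 2 (om g n)"
proof -
  have "hm (letters g n) (1 + 1) (cm (vr (X i)) (vr (Y i)))" if "i \<in> {1..g}" for i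
    using that by (intro hm_cm hm_vr) auto
  then show ?thesis
    unfolding om_def by (intro hm_add hm_sum hm_vr) (auto simp: numeral_2_eq_2)
qed

lemma prim_om: "prim (om g n)"
  unfolding om_def by (intro prim_add prim_sum prim_cm prim_letter)

lemma cf_cm_vr: "cf (cm (vr a) (vr b)) w = (if w = [a, b] then 1 else 0) - (if w = [b, a] then 1 else 0)"
  using monom_append[of "[a]" "[b]"] monom_append[of "[b]" "[a]"]
  by (simp add: vr_def cf_monom flip: monom_append)

lemma cf_om: "cf (om g n) w = (\<Sum>i\<in>{1..g}. (if w = [X i, Y i] then 1 else 0) - (if w = [Y i, X i] then 1 else 0))
    + (\<Sum>j\<in>{1..n}. if w = [Z j] then 1 else 0)"
  unfolding om_def cf_add cf_sum cf_cm_vr cf_vr ..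

lemma cf_om_nonzero:
  assumes "cf (om g n :: (gen, 'k::comm_ring_1) ncs) w \<noteq> 0"
  shows "(\<exists>i. w = [X i, Y i]) \<or> (\<exists>i. w = [Y i, X i]) \<or> (\<exists>j. w = [Z j] \<and> 1 \<le> j)"
proof (rule ccontr)
  assume "\<not> ?thesis"
  then have "cf (om g n :: (gen, 'k) ncs) w = (\<Sum>i\<in>{1..g}. 0) + (\<Sum>j\<in>{1..n}. 0)"
    unfolding cf_om by (intro arg_cong2[of _ _ _ _ "(+)"] sum.cong refl) auto
  then show False using assms by simp
qed

lemma block_Z:
  assumes "1 \<le> j" "j \<le> n" shows "block (letters g n) [Z j] (vr (Z j) :: (gen, 'k::field_char_0) ncs)"
  using assms by unfold_locales (auto intro!: hm_vr, simp_all add: vr_def)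

text \<open>Measured by \<open>mu (X 1)\<close>, the word \<open>x_1 y_1\<close> has value 2,
  \<open>y_1 x_1\<close> value 1 and all other words of \<open>\<omega>\<close> value 0.\<close>

lemma block_om_pos:
  assumes "1 \<le> g" shows "block (letters g n) [X 1, Y 1] (om g n :: (gen, 'k::field_char_0) ncs)"
proof
  fix t assume t: "cf (om g n - monom [X 1, Y 1] :: (gen, 'k) ncs) t \<noteq> 0"
  have "cf (om g n :: (gen, 'k) ncs) [X 1, Y 1] = 1"
    using assms by (simp add: cf_om)
  then have "t \<noteq> [X 1, Y 1]" "cf (om g n :: (gen, 'k) ncs) t \<noteq> 0"
    using t by (auto simp: cf_monom split: if_splits)
  then show "mu (hd [X 1, Y 1]) t < 2 \<and> count_list t (hd [X 1, Y 1]) \<le> 1"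
    using cf_om_nonzero[of g n t, where 'k = 'k] by (auto split: if_splits)
qed (use assms hm_om prim_om in auto)

lemma block_om_0:
  assumes "1 \<le> n" shows "block (letters 0 n) [Z 1] (om 0 n :: (gen, 'k::field_char_0) ncs)"
proof
  fix t assume t: "cf (om 0 n - monom [Z 1] :: (gen, 'k) ncs) t \<noteq> 0"
  have "cf (om 0 n :: (gen, 'k) ncs) [Z 1] = 1"
    using assms by (simp add: cf_om)
  then have "t \<noteq> [Z 1]" "cf (om 0 n :: (gen, 'k) ncs) t \<noteq> 0"
    using t by (auto simp: cf_monom split: if_splits)
  then show "mu (hd [Z 1]) t < 2 \<and> count_list t (hd [Z 1]) \<le> 1"
    using cf_om_nonzero[of 0 n t, where 'k = 'k] by (auto split: if_splits)
qed (use assms hm_om prim_om in auto)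

text \<open>The bracket derivation annihilates \<open>\<omega>\<close>, so no inner part has to be
  subtracted. The marker is \<open>y_1\<close> in positive genus and \<open>z_2\<close> in genus 0
  with at least two punctures; with one letter all words are powers of it, and with no letters
  \<open>u\<close> is 0.\<close>

theorem central_om_bracket:
  fixes u :: "(gen, 'k::field_char_0) ncs"
  assumes u: "hm (letters g n) m u" "prim u" "2 < m"
    and cyc: "\<And>k b. pol (letters g n) b \<Longrightarrow> cyc0 (der (Dn (om g n ^ k * u)) b)"
  shows "\<exists>h. hm (letters g n) (m - 2) h \<and> prim h \<and> u = cm (om g n) h"
proof -
  let ?L = "letters g n"
  have pu: "pol ?L u" using hm_pol[OF _ u(1)] by simp
  have D\<theta>: "der (Dn (om g n ^ k * u)) (om g n) = cm (om g n) 0" for k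
  proof -
    have "pol ?L (om g n :: (gen, 'k) ncs)" using hm_pol[OF _ hm_om] by simp
    then show ?thesis using pu der_Dn_om[of g n "om g n ^ k * u"] by simp
  qed
  consider "1 \<le> g" | "g = 0" "2 \<le> n" | "g = 0" "n = 1" | "g = 0" "n = 0" by linarith
  then show ?thesis
  proof cases
    case 1
    interpret block ?L "[X 1, Y 1]" "om g n :: (gen, 'k) ncs" using block_om_pos[OF 1] .
    obtain C where C: "\<And>k. Rsp C k (ins (X 1) (om g n ^ k) u)" using Rsp_ins[OF pu] by blast
    \<comment> \<open>The cyclic derivative of \<open>\<omega>\<close> by \<open>x_1\<close> is
      \<open>[y_1, -]\<close>, so the commutator with the marker appears by itself.\<close>
    have cd: "cd (X 1) (om g n ^ k * e) = cm (vr (Y 1)) (Sk k e) + ins (X 1) (om g n ^ k) e" if "fin e" for k e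
      using that 1 by (simp add: cd_power_mult ins_om)
    show ?thesis
    proof (rule central_imp_bracket[OF u, of "Y 1" "\<lambda>k. Dn (om g n ^ k * u)" 1])
      show "\<exists>C. \<forall>l. \<exists>r. Rsp C l r \<and> cm (vr (Y 1)) (Sk l E) + r = 0"
        if E: "pol ?L E" "\<And>l. cyc0 (om g n ^ l * E)" for E
      proof -
        have "cm (vr (Y 1)) (Sk l E) + ins (X 1) (om g n ^ l) E = 0" for l
          using cd_cyc0[OF _ E(2)[of l], of "X 1"] E(1) cd[of E l] by simp
        then show ?thesis using Rsp_ins[OF E(1), of "X 1"] by blast
      qed
      have "Dn (om g n ^ k * u) (Y 1) - cm (vr (Y 1)) 0 = scl 1 (cm (vr (Y 1)) (Sk k u)) + ins (X 1) (om g n ^ k) u" for k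
        using cd[of u k] pu by simp
      then show "\<exists>C. \<forall>k. \<exists>p R. der (Dn (om g n ^ k * u)) (om g n) = cm (om g n) p \<and> Rsp C k R \<and>
         Dn (om g n ^ k * u) (Y 1) - cm (vr (Y 1)) p = scl 1 (cm (vr (Y 1)) (Sk k u)) + R"
        using C D\<theta> by blast
    qed (use 1 cyc in auto)
  next
    case 2
    interpret block ?L "[Z 1]" "om g n :: (gen, 'k) ncs" using block_om_0[of n] 2 by simp
    obtain C where C: "\<And>k. Rsp C k (ins (Z 2) (om g n ^ k) u)" using Rsp_ins[OF pu] by blast
    have d: "Z 2 \<in> ?L" using 2 by simp
    show ?thesis
    proof (rule central_imp_bracket[OF u, of "Z 2" "\<lambda>k. Dn (om g n ^ k * u)" 1])
      show "\<exists>C. \<forall>l. \<exists>r. Rsp C l r \<and> cm (vr (Z 2)) (Sk l E) + r = 0"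
        if E: "pol ?L E" "\<And>l. cyc0 (om g n ^ l * E)" for E
        by (rule relation_of_ins_id[OF d _ E, of "Z 1"]) (rule ins_om(3), use 2 in auto)
      have "Dn (om g n ^ k * u) (Z 2) - cm (vr (Z 2)) 0
          = scl 1 (cm (vr (Z 2)) (Sk k u)) + cm (vr (Z 2)) (ins (Z 2) (om g n ^ k) u)" for k
      proof -
        have "cd (Z 2) (om g n ^ k * u) = Sk k u + ins (Z 2) (om g n ^ k) u"
          using cd_power_mult[of u "Z 2" k] ins_om(3)[of 2 n] 2(2) pu by simp
        then show ?thesis by (simp add: algebra_simps)
      qed
      then show "\<exists>C. \<forall>k. \<exists>p R. der (Dn (om g n ^ k * u)) (om g n) = cm (om g n) p \<and> Rsp C k R \<and>
         Dn (om g n ^ k * u) (Z 2) - cm (vr (Z 2)) p = scl 1 (cm (vr (Z 2)) (Sk k u)) + R"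
        using Rsp_cm_vr[OF C d] D\<theta> by blast
    qed (use d cyc in auto)
  next
    case 3
    interpret block ?L "[Z 1]" "om g n :: (gen, 'k) ncs" using block_om_0[of n] 3 by simp
    show ?thesis by (rule single_letter_bracket[OF u, of "Z 1"]) (use 3 in \<open>auto simp: letters_def\<close>)
  next
    case 4
    have "u = 0"
    proof (rule ncs_eqI, rule ccontr)
      fix w assume "cf u w \<noteq> cf 0 w"
      then have "set w \<subseteq> {}" "wtw w = m" using u(1) 4 by (auto simp: hm_def letters_def)
      then show False using u(3) by simp
    qed
    then show ?thesis by (intro exI[of _ 0]) simp
  qed
qed

text \<open>Here the derivation sends another letter \<open>d\<close> to error terms only, but acts
  on \<open>z_j\<close> as \<open>[z_j, p]\<close> with \<open>p\<close> containing
  \<open>Sk k u\<close>. Subtracting \<open>[d, p]\<close> produces the commutator with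
  \<open>Sk k u\<close>, with sign -1.\<close>

theorem central_Z_bracket:
  fixes u :: "(gen, 'k::field_char_0) ncs"
  assumes j: "1 \<le> j" "j \<le> n" and u: "hm (letters g n) m u" "prim u" "2 < m"
    and cyc: "\<And>k b. pol (letters g n) b \<Longrightarrow> cyc0 (der (Dn (vr (Z j) ^ k * u)) b)"
  shows "\<exists>h. hm (letters g n) (m - 2) h \<and> prim h \<and> u = cm (vr (Z j)) h"
proof -
  let ?L = "letters g n" and ?z = "vr (Z j) :: (gen, 'k) ncs"
  have pu: "pol ?L u" using hm_pol[OF _ u(1)] by simp
  interpret block ?L "[Z j]" ?z using block_Z[OF j] .
  show ?thesis
  proof (cases "?L \<subseteq> {Z j}")
    case True
    then show ?thesis by (intro single_letter_bracket[OF u]) auto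
  next
    case False
    then obtain d where d: "d \<in> ?L" "d \<noteq> Z j" by blast
    define D where "D k = Dn (?z ^ k * u)" for k
    obtain C0 where C0: "\<And>k. Rsp C0 k (ins (Z j) (?z ^ k) u)" using Rsp_ins[OF pu] by blast
    have cd: "cd c (?z ^ k * u) = ins c (?z ^ k) u" if "c \<noteq> Z j" for c k
      using pu that by (simp add: cd_power_mult ins_vr)
    have cdz: "cd (Z j) (?z ^ k * u) = Sk k u + ins (Z j) (?z ^ k) u" for k
      using pu by (simp add: cd_power_mult ins_vr)
    have "\<exists>C. \<forall>k. Rsp C k (D k d)"
    proof (cases d)
      case (X i)
      then show ?thesis using Rsp_ins[OF pu, of "Y i"] by (auto simp: D_def cd intro: Rsp_uminus)
    next
      case (Y i)
      then show ?thesis using Rsp_ins[OF pu, of "X i"] by (auto simp: D_def cd)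
    next
      case (Z i)
      then have "D k d = cm (vr d) (ins d (?z ^ k) u)" for k
        using cd d by (simp add: D_def)
      then show ?thesis using Rsp_ins[OF pu, of d] Rsp_cm_vr[OF _ d(1)] by metis
    qed
    then obtain C1 where C1: "\<And>k. Rsp C1 k (D k d)" by blast
    show ?thesis
    proof (rule central_imp_bracket[OF u, of d D "-1"])
      show "\<exists>C. \<forall>l. \<exists>r. Rsp C l r \<and> cm (vr d) (Sk l E) + r = 0"
        if E: "pol ?L E" "\<And>l. cyc0 (?z ^ l * E)" for E
        by (rule relation_of_ins_id[OF d(1) _ E, of "Z j"]) (auto simp: ins_vr)
      define R where "R k = D k d - cm (vr d) (ins (Z j) (?z ^ k) u)" for k
      have "D k d - cm (vr d) (cd (Z j) (?z ^ k * u)) = scl (-1) (cm (vr d) (Sk k u)) + R k" for k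
        by (simp add: cdz R_def algebra_simps)
      moreover have "der (D k) ?z = cm ?z (cd (Z j) (?z ^ k * u))" for k
        by (simp add: D_def)
      moreover have "Rsp (C0 + C1 + wt d) k (R k)" for k
        unfolding R_def
        by (intro Rsp_diff Rsp_le[OF C1] Rsp_le[OF Rsp_cm_vr[OF C0 d(1)]]) auto
      ultimately show "\<exists>C. \<forall>k. \<exists>p R. der (D k) ?z = cm ?z p \<and> Rsp C k R \<and>
          D k d - cm (vr d) p = scl (-1) (cm (vr d) (Sk k u)) + R"
        by blast
    qed (use d cyc in \<open>auto simp: D_def\<close>)
  qed
qed

section \<open>The necklace bracket on series\<close>

definition flt :: "nat \<Rightarrow> (gen, 'k::comm_ring_1) ncs \<Rightarrow> bool" where
  "flt m a \<longleftrightarrow> (\<forall>w. wtw w < m \<longrightarrow> cf a w = 0)"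

lemma flt_0 [simp]: "flt m 0" "flt 0 a"
  by (simp_all add: flt_def)

lemma flt_add: "flt m a \<Longrightarrow> flt m b \<Longrightarrow> flt m (a + b)"
  and flt_diff: "flt m a \<Longrightarrow> flt m b \<Longrightarrow> flt m (a - b)"
  and flt_uminus: "flt m a \<Longrightarrow> flt m (- a)"
  and flt_scl: "flt m a \<Longrightarrow> flt m (scl k a)"
  and flt_le: "flt m a \<Longrightarrow> m' \<le> m \<Longrightarrow> flt m' a"
  by (simp_all add: flt_def)

lemma flt_sum: "(\<And>i. i \<in> I \<Longrightarrow> flt m (f i)) \<Longrightarrow> flt m (sum f I)"
  by (simp add: flt_def)

lemma flt_mult:
  assumes "flt m a" "flt n b" shows "flt (m + n) (a * b)"
  unfolding flt_def
proof (intro allI impI, rule ccontr)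
  fix w assume w: "wtw w < m + n" "cf (a * b) w \<noteq> 0"
  then obtain u v where "w = u @ v" "cf a u \<noteq> 0" "cf b v \<noteq> 0" by (elim cf_mult_nonzeroE)
  then show False using assms w(1) by (auto simp: flt_def not_less[symmetric])
      (meson add_mono_thms_linordered_semiring(1) not_less)
qed

lemma flt_mult_le: "flt m a \<Longrightarrow> flt n b \<Longrightarrow> k \<le> m + n \<Longrightarrow> flt k (a * b)"
  using flt_mult flt_le by blast

lemma hm_flt: "hm S m a \<Longrightarrow> flt m a"
  by (auto simp: hm_def flt_def)

lemma flt_power: "flt m a \<Longrightarrow> flt (k * m) (a ^ k)"
proof (induction k)
  case (Suc k)
  then show ?case using flt_mult[of m a "k * m" "a ^ k"] by (simp add: add.commute)
qed simp

lemma wtw_rotate: "wtw (rotate r w) = wtw w"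
  by (metis add.commute append_take_drop_id rotate_drop_take wtw_append)

lemma tau_flt:
  assumes "flt m a" "wtw w < m" shows "tau w a = 0"
  using assms by (simp add: tau_def flt_def wtw_rotate)

definition al :: "nat \<Rightarrow> nat \<Rightarrow> (gen, 'k::comm_ring_1) ncs \<Rightarrow> bool" where
  "al g n a \<longleftrightarrow> (\<forall>w. cf a w \<noteq> 0 \<longrightarrow> set w \<subseteq> letters g n)"

lemma al_simps [simp]: "al g n 0" "al g n 1" "al g n a \<Longrightarrow> al g n b \<Longrightarrow> al g n (a + b)"
  "al g n a \<Longrightarrow> al g n b \<Longrightarrow> al g n (a - b)" "al g n a \<Longrightarrow> al g n (- a)" "al g n a \<Longrightarrow> al g n (scl k a)"
proof -
  show "al g n (a + b)" if "al g n a" "al g n b"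
    using that unfolding al_def by (metis add.right_neutral cf_add)
  show "al g n (a - b)" if "al g n a" "al g n b"
    using that unfolding al_def by (metis diff_zero cf_diff)
  show "al g n (scl k a)" if "al g n a"
    using that unfolding al_def by (metis mult_zero_right cf_scl)
qed (auto simp: al_def cf_one)

lemma al_mult [simp]: "al g n a \<Longrightarrow> al g n b \<Longrightarrow> al g n (a * b)"
  unfolding al_def by (auto elim!: cf_mult_nonzeroE) blast+

lemma al_power [simp]: "al g n a \<Longrightarrow> al g n (a ^ k)"
  by (induction k) auto

lemma pol_al: "pol (letters g n) a \<Longrightarrow> al g n a"
  by (simp add: pol_def al_def)

text \<open>Operators built on \<open>lin\<close> need finite support, while a bracket coefficient
  at \<open>w\<close> involves only words of weight at most \<open>wtw w + 2\<close>.\<close>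

definition tr :: "nat \<Rightarrow> nat \<Rightarrow> nat \<Rightarrow> (gen, 'k::comm_ring_1) ncs \<Rightarrow> (gen, 'k) ncs" where
  "tr g n M a = Ncs (\<lambda>w. if set w \<subseteq> letters g n \<and> wtw w \<le> M then cf a w else 0)"

lemma pol_tr: "pol (letters g n) (tr g n M a)"
  unfolding pol_def tr_def
  by (auto intro!: fin_subset[OF finite_words[of "letters g n" M]] split: if_splits)

lemma flt_tr: "al g n a \<Longrightarrow> flt (Suc M) (a - tr g n M a)"
  by (auto simp: flt_def al_def tr_def)

lemma wtw_rot: "p < length u \<Longrightarrow> wt (u ! p) + wtw (rot u p) = wtw u"
  by (metis rot_rotate wtw_Cons wtw_rotate)

lemma length_rot: "p < length u \<Longrightarrow> Suc (length (rot u p)) = length u"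
  by (simp add: rot_def)

lemma set_rot: "set (rot u p) \<subseteq> set u"
  by (auto simp: rot_def dest: in_set_dropD in_set_takeD)

lemma dbc_nonzero:
  assumes "dbc c d P Q w \<noteq> (0::'k::field_char_0)"
  shows "wtw w + 2 = wt c + wt d + wtw P + wtw Q" "length P + length Q \<le> length w"
    "set w \<subseteq> {c} \<union> set P \<union> set Q"
  using assms by (cases c; cases d; auto split: if_splits)+

lemma wbr_nonzero:
  assumes "wbr u v w \<noteq> (0::'k::field_char_0)"
  shows "wtw w + 2 = wtw u + wtw v" "length u + length v \<le> length w + 2" "set w \<subseteq> set u \<union> set v"
proof -
  obtain p q where pq: "p < length u" "q < length v" "dbc (u ! p) (v ! q) (rot u p) (rot v q) w \<noteq> (0::'k)"
    using assms unfolding wbr_def by (metis (no_types, lifting) lessThan_iff sum.neutral)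
  show "wtw w + 2 = wtw u + wtw v"
    using dbc_nonzero(1)[OF pq(3)] wtw_rot[OF pq(1)] wtw_rot[OF pq(2)] by simp
  show "length u + length v \<le> length w + 2"
    using dbc_nonzero(2)[OF pq(3)] length_rot[OF pq(1)] length_rot[OF pq(2)] by simp
  show "set w \<subseteq> set u \<union> set v"
    using dbc_nonzero(3)[OF pq(3)] set_rot[of u p] set_rot[of v q] nth_mem[OF pq(1)] by blast
qed

lemma cd_monom: "cd c (monom u) = (\<Sum>p<length u. if u ! p = c then monom (rot u p) else 0)"
  by (auto simp: ins_def insw_def rot_def monom_append intro!: sum.cong)

text \<open>The link between the letterwise rule \<open>dbc\<close> of the statement and the
  derivation \<open>Dn\<close>; the cyclic remainder of \<open>v\<close> stands behind the value of
  the derivation.\<close>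

lemma wbr_Dn:
  "Ncs (wbr u v) = (\<Sum>q<length v. Dn (monom u) (v ! q) * monom (rot v q) :: (gen, 'k::field_char_0) ncs)"
proof (rule ncs_eqI)
  fix w
  have "cf (Dn (monom u) d * monom Q :: (gen, 'k) ncs) w = (\<Sum>p<length u. dbc (u ! p) d (rot u p) Q w)" for d Q
  proof (cases d)
    case (X i)
    have "cf (Dn (monom u) d * monom Q :: (gen, 'k) ncs) w
        = (\<Sum>p<length u. cf (if u ! p = Y i then - monom (rot u p @ Q) else (0 :: (gen, 'k) ncs)) w)"
      unfolding cf_sum[symmetric] X Dn.simps cd_monom sum_negf[symmetric] sum_distrib_right
      by (auto simp: monom_append intro!: arg_cong[of _ _ "\<lambda>a. cf a w"] sum.cong)
    also have "\<dots> = (\<Sum>p<length u. dbc (u ! p) d (rot u p) Q w)"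
      by (intro sum.cong refl, case_tac "u ! x") (auto simp: X cf_monom)
    finally show ?thesis .
  next
    case (Y i)
    have "cf (Dn (monom u) d * monom Q :: (gen, 'k) ncs) w
        = (\<Sum>p<length u. cf (if u ! p = X i then monom (rot u p @ Q) else (0 :: (gen, 'k) ncs)) w)"
      unfolding cf_sum[symmetric] Y Dn.simps cd_monom sum_distrib_right
      by (auto simp: monom_append intro!: arg_cong[of _ _ "\<lambda>a. cf a w"] sum.cong)
    also have "\<dots> = (\<Sum>p<length u. dbc (u ! p) d (rot u p) Q w)"
      by (intro sum.cong refl, case_tac "u ! x") (auto simp: Y cf_monom)
    finally show ?thesis .
  next
    case (Z j)
    have "cf (Dn (monom u) d * monom Q :: (gen, 'k) ncs) w
        = (\<Sum>p<length u. cf (if u ! p = Z j then monom (Z j # rot u p @ Q) - monom (rot u p @ Z j # Q) else (0 :: (gen, 'k) ncs)) w)"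
      unfolding cf_sum[symmetric] Z Dn.simps cd_monom sum_distrib_left sum_distrib_right
        sum_subtractf[symmetric]
      by (auto simp: monom_append monom_Cons left_diff_distrib mult.assoc intro!: arg_cong[of _ _ "\<lambda>a. cf a w"] sum.cong)
    also have "\<dots> = (\<Sum>p<length u. dbc (u ! p) d (rot u p) Q w)"
      by (intro sum.cong refl, case_tac "u ! x") (auto simp: Z cf_monom)
    finally show ?thesis .
  qed
  then show "cf (Ncs (wbr u v)) w = cf (\<Sum>q<length v. Dn (monom u) (v ! q) * monom (rot v q) :: (gen, 'k) ncs) w"
    unfolding cf_Ncs wbr_def cf_sum by (subst sum.swap) simp
qed

definition nb :: "nat \<Rightarrow> nat \<Rightarrow> (gen, 'k::field_char_0) ncs \<Rightarrow> (gen, 'k) ncs \<Rightarrow> (gen, 'k) ncs" where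
  "nb g n a b = Ncs (nbr g n (cf a) (cf b))"

lemma nb_linear [simp]:
  "nb g n (a + a') b = nb g n a b + nb g n a' b" "nb g n a (b + b') = nb g n a b + nb g n a b'"
  "nb g n (a - a') b = nb g n a b - nb g n a' b" "nb g n a (b - b') = nb g n a b - nb g n a b'"
  "nb g n 0 b = 0"
  by (auto intro!: ncs_eqI simp: nb_def nbr_def case_prod_unfold algebra_simps
      sum.distrib[symmetric] sum_subtractf[symmetric])

lemma nb_sum: "nb g n (sum f I) b = (\<Sum>i\<in>I. nb g n (f i) b)"
  by (induction I rule: infinite_finite_induct) auto

lemma cf_nb_nonzero:
  assumes "cf (nb g n a b) w \<noteq> 0"
  obtains u v where "cf a u \<noteq> 0" "cf b v \<noteq> 0" "wtw w + 2 = wtw u + wtw v" "set w \<subseteq> set u \<union> set v"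
    "set u \<subseteq> letters g n" "set v \<subseteq> letters g n"
proof -
  have "\<exists>x\<in>{(u, v). set u \<subseteq> letters g n \<and> set v \<subseteq> letters g n \<and> length u + length v \<le> length w + 2}.
      (case x of (u, v) \<Rightarrow> cf a u * cf b v * wbr u v w) \<noteq> 0"
    using assms unfolding nb_def nbr_def cf_Ncs by (metis (no_types, lifting) sum.neutral)
  then obtain u v where uv: "set u \<subseteq> letters g n" "set v \<subseteq> letters g n" "cf a u * cf b v * wbr u v w \<noteq> 0"
    by auto
  then have "cf a u \<noteq> 0" "cf b v \<noteq> 0" "wbr u v w \<noteq> (0::'a)" by auto
  then show thesis using that[of u v] uv wbr_nonzero[of u v w, where 'k = 'a] by blast
qed

lemma flt_nb: "flt p a \<Longrightarrow> flt q b \<Longrightarrow> flt (p + q - 2) (nb g n a b)"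
  unfolding flt_def
proof (intro allI impI, rule ccontr)
  fix w assume a: "\<forall>w. wtw w < p \<longrightarrow> cf a w = 0" "\<forall>w. wtw w < q \<longrightarrow> cf b w = 0"
    and w: "wtw w < p + q - 2" "cf (nb g n a b) w \<noteq> 0"
  from w(2) obtain u v where uv: "cf a u \<noteq> 0" "cf b v \<noteq> 0" "wtw w + 2 = wtw u + wtw v"
    by (rule cf_nb_nonzero)
  then have "p \<le> wtw u" "q \<le> wtw v" using a by (meson not_less)+
  then show False using uv(3) w(1) by linarith
qed

lemma hm_nb:
  assumes "hm S p a" "hm S q b" shows "hm (letters g n) (p + q - 2) (nb g n a b)"
  unfolding hm_def
proof (intro allI impI)
  fix w assume "cf (nb g n a b) w \<noteq> 0"
  then obtain u v where "cf a u \<noteq> 0" "cf b v \<noteq> 0" "wtw w + 2 = wtw u + wtw v" "set w \<subseteq> set u \<union> set v"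
    "set u \<subseteq> letters g n" "set v \<subseteq> letters g n" by (rule cf_nb_nonzero)
  moreover from this have "wtw u = p" "wtw v = q" using assms by (auto simp: hm_def)
  ultimately show "set w \<subseteq> letters g n \<and> wtw w = p + q - 2" by auto
qed

lemma al_nb: "al g n (nb g n a b)"
  unfolding al_def by (auto elim!: cf_nb_nonzero)

lemma nb_pol:
  assumes a: "pol (letters g n) a" and b: "pol (letters g n) b"
  shows "nb g n a b = lin (\<lambda>v. \<Sum>q<length v. Dn a (v ! q) * monom (rot v q)) b"
proof (rule ncs_eqI)
  fix w :: "gen list"
  let ?I = "{(u, v). set u \<subseteq> letters g n \<and> set v \<subseteq> letters g n \<and> length u + length v \<le> length w + 2}"
  let ?A = "{u. cf a u \<noteq> 0}" and ?B = "{v. cf b v \<noteq> 0}"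
  have fin: "finite ?A" "finite ?B" using a b by (auto simp: pol_def fin_def)
  have "finite ?I"
    by (rule finite_subset[of _ "{u. set u \<subseteq> letters g n \<and> length u \<le> length w + 2} \<times> {v. set v \<subseteq> letters g n \<and> length v \<le> length w + 2}"])
      (auto intro!: finite_lists_length_le)
  have Dn_lin: "Dn a c = (\<Sum>u\<in>?A. scl (cf a u) (Dn (monom u) c))" for c
  proof -
    have "cd c a = (\<Sum>u\<in>?A. scl (cf a u) (cd c (monom u)))" for c
      by (simp add: ins_def lin_def[of _ a])
    then show ?thesis
      by (cases c) (simp_all add: sum_negf sum_distrib_left sum_distrib_right sum_subtractf scl_distrib)
  qed
  have "cf (nb g n a b) w = (\<Sum>(u, v)\<in>?A \<times> ?B. cf a u * cf b v * wbr u v w)"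
    unfolding nb_def nbr_def cf_Ncs
  proof (rule sum.mono_neutral_cong)
    show "finite (?A \<times> ?B)" using fin by simp
    fix x assume x: "x \<in> ?A \<times> ?B - ?I"
    show "(case x of (u, v) \<Rightarrow> cf a u * cf b v * wbr u v w) = 0"
    proof (rule ccontr)
      assume "(case x of (u, v) \<Rightarrow> cf a u * cf b v * wbr u v w) \<noteq> 0"
      then show False using x a b wbr_nonzero(2)[of "fst x" "snd x" w, where 'k = 'a]
        by (auto simp: pol_def)
    qed
  qed (use \<open>finite ?I\<close> in auto)
  also have "\<dots> = cf (lin (\<lambda>v. \<Sum>q<length v. Dn a (v ! q) * monom (rot v q)) b) w"
  proof -
    have "lin (\<lambda>v. \<Sum>q<length v. Dn a (v ! q) * monom (rot v q)) b
        = (\<Sum>v\<in>?B. scl (cf b v) (\<Sum>u\<in>?A. scl (cf a u) (Ncs (wbr u v))))"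
      unfolding lin_def wbr_Dn Dn_lin sum_distrib_right scl_sum by (subst sum.swap) simp
    then show ?thesis
      by (simp add: sum.cartesian_product[symmetric] sum_distrib_left mult_ac)
        (subst sum.swap, simp)
  qed
  finally show "cf (nb g n a b) w = cf (lin (\<lambda>v. \<Sum>q<length v. Dn a (v ! q) * monom (rot v q)) b) w" .
qed

text \<open>The chosen representative of the bracket and the derivation differ by moving the part
  before the cut to the end, which \<open>tau\<close> does not see.\<close>

lemma tau_nb_pol:
  fixes a b :: "(gen, 'k::field_char_0) ncs"
  assumes "pol (letters g n) a" "pol (letters g n) b"
  shows "tau w (nb g n a b) = tau w (der (Dn a) b)"
proof -
  have "tau w (monom (take q v) * d * monom (drop (Suc q) v)) = tau w (d * monom (rot v q))" for q v and d :: "(gen, 'k) ncs"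
    using tau_mult_commute[of w "monom (take q v)" "d * monom (drop (Suc q) v)"]
    by (simp add: rot_def monom_append mult.assoc)
  then show ?thesis
    unfolding nb_pol[OF assms] der_def lin_def by simp
qed

lemma Dn_mult_commute: "fin a \<Longrightarrow> fin b \<Longrightarrow> Dn (a * b) c = Dn (b * a) c"
  by (cases c) (simp_all add: ins_mult add.commute)

text \<open>An equality of series, not just of cyclic words, because the first argument enters only
  through its cyclic derivatives.\<close>

lemma nb_mult_commute:
  assumes "al g n a" "al g n b" "al g n c"
  shows "nb g n (a * b) c = nb g n (b * a) c"
proof (rule ncs_eqI)
  fix w
  \<comment> \<open>The bracket lowers the total weight by 2.\<close>
  define M where "M = wtw w + 2"
  have *: "cf (nb g n (x * y) c) w = cf (nb g n (tr g n M x * tr g n M y) (tr g n M c)) w"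
    if "al g n x" "al g n y" for x y
  proof -
    have "flt (Suc M) ((x - tr g n M x) * y + tr g n M x * (y - tr g n M y))"
      using flt_mult[OF flt_tr[OF that(1), of M], of 0 y] flt_mult[OF _ flt_tr[OF that(2), of M], of 0 "tr g n M x"]
      by (intro flt_add) auto
    then have "flt (Suc M + 0 - 2) (nb g n (x * y - tr g n M x * tr g n M y) c)"
      by (intro flt_nb) (simp_all add: algebra_simps)
    then have "cf (nb g n (x * y) c) w = cf (nb g n (tr g n M x * tr g n M y) c) w"
      by (simp add: flt_def M_def)
    moreover have "flt (0 + Suc M - 2) (nb g n (tr g n M x * tr g n M y) (c - tr g n M c))"
      by (intro flt_nb flt_tr assms) simp
    ultimately show ?thesis by (simp add: flt_def M_def)
  qed
  have p: "pol (letters g n) (tr g n M x * tr g n M y)" for x y :: "(gen, 'a) ncs"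
    by (simp add: pol_tr)
  have "nb g n (tr g n M a * tr g n M b) (tr g n M c) = nb g n (tr g n M b * tr g n M a) (tr g n M c)"
    unfolding nb_pol[OF p pol_tr] by (rule lin_cong) (use pol_tr Dn_mult_commute pol_fin in metis)
  then show "cf (nb g n (a * b) c) w = cf (nb g n (b * a) c) w"
    using * assms by simp
qed

text \<open>A derivation that is \<open>[-, p]\<close> on letters is so everywhere, and commutators
  have trivial cyclic words; truncation passes from polynomials to series.\<close>

lemma central_cyc0:
  assumes "\<And>c. c \<in> letters g n \<Longrightarrow> Dn a c = cm (vr c) p" and a: "pol (letters g n) a"
    and b: "al g n b"
  shows "cyc0 (nb g n a b)"
proof -
  have pol: "cyc0 (nb g n a c)" if c: "pol (letters g n) c" for c
  proof -
    have v: "(\<Sum>q<length v. monom (take q v) * Dn a (v ! q) * monom (drop (Suc q) v)) = cm (monom v) p"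
      if "set v \<subseteq> letters g n" for v
      using that
    proof (induction v)
      case (Cons x v)
      have "(\<Sum>q<length (x # v). monom (take q (x # v)) * Dn a ((x # v) ! q) * monom (drop (Suc q) (x # v)))
          = Dn a x * monom v + vr x * (\<Sum>q<length v. monom (take q v) * Dn a (v ! q) * monom (drop (Suc q) v))"
        by (simp add: sum.lessThan_Suc_shift monom_Cons sum_distrib_left mult.assoc del: sum.lessThan_Suc)
      also have "\<dots> = cm (vr x) p * monom v + vr x * cm (monom v) p"
        using Cons assms(1)[of x] by simp
      finally show ?case by (simp add: monom_Cons algebra_simps)
    qed simp
    have "der (Dn a) c = lin (\<lambda>v. cm (monom v) p) c"
      unfolding der_def by (rule lin_cong, rule v) (use c in \<open>auto simp: pol_def\<close>)
    also have "\<dots> = cm (lin monom c) p"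
      by (simp add: lin_def sum_distrib_left sum_distrib_right scl_distrib sum_subtractf)
    finally have "der (Dn a) c = cm (lin monom c) p" .
    then show ?thesis
      using tau_nb_pol[OF a c] tau_mult_commute[of _ "lin monom c" p] by (simp add: cyc0_def)
  qed
  show ?thesis
    unfolding cyc0_def
  proof
    fix w
    have "flt (0 + Suc (wtw w + 2) - 2) (nb g n a (b - tr g n (wtw w + 2) b))"
      by (intro flt_nb flt_tr b) simp
    then have "tau w (nb g n a (b - tr g n (wtw w + 2) b)) = 0"
      by (rule tau_flt) simp
    then show "tau w (nb g n a b) = 0"
      using pol[OF pol_tr, of "wtw w + 2" b] by (simp add: cyc0_def)
  qed
qed

text \<open>The common inner element is \<open>k \<omega>^(k-1)\<close>, left in the form in which
  \<open>ins_power\<close> delivers it.\<close>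

lemma nb_om_power: "al g n b \<Longrightarrow> cyc0 (nb g n (om g n ^ k) b)"
proof (rule central_cyc0)
  fix c assume "c \<in> letters g n"
  then show "Dn (om g n ^ k) c = cm (vr c) (\<Sum>i<k. om g n ^ (k - 1 - i) * 1 * om g n ^ i)"
    by (cases c) (simp_all add: ins_power ins_om del: mult_1_right)
next
  show "pol (letters g n) (om g n ^ k)" by (intro pol_power hm_pol[OF _ hm_om]) simp
qed

text \<open>The derivation itself is zero: the only nonzero cyclic derivative of
  \<open>z_j^k\<close> commutes with \<open>z_j\<close>.\<close>

lemma nb_Z_power:
  fixes b :: "(gen, 'k::field_char_0) ncs"
  assumes "1 \<le> j" "j \<le> n" "al g n b" shows "cyc0 (nb g n (vr (Z j) ^ k) b)"
proof (rule central_cyc0)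
  fix c
  have "vr (Z j) * (vr (Z j) ^ (k - 1 - i) * 1 * vr (Z j) ^ i) = vr (Z j) ^ (k - 1 - i) * 1 * vr (Z j) ^ i * (vr (Z j) :: (gen, 'k) ncs)" for i
    by (simp add: power_commutes flip: mult.assoc power_add)
  then show "Dn (vr (Z j) ^ k :: (gen, 'k) ncs) c = cm (vr c) 0"
    by (cases c) (auto simp: ins_power ins_vr sum_distrib_left sum_distrib_right simp del: mult_1_right)
qed (use assms in auto)

text \<open>The sum of all rotations of the words of \<open>a\<close> is 0, and a cyclic functional
  \<open>t\<close> is recovered from it by averaging over rotations, which needs characteristic
  0.\<close>

lemma cyc0_lin:
  assumes a: "fin a" "cyc0 a" and t: "\<And>u v. t (u @ v) = t (v @ u)" "t [] = (0::'k::field_char_0)"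
  shows "(\<Sum>u | cf a u \<noteq> 0. cf a u * t u) = 0"
proof -
  define g where "g u = scl (t u / of_nat (length u)) (1 :: ('a, 'k) ncs)" for u
  have rot: "t (rotate q u) = t u" for q u
    by (metis append_take_drop_id rotate_drop_take t(1))
  have "lin (\<lambda>u. \<Sum>q<length u. monom (rotate q u)) a = 0"
  proof (rule ncs_eqI)
    fix w
    have "cf (lin (\<lambda>u. \<Sum>q<length u. monom (rotate q u)) a) w = tau w a"
      using a(1)
    proof (induction rule: fin_induct)
      case (monom u)
      show ?case
      proof (cases "length u = length w")
        case True
        then show ?thesis
          using sum_rotate_inverse[of u w, where 'b = 'k] by (simp add: tau_def cf_monom eq_commute)
      next
        case False
        then have "w \<noteq> rotate q u" "rotate r w \<noteq> u" for q r by (metis length_rotate)+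
        then show ?thesis by (simp add: tau_def cf_monom)
      qed
    qed auto
    then show "cf (lin (\<lambda>u. \<Sum>q<length u. monom (rotate q u)) a) w = cf 0 w"
      using a(2) by (simp add: cyc0_def)
  qed
  then have "0 = lin g (lin (\<lambda>u. \<Sum>q<length u. monom (rotate q u)) a)" by simp
  also have "\<dots> = lin (\<lambda>u. \<Sum>q<length u. g (rotate q u)) a"
    using a(1) by (induction rule: fin_induct) (simp_all)
  also have "\<dots> = lin (\<lambda>u. scl (t u) 1) a"
  proof (rule lin_cong)
    fix u
    show "(\<Sum>q<length u. g (rotate q u)) = scl (t u) 1"
    proof (cases "u = []")
      case False
      then have "(\<Sum>q<length u. g (rotate q u)) = scl (of_nat (length u) * (t u / of_nat (length u))) 1"
        by (simp only: g_def rot length_rotate sum_constant card_lessThan scl_of_nat[symmetric] scl_simps(4))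
      then show ?thesis using False by simp
    qed (simp add: t(2))
  qed
  finally have "cf (lin (\<lambda>u. scl (t u) (1 :: ('a, 'k) ncs)) a) [] = 0" by simp
  then show ?thesis by (simp add: cf_lin cf_one)
qed

section \<open>Exponentials and conjugation\<close>

definition ex :: "(gen, 'k::field_char_0) ncs \<Rightarrow> (gen, 'k) ncs" where
  "ex a = Ncs (\<lambda>w. \<Sum>k\<le>length w. cf (a ^ k) w / of_nat (fact k))"

definition exn :: "nat \<Rightarrow> (gen, 'k::field_char_0) ncs \<Rightarrow> (gen, 'k) ncs" where
  "exn M a = (\<Sum>k\<le>M. scl (1 / of_nat (fact k)) (a ^ k))"

lemma flt_cong: "flt M (a - b) \<longleftrightarrow> (\<forall>w. wtw w < M \<longrightarrow> cf a w = cf b w)"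
  by (simp add: flt_def)

lemma flt_power1: "flt 1 a \<Longrightarrow> flt k (a ^ k)"
  using flt_power[of 1 a k] by simp

lemma flt_1: "flt 1 a \<longleftrightarrow> cf a [] = 0"
  by (simp add: flt_def)

lemma cf_power_length:
  assumes "cf a [] = 0" "length w < k" shows "cf (a ^ k) w = 0"
  using assms(2)
proof (induction k arbitrary: w)
  case (Suc k)
  show ?case
  proof (rule ccontr)
    assume "cf (a ^ Suc k) w \<noteq> 0"
    then obtain u v where uv: "w = u @ v" "cf a u \<noteq> 0" "cf (a ^ k) v \<noteq> 0"
      unfolding power_Suc by (rule cf_mult_nonzeroE)
    then have "u \<noteq> []" "\<not> length v < k" using assms(1) Suc.IH by auto
    then have "length w \<ge> Suc k" using uv(1) by (cases u) auto
    then show False using Suc.prems by simp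
  qed
qed simp

lemma ex_exn:
  assumes "flt 1 a" shows "flt (Suc M) (ex a - exn M a)"
  unfolding flt_cong
proof (intro allI impI)
  fix w assume w: "wtw w < Suc M"
  have a0: "cf a [] = 0" using assms flt_1 by blast
  have "length w \<le> M" using w length_le_wtw[of w] by simp
  then have "cf (exn M a) w = (\<Sum>k\<le>length w. cf (a ^ k) w / of_nat (fact k))"
    unfolding exn_def cf_sum
    by (intro sum.mono_neutral_cong_right) (auto simp: cf_power_length[OF a0])
  then show "cf (ex a) w = cf (exn M a) w" by (simp add: ex_def)
qed

lemma flt_exn_1: "flt 1 a \<Longrightarrow> flt 1 (exn M a - 1)"
proof (induction M)
  case (Suc M)
  have "exn (Suc M) a - 1 = (exn M a - 1) + scl (1 / of_nat (fact (Suc M))) (a ^ Suc M)"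
    by (simp add: exn_def del: fact_Suc of_nat_fact)
  moreover have "flt 1 (a ^ Suc M)" by (rule flt_le[OF flt_power1[OF Suc.prems]]) simp
  ultimately show ?case using Suc by (simp only: flt_add flt_scl)
qed (simp add: exn_def)

lemma flt_ex_1: "flt 1 a \<Longrightarrow> flt 1 (ex a - 1)"
proof -
  assume a: "flt 1 a"
  have "flt 1 ((ex a - exn 0 a) + (exn 0 a - 1))"
    by (intro flt_add flt_exn_1[OF a] flt_le[OF ex_exn[OF a]]) simp
  then show ?thesis by simp
qed

lemma power_diff_telescope:
  "(x::'b::ring_1) ^ K - t ^ K = (\<Sum>i<K. t ^ i * (x - t) * x ^ (K - 1 - i))"
proof (induction K)
  case (Suc K)
  have "(\<Sum>i<Suc K. t ^ i * (x - t) * x ^ (Suc K - 1 - i))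
      = (\<Sum>i<K. t ^ i * (x - t) * x ^ (K - 1 - i)) * x + t ^ K * (x - t)"
  proof -
    have "x ^ (K - i) = x ^ (K - 1 - i) * x" if "i < K" for i
      using that by (metis Suc_diff_Suc diff_Suc_eq_diff_pred power_Suc2)
    then show ?thesis by (simp add: sum_distrib_right mult.assoc)
  qed
  also have "\<dots> = (x ^ K - t ^ K) * x + t ^ K * (x - t)" by (simp add: Suc)
  also have "\<dots> = x ^ Suc K - t ^ Suc K" by (simp add: algebra_simps power_Suc2 del: power_Suc)
  finally show ?case by simp
qed simp

text \<open>Every term of the difference other than \<open>h\<close> has a factor \<open>h\<close>
  and at least one more factor of weight 1 or higher.\<close>

lemma ex_perturb:
  assumes l: "flt 1 l" and h: "flt d h" and d: "1 \<le> d"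
  shows "flt (Suc d) (ex (l + h) - ex l - h)"
proof -
  have lh: "flt 1 (l + h)" using l h d by (intro flt_add flt_le[OF h]) auto
  define M where "M = Suc d"
  have step: "flt (Suc d) ((l + h) ^ k - l ^ k)" if "2 \<le> k" for k
  proof -
    have "flt (Suc d) (\<Sum>i<k. l ^ i * h * (l + h) ^ (k - 1 - i))"
    proof (rule flt_sum)
      fix i assume "i \<in> {..<k}"
      then have i: "i < k" by simp
      show "flt (Suc d) (l ^ i * h * (l + h) ^ (k - 1 - i))"
        by (rule flt_mult_le[OF flt_mult[OF flt_power1[OF l] h] flt_power1[OF lh]]) (use i that in auto)
    qed
    then show ?thesis using power_diff_telescope[of "l + h" k l] by simp
  qed
  have "exn M (l + h) - exn M l - h = (\<Sum>k\<le>M. if k < 2 then 0 else scl (1 / of_nat (fact k)) ((l + h) ^ k - l ^ k))"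
  proof -
    have "exn M (l + h) - exn M l = (\<Sum>k\<le>M. scl (1 / of_nat (fact k)) ((l + h) ^ k - l ^ k))"
      by (simp add: exn_def sum_subtractf scl_distrib)
    also have "\<dots> = (\<Sum>k\<le>M. (if k < 2 then 0 else scl (1 / of_nat (fact k)) ((l + h) ^ k - l ^ k)) + (if k = 1 then h else 0))"
      by (intro sum.cong refl) (auto simp: less_2_cases_iff)
    also have "\<dots> = (\<Sum>k\<le>M. if k < 2 then 0 else scl (1 / of_nat (fact k)) ((l + h) ^ k - l ^ k)) + h"
      by (simp add: sum.distrib M_def)
    finally show ?thesis by simp
  qed
  also have "flt (Suc d) \<dots>"
    by (intro flt_sum) (auto intro!: flt_scl step)
  finally have "flt (Suc d) (exn M (l + h) - exn M l - h)" .
  moreover have "flt (Suc d) (ex (l + h) - exn M (l + h))" "flt (Suc d) (ex l - exn M l)"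
    by (rule flt_le[OF ex_exn[OF lh]], simp add: M_def, rule flt_le[OF ex_exn[OF l]], simp add: M_def)
  ultimately have "flt (Suc d) ((ex (l + h) - exn M (l + h)) - (ex l - exn M l) + (exn M (l + h) - exn M l - h))"
    by (meson flt_add flt_diff)
  then show ?thesis by (simp add: algebra_simps)
qed

fun adi :: "(gen, 'k::field_char_0) ncs \<Rightarrow> nat \<Rightarrow> (gen, 'k) ncs \<Rightarrow> (gen, 'k) ncs" where
  "adi l 0 x = x"
| "adi l (Suc k) x = cm (adi l k x) l"

text \<open>Binomial theorem for the commuting operators of left multiplication by
  \<open>- l\<close> and right multiplication by \<open>l\<close>, whose sum is
  \<open>[-, l]\<close>: the right side is the part of \<open>exp(-l) x exp(l)\<close> of degree
  \<open>k\<close> in \<open>l\<close>.\<close>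

lemma adi_expand:
  "scl (1 / of_nat (fact k)) (adi l k x)
     = (\<Sum>i\<le>k. scl (1 / (of_nat (fact i) * of_nat (fact (k - i)))) ((- l) ^ i * x * l ^ (k - i)))"
proof (induction k)
  case (Suc k)
  define c where "c i j = (1 / (of_nat (fact i) * of_nat (fact j)) :: 'a)" for i j
  define T where "T i j = (- l) ^ i * x * l ^ j" for i j
  define P where "P k = (\<Sum>i\<le>k. scl (c i (k - i)) (T i (k - i)))" for k
  have IH: "scl (1 / of_nat (fact k)) (adi l k x) = P k"
    using Suc by (simp add: P_def c_def T_def)
  have R: "P k * l = (\<Sum>i\<le>Suc k. scl (of_nat (Suc k - i) * c i (Suc k - i)) (T i (Suc k - i)))"
  proof -
    have "P k * l = (\<Sum>i\<le>k. scl (of_nat (Suc k - i) * c i (Suc k - i)) (T i (Suc k - i)))"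
      unfolding P_def sum_distrib_right
    proof (intro sum.cong refl)
      fix i assume i: "i \<in> {..k}"
      then have s: "Suc k - i = Suc (k - i)" by (simp add: Suc_diff_le)
      have "of_nat (Suc (k - i)) * c i (Suc (k - i)) = c i (k - i)"
        unfolding c_def fact_Suc of_nat_mult using of_nat_neq_0[of "k - i", where 'a = 'a]
        by (simp add: del: of_nat_Suc of_nat_fact)
      then show "scl (c i (k - i)) (T i (k - i)) * l = scl (of_nat (Suc k - i) * c i (Suc k - i)) (T i (Suc k - i))"
        unfolding s by (simp add: T_def mult.assoc power_Suc2 del: power_Suc of_nat_Suc)
    qed
    then show ?thesis by simp
  qed
  have L: "- l * P k = (\<Sum>i\<le>Suc k. scl (of_nat i * c i (Suc k - i)) (T i (Suc k - i)))"
  proof -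
    have "(\<Sum>i\<le>Suc k. scl (of_nat i * c i (Suc k - i)) (T i (Suc k - i)))
        = (\<Sum>i\<le>k. scl (of_nat (Suc i) * c (Suc i) (k - i)) (T (Suc i) (k - i)))"
      by (subst sum.atMost_Suc_shift) simp
    also have "\<dots> = (\<Sum>i\<le>k. - l * scl (c i (k - i)) (T i (k - i)))"
    proof (intro sum.cong refl)
      fix i
      have "of_nat (Suc i) * c (Suc i) (k - i) = c i (k - i)"
        unfolding c_def fact_Suc of_nat_mult using of_nat_neq_0[of i, where 'a = 'a]
        by (simp add: del: of_nat_Suc of_nat_fact)
      then show "scl (of_nat (Suc i) * c (Suc i) (k - i)) (T (Suc i) (k - i)) = - l * scl (c i (k - i)) (T i (k - i))"
        by (simp add: T_def mult.assoc del: of_nat_Suc)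
    qed
    finally show ?thesis by (simp add: P_def sum_distrib_left)
  qed
  have "cm (P k) l = P k * l + - l * P k" by simp
  also have "\<dots> = (\<Sum>i\<le>Suc k. scl (of_nat (Suc k) * c i (Suc k - i)) (T i (Suc k - i)))"
    unfolding R L sum.distrib[symmetric]
  proof (intro sum.cong refl)
    fix i assume "i \<in> {..Suc k}"
    then have "(of_nat (Suc k) :: 'a) = of_nat (Suc k - i) + of_nat i"
      by (metis atMost_iff le_add_diff_inverse2 of_nat_add)
    then show "scl (of_nat (Suc k - i) * c i (Suc k - i)) (T i (Suc k - i)) + scl (of_nat i * c i (Suc k - i)) (T i (Suc k - i))
        = scl (of_nat (Suc k) * c i (Suc k - i)) (T i (Suc k - i))"
      by (simp only: distrib_right scl_distrib)
  qed
  also have "\<dots> = scl (of_nat (Suc k)) (P (Suc k))"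
    by (simp only: P_def scl_sum scl_simps)
  finally have e: "cm (P k) l = scl (of_nat (Suc k)) (P (Suc k))" .
  have "(1 / of_nat (fact (Suc k)) :: 'a) = 1 / of_nat (Suc k) * (1 / of_nat (fact k))"
    unfolding fact_Suc of_nat_mult by simp
  then have "scl (1 / of_nat (fact (Suc k))) (adi l (Suc k) x) = scl (1 / of_nat (Suc k)) (cm (scl (1 / of_nat (fact k)) (adi l k x)) l)"
    by (simp only: adi.simps scl_distrib scl_simps)
  also have "\<dots> = P (Suc k)" unfolding IH e by (simp del: of_nat_Suc)
  finally show ?case by (simp add: P_def c_def T_def)
qed simp

lemma conj_adi:
  assumes l: "flt 1 l"
  shows "flt (Suc M) (ex (- l) * x * ex l - (\<Sum>k\<le>M. scl (1 / of_nat (fact k)) (adi l k x)))"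
proof -
  have l': "flt 1 (- l)" using l by (rule flt_uminus)
  define E where "E i j = scl (1 / (of_nat (fact i) * of_nat (fact j))) ((- l) ^ i * x * l ^ j)" for i j
  have e0: "flt (Suc M) (ex (- l) * x * ex l - exn M (- l) * x * exn M l)"
  proof -
    have "ex (- l) * x * ex l - exn M (- l) * x * exn M l
        = (ex (- l) - exn M (- l)) * x * ex l + exn M (- l) * x * (ex l - exn M l)"
      by (simp add: algebra_simps)
    moreover have "flt (Suc M + 0 + 0) ((ex (- l) - exn M (- l)) * x * ex l)"
      by (intro flt_mult ex_exn l') simp_all
    moreover have "flt (0 + 0 + Suc M) (exn M (- l) * x * (ex l - exn M l))"
      by (intro flt_mult ex_exn l) simp_all
    ultimately show ?thesis by (simp add: flt_add)
  qed
  have "exn M (- l) * x * exn M l = (\<Sum>(i, j)\<in>{..M} \<times> {..M}. E i j)"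
    by (simp add: exn_def E_def sum_distrib_left sum_distrib_right scl_sum sum.cartesian_product[symmetric])
      (subst sum.swap, simp add: mult.commute)
  also have "\<dots> = (\<Sum>(i, j)\<in>{(i, j). i + j \<le> M}. E i j) + (\<Sum>(i, j)\<in>{..M} \<times> {..M} - {(i, j). i + j \<le> M}. E i j)"
  proof -
    have "{(i, j). i + j \<le> M} \<subseteq> {..M} \<times> {..M}" by auto
    then show ?thesis by (subst sum.subset_diff[of "{(i, j). i + j \<le> M}"]) (auto simp: add.commute)
  qed
  also have "(\<Sum>(i, j)\<in>{(i, j). i + j \<le> M}. E i j) = (\<Sum>k\<le>M. \<Sum>i\<le>k. E i (k - i))"
    by (rule sum.triangle_reindex_eq)
  also have "\<dots> = (\<Sum>k\<le>M. scl (1 / of_nat (fact k)) (adi l k x))"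
    by (simp only: adi_expand E_def)
  finally have e1: "exn M (- l) * x * exn M l - (\<Sum>k\<le>M. scl (1 / of_nat (fact k)) (adi l k x))
      = (\<Sum>(i, j)\<in>{..M} \<times> {..M} - {(i, j). i + j \<le> M}. E i j)" by simp
  have "flt (Suc M) (E i j)" if "M < i + j" for i j
  proof -
    have "flt (i + 0 + j) ((- l) ^ i * x * l ^ j)"
      by (intro flt_mult flt_power1 l l') simp
    then show ?thesis unfolding E_def using that by (intro flt_scl) (rule flt_le, auto)
  qed
  then have "flt (Suc M) (exn M (- l) * x * exn M l - (\<Sum>k\<le>M. scl (1 / of_nat (fact k)) (adi l k x)))"
    unfolding e1 by (intro flt_sum) auto
  from flt_add[OF e0 this] show ?thesis by simp
qed

lemma flt_all_0: "(\<And>M. flt M a) \<Longrightarrow> a = 0"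
  by (rule ncs_eqI) (auto simp: flt_def intro: lessI)

text \<open>\<open>conj_adi\<close> at \<open>x = 1\<close>, where all brackets vanish.\<close>

lemma ex_inverse:
  assumes "flt 1 l" shows "ex (- l) * ex l = 1" "ex l * ex (- l) = 1"
proof -
  have *: "ex (- l) * ex l = 1" if l: "flt 1 l" for l :: "(gen, 'a) ncs"
  proof -
    have "adi l (Suc k) 1 = 0" for k
      by (induction k) auto
    then have "adi l k 1 = 0" if "0 < k" for k
      using that by (cases k) auto
    then have "(\<Sum>k\<le>M. scl (1 / of_nat (fact k)) (adi l k 1)) = 1" for M
      by (induction M) (auto simp del: adi.simps(2))
    then have "flt (Suc M) (ex (- l) * ex l - 1)" for M
      using conj_adi[OF l, of M 1] by simp
    then have "flt M (ex (- l) * ex l - 1)" for M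
      by (rule flt_le[where m = "Suc M"]) simp
    then show ?thesis using flt_all_0[of "ex (- l) * ex l - 1"] by simp
  qed
  show "ex (- l) * ex l = 1" using * assms .
  show "ex l * ex (- l) = 1" using *[OF flt_uminus[OF assms]] by simp
qed

text \<open>The condition at \<open>u\<close>, \<open>v\<close> involves only coefficients of words
  of weight at most \<open>wtw u + wtw v\<close>.\<close>

lemma prim_limit:
  assumes "\<And>M. \<exists>p. prim p \<and> flt (Suc M) (a - p)" shows "prim a"
  unfolding prim_def
proof (intro allI)
  fix u v
  define M where "M = wtw u + wtw v"
  obtain p where p: "prim p" "flt (Suc M) (a - p)" using assms by blast
  have eq: "cf a w = cf p w" if "wtw w \<le> M" for w
    using p(2) that unfolding flt_cong by simp
  then have "map (cf a) (shuf u v) = map (cf p) (shuf u v)"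
    using wtw_shuf by (intro map_cong refl eq) (auto simp: M_def)
  then have "cop (cf a) u v = cop (cf p) u v" unfolding cop_def by (rule arg_cong)
  then show "cop (cf a) u v = (if v = [] then cf a u else 0) + (if u = [] then cf a v else 0)"
    using p(1) eq[of u] eq[of v] by (simp add: prim_def M_def)
qed

lemma prim_conj:
  assumes "prim l" "prim x" shows "prim (ex (- l) * x * ex l)"
proof (rule prim_limit)
  fix M
  have l: "flt 1 l" using prim_Nil[OF assms(1)] flt_1 by blast
  have "prim (adi l k x)" for k using assms by (induction k) auto
  then have "prim (\<Sum>k\<le>M. scl (1 / of_nat (fact k)) (adi l k x))"
    by (intro prim_sum prim_scl)
  then show "\<exists>p. prim p \<and> flt (Suc M) (ex (- l) * x * ex l - p)"
    using conj_adi[OF l] by blast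
qed

lemma al_ex: "al g n l \<Longrightarrow> al g n (ex l)"
proof -
  assume l: "al g n l"
  show ?thesis
    unfolding al_def
  proof (intro allI impI)
    fix w assume "cf (ex l) w \<noteq> 0"
    then obtain k where "cf (l ^ k) w \<noteq> 0"
      unfolding ex_def cf_Ncs by (metis (no_types, lifting) div_0 sum.neutral)
    then show "set w \<subseteq> letters g n" using al_power[OF l, of k] by (auto simp: al_def)
  qed
qed

text \<open>To first order, changing \<open>l\<close> by \<open>h\<close> changes the conjugate of
  \<open>x\<close> by \<open>[x, h]\<close>, of weight \<open>d + 2\<close>; every further term has
  one more factor of positive weight.\<close>

lemma conj_perturb:
  assumes l: "flt 1 l" and h: "flt d h" and d: "1 \<le> d" and x: "flt 2 x"
  shows "flt (d + 3) (ex (- (l + h)) * x * ex (l + h) - ex (- l) * x * ex l - cm x h)"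
proof -
  define e e' where "e = ex (l + h) - ex l - h" and "e' = ex (- (l + h)) - ex (- l) + h"
  have e: "flt (Suc d) e" unfolding e_def by (rule ex_perturb[OF l h d])
  have e': "flt (Suc d) e'"
    using ex_perturb[OF flt_uminus[OF l] flt_uminus[OF h] d] by (simp add: e'_def)
  have lh: "flt 1 (l + h)" using l h d by (intro flt_add flt_le[OF h]) auto
  have "ex (- (l + h)) * x * ex (l + h) - ex (- l) * x * ex l - cm x h
      = (ex (- l) - 1) * x * h + ex (- l) * x * e - h * x * (ex (l + h) - 1) + e' * x * ex (l + h)"
    by (simp add: e_def e'_def algebra_simps)
  also have "flt (d + 3) \<dots>"
  proof (intro flt_add flt_diff)
    show "flt (d + 3) ((ex (- l) - 1) * x * h)"
      by (rule flt_mult_le[OF flt_mult[OF flt_ex_1[OF flt_uminus[OF l]] x] h]) simp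
    show "flt (d + 3) (ex (- l) * x * e)"
      by (rule flt_mult_le[OF flt_mult[OF _ x] e, of 0]) auto
    show "flt (d + 3) (h * x * (ex (l + h) - 1))"
      by (rule flt_mult_le[OF flt_mult[OF h x] flt_ex_1[OF lh]]) simp
    show "flt (d + 3) (e' * x * ex (l + h))"
      by (rule flt_mult_le[OF flt_mult[OF e' x], of 0]) auto
  qed
  finally show ?thesis .
qed

section \<open>Automorphisms preserving the necklace bracket\<close>

definition lie :: "nat \<Rightarrow> nat \<Rightarrow> (gen, 'k::field_char_0) ncs \<Rightarrow> bool" where
  "lie g n a \<longleftrightarrow> al g n a \<and> prim a"

lemma lie_simps [simp]: "lie g n 0" "lie g n a \<Longrightarrow> lie g n b \<Longrightarrow> lie g n (a + b)"
  "lie g n a \<Longrightarrow> lie g n b \<Longrightarrow> lie g n (a - b)" "lie g n a \<Longrightarrow> lie g n (- a)"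
  "lie g n a \<Longrightarrow> lie g n (scl k a)" "lie g n a \<Longrightarrow> lie g n b \<Longrightarrow> lie g n (cm a b)"
  by (simp_all add: lie_def)

lemma lie_sum: "(\<And>i. i \<in> I \<Longrightarrow> lie g n (f i)) \<Longrightarrow> lie g n (sum f I)"
  by (induction I rule: infinite_finite_induct) auto

lemma lie_vr: "c \<in> letters g n \<Longrightarrow> lie g n (vr c)"
  by (simp add: lie_def al_def cf_vr)

lemma lie_flt: "lie g n l \<Longrightarrow> flt 1 l"
  using prim_Nil flt_1 lie_def by blast

lemma hm_lie: "hm (letters g n) m a \<Longrightarrow> prim a \<Longrightarrow> lie g n a"
  by (auto simp: lie_def hm_def al_def)

fun pgw :: "((gen, 'k::comm_ring_1) ncs \<Rightarrow> (gen, 'k) ncs) \<Rightarrow> gen list \<Rightarrow> (gen, 'k) ncs" where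
  "pgw G [] = 1"
| "pgw G (c # u) = G (vr c) * pgw G u"

lemma pgw_append: "pgw G (u @ v) = pgw G u * pgw G v"
  by (induction u) (auto simp: mult.assoc)

definition comp :: "nat \<Rightarrow> (gen, 'k::comm_ring_1) ncs \<Rightarrow> (gen, 'k) ncs" where
  "comp m a = Ncs (\<lambda>w. if wtw w = m then cf a w else 0)"

lemma hm_comp: "al g n a \<Longrightarrow> hm (letters g n) m (comp m a)"
  by (auto simp: hm_def al_def comp_def)

lemma flt_comp: "flt m a \<Longrightarrow> flt (Suc m) (a - comp m a)"
  by (auto simp: flt_def comp_def)

lemma prim_comp:
  assumes "prim a" shows "prim (comp m a)"
  unfolding prim_def
proof (intro allI)
  fix u v
  have "cop (cf (comp m a)) u v = (if wtw u + wtw v = m then cop (cf a) u v else 0)"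
  proof (cases "wtw u + wtw v = m")
    case True
    then have "map (cf (comp m a)) (shuf u v) = map (cf a) (shuf u v)"
      by (intro map_cong refl) (auto simp: comp_def dest: wtw_shuf)
    then have "cop (cf (comp m a)) u v = cop (cf a) u v" unfolding cop_def by (rule arg_cong)
    then show ?thesis using True by simp
  next
    case False
    then have "map (cf (comp m a)) (shuf u v) = map (\<lambda>_. 0) (shuf u v)"
      by (intro map_cong refl) (auto simp: comp_def dest: wtw_shuf)
    then have "cop (cf (comp m a)) u v = sum_list (map (\<lambda>_. 0) (shuf u v))"
      unfolding cop_def by (rule arg_cong)
    then show ?thesis using False by simp
  qed
  then show "cop (cf (comp m a)) u v = (if v = [] then cf (comp m a) u else 0) + (if u = [] then cf (comp m a) v else 0)"
    using assms by (auto simp: prim_def comp_def)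
qed

lemma tau_hm: "hm S m a \<Longrightarrow> wtw w \<noteq> m \<Longrightarrow> tau w a = 0"
  unfolding tau_def hm_def by (metis (no_types, lifting) sum.neutral wtw_rotate)

lemma tau_1 [simp]: "tau w 1 = 0"
  unfolding tau_def
proof (rule sum.neutral, rule ballI)
  fix r assume "r \<in> {..<length w}"
  then have "w \<noteq> []" by auto
  then show "cf 1 (rotate r w) = 0" by (simp add: cf_one)
qed

lemma pol_nb:
  assumes "pol (letters g n) a" "pol (letters g n) b" shows "pol (letters g n) (nb g n a b)"
proof -
  let ?A = "{u. cf a u \<noteq> 0}" and ?B = "{v. cf b v \<noteq> 0}"
  have "finite (\<Union>u\<in>?A. \<Union>v\<in>?B. {w. set w \<subseteq> letters g n \<and> wtw w \<le> wtw u + wtw v})"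
    using assms by (intro finite_UN_I finite_words) (auto simp: pol_def fin_def)
  then have "fin (nb g n a b)"
  proof (rule fin_subset)
    fix w assume "cf (nb g n a b) w \<noteq> 0"
    then obtain u v where "cf a u \<noteq> 0" "cf b v \<noteq> 0" "wtw w + 2 = wtw u + wtw v" "set w \<subseteq> set u \<union> set v"
      "set u \<subseteq> letters g n" "set v \<subseteq> letters g n" by (rule cf_nb_nonzero)
    then show "w \<in> (\<Union>u\<in>?A. \<Union>v\<in>?B. {w. set w \<subseteq> letters g n \<and> wtw w \<le> wtw u + wtw v})"
      by (intro UN_I[of u] UN_I[of v]) auto
  qed
  then show ?thesis using al_nb[of g n a b] by (simp add: pol_def al_def)
qed

lemma power_conj: "(f' :: 'b::ring_1) * f = 1 \<Longrightarrow> (f * a * f') ^ Suc k = f * a ^ Suc k * f'"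
proof (induction k)
  case (Suc k)
  have "(f * a * f') ^ Suc (Suc k) = (f * a * f') * (f * a ^ Suc k * f')"
    using Suc by simp
  also have "\<dots> = f * a * (f' * f) * a ^ Suc k * f'" by (simp add: mult.assoc)
  finally show ?case using Suc.prems by (simp add: mult.assoc)
qed simp

text \<open>The first order term has weight \<open>2 * K + m - 2\<close>. As
  \<open>m \<ge> 3\<close>, each further replacement of \<open>t\<close> by \<open>y - t\<close>
  raises the weight by at least 1.\<close>

lemma power_expand_flt:
  assumes t: "flt 2 t" and u: "flt m u" "3 \<le> m" and y: "flt (Suc m) (y - t - u)"
  shows "flt (2 * K + m - 1) (y ^ K - t ^ K - (\<Sum>i<K. t ^ i * u * t ^ (K - 1 - i)))"
proof -
  have e: "flt m (y - t)"
    using flt_add[OF flt_le[OF y, of m] u(1)] by simp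
  have y2: "flt 2 y" using flt_add[OF flt_le[OF e, of 2] t] u(2) by simp
  have p: "flt (j * 2 + 1) (y ^ j - t ^ j)" for j
    unfolding power_diff_telescope
  proof (rule flt_sum)
    fix i assume "i \<in> {..<j}"
    then show "flt (j * 2 + 1) (t ^ i * (y - t) * y ^ (j - 1 - i))"
      by (intro flt_mult_le[OF flt_mult[OF flt_power[OF t] e] flt_power[OF y2]]) (use u(2) in auto)
  qed
  have "y ^ K - t ^ K - (\<Sum>i<K. t ^ i * u * t ^ (K - 1 - i))
      = (\<Sum>i<K. t ^ i * (y - t - u) * y ^ (K - 1 - i) + t ^ i * u * (y ^ (K - 1 - i) - t ^ (K - 1 - i)))"
    unfolding power_diff_telescope[of y K t] sum_subtractf[symmetric]
    by (intro sum.cong refl) (simp add: algebra_simps)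
  also have "flt (2 * K + m - 1) \<dots>"
  proof (intro flt_sum flt_add)
    fix i assume i: "i \<in> {..<K}"
    show "flt (2 * K + m - 1) (t ^ i * (y - t - u) * y ^ (K - 1 - i))"
      by (rule flt_mult_le[OF flt_mult[OF flt_power[OF t] y] flt_power[OF y2]]) (use i in auto)
    show "flt (2 * K + m - 1) (t ^ i * u * (y ^ (K - 1 - i) - t ^ (K - 1 - i)))"
      by (rule flt_mult_le[OF flt_mult[OF flt_power[OF t] u(1)] p]) (use i in auto)
  qed
  finally show ?thesis .
qed

text \<open>\<open>F\<close> transported to the ring of series. The bracket condition is stated for
  finite support, where \<open>lin (pgw G)\<close> is the algebra extension of
  \<open>G\<close>.\<close>

locale necklace_aut =
  fixes g n :: nat and G :: "(gen, 'k::field_char_0) ncs \<Rightarrow> (gen, 'k) ncs"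
  assumes G_lie: "lie g n a \<Longrightarrow> lie g n (G a)"
    and G_gr: "lie g n a \<Longrightarrow> flt m a \<Longrightarrow> flt (Suc m) (G a - a)"
    and necklace: "pol (letters g n) a \<Longrightarrow> pol (letters g n) b \<Longrightarrow>
      cyc0 (lin (pgw G) (nb g n a b) - nb g n (lin (pgw G) a) (lin (pgw G) b))"
begin

lemma al_pgw: "set v \<subseteq> letters g n \<Longrightarrow> al g n (pgw G v)"
proof (induction v)
  case (Cons c v)
  then have "lie g n (G (vr c))" by (intro G_lie lie_vr) auto
  then show ?case using Cons by (simp add: lie_def)
qed simp

lemma flt_pgw:
  "set v \<subseteq> letters g n \<Longrightarrow> flt (Suc (wtw v)) (pgw G v - monom v) \<and> flt (wtw v) (pgw G v)"
proof (induction v)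
  case (Cons c v)
  have c: "flt (wt c) (vr c :: (gen, 'k) ncs)" by (simp add: flt_def cf_vr)
  have Gc: "flt (Suc (wt c)) (G (vr c) - vr c)"
    using Cons.prems by (intro G_gr lie_vr c) auto
  have IH: "flt (Suc (wtw v)) (pgw G v - monom v)" "flt (wtw v) (pgw G v)" using Cons by auto
  have "pgw G (c # v) - monom (c # v) = (G (vr c) - vr c) * pgw G v + vr c * (pgw G v - monom v)"
    by (simp add: monom_Cons algebra_simps)
  moreover have "flt (Suc (wtw (c # v))) \<dots>"
    by (intro flt_add flt_mult_le[OF Gc IH(2)] flt_mult_le[OF c IH(1)]) auto
  ultimately have 1: "flt (Suc (wtw (c # v))) (pgw G (c # v) - monom (c # v))" by simp
  have "flt (wtw (c # v)) (monom (c # v) :: (gen, 'k) ncs)" by (auto simp: flt_def cf_monom)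
  then have "flt (wtw (c # v)) ((pgw G (c # v) - monom (c # v)) + monom (c # v))"
    by (intro flt_add flt_le[OF 1]) auto
  then show ?case using 1 by simp
qed (simp add: flt_def)

text \<open>The functional \<open>tau w\<close> composed with the multiplicative
  \<open>pgw G\<close> is cyclic, so \<open>cyc0_lin\<close> applies.\<close>

lemma cyc0_lin_pgw:
  assumes "pol (letters g n) a" "cyc0 a" shows "cyc0 (lin (pgw G) a)"
  unfolding cyc0_def
proof
  fix w
  have "tau w (lin (pgw G) a) = (\<Sum>u | cf a u \<noteq> 0. cf a u * tau w (pgw G u))"
    by (simp add: lin_def)
  also have "\<dots> = 0"
    by (rule cyc0_lin) (use assms tau_mult_commute in \<open>auto simp: pgw_append\<close>)
  finally show "tau w (lin (pgw G) a) = 0" .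
qed

lemma lin_pgw_power: "fin a \<Longrightarrow> lin (pgw G) (a ^ k) = lin (pgw G) a ^ k"
  by (induction k) (auto simp: lin_mult_hom pgw_append)

section \<open>Construction of the conjugating Lie element by successive approximation\<close>

context
  fixes \<theta> :: "(gen, 'k) ncs"
  assumes \<theta>: "hm (letters g n) 2 \<theta>" "prim \<theta>" and \<theta>_G: "lin (pgw G) \<theta> = G \<theta>"
    and \<theta>_central: "\<And>k b. al g n b \<Longrightarrow> cyc0 (nb g n (\<theta> ^ k) b)"
    and \<theta>_bracket: "\<And>m u. hm (letters g n) m u \<Longrightarrow> prim u \<Longrightarrow> 2 < m \<Longrightarrow>
      (\<And>k b. pol (letters g n) b \<Longrightarrow> cyc0 (der (Dn (\<theta> ^ k * u)) b)) \<Longrightarrow>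
      \<exists>h. hm (letters g n) (m - 2) h \<and> prim h \<and> u = cm \<theta> h"
begin

lemma pol_\<theta>: "pol (letters g n) \<theta>"
  using hm_pol[OF _ \<theta>(1)] by simp

lemma lie_\<theta>: "lie g n \<theta>"
  using hm_lie \<theta> .

lemma flt_\<theta>: "flt 2 \<theta>"
  using hm_flt \<theta>(1) .

lemma cyc0_power_G:
  assumes "set v \<subseteq> letters g n" shows "cyc0 (nb g n (G \<theta> ^ k) (pgw G v))"
proof -
  have v: "pol (letters g n) (monom v :: (gen, 'k) ncs)" using pol_monom[OF assms] .
  have "cyc0 (nb g n (\<theta> ^ k) (monom v))" using \<theta>_central pol_al[OF v] .
  then have "cyc0 (lin (pgw G) (nb g n (\<theta> ^ k) (monom v)))"
    by (intro cyc0_lin_pgw pol_nb v pol_power pol_\<theta>)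
  moreover have "cyc0 (lin (pgw G) (nb g n (\<theta> ^ k) (monom v)) - nb g n (G \<theta> ^ k) (pgw G v))"
    using necklace[OF pol_power[OF pol_\<theta>] v] pol_\<theta> by (simp add: lin_pgw_power \<theta>_G)
  ultimately show ?thesis by (simp add: cyc0_def)
qed

text \<open>Conjugating back gives \<open>y = \<theta> + u + ...\<close> with the same cyclic powers
  as \<open>G \<theta>\<close>. Both \<open>y^K\<close> and \<open>\<theta>^K\<close> have trivial
  bracket with the image of any word, hence so has, in lowest weight, the first variation of
  \<open>\<theta>^K\<close>, which is cyclically \<open>K \<theta>^k u\<close>.\<close>

lemma leading_central:
  assumes l: "lie g n l" and m: "3 \<le> m" and d: "flt m (G \<theta> - ex (- l) * \<theta> * ex l)"
    and b: "pol (letters g n) b"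
  shows "cyc0 (der (Dn (\<theta> ^ k * comp m (G \<theta> - ex (- l) * \<theta> * ex l))) b)"
proof -
  define u where "u = comp m (G \<theta> - ex (- l) * \<theta> * ex l)"
  define f f' where "f = ex l" and "f' = ex (- l)"
  define y where "y = f * G \<theta> * f'"
  \<comment> \<open>One power more than in the claim, as the variation replaces one factor;
    \<open>K\<close> is never 0 and can be cancelled.\<close>
  define K where "K = Suc k"
  define s where "s = (\<Sum>i<K. \<theta> ^ i * u * \<theta> ^ (K - 1 - i))"
  have l1: "flt 1 l" using lie_flt[OF l] .
  have ff: "f' * f = 1" "f * f' = 1" using ex_inverse[OF l1] by (simp_all add: f_def f'_def)
  have al: "al g n f" "al g n f'" "al g n \<theta>" "al g n (G \<theta>)"
    using l lie_\<theta> G_lie[OF lie_\<theta>] by (auto simp: f_def f'_def lie_def intro!: al_ex)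
  have hu: "hm (letters g n) m u"
    unfolding u_def by (rule hm_comp) (use al in \<open>simp add: f_def f'_def\<close>)
  have alu: "al g n u" using hu by (auto simp: hm_def al_def)
  have yu: "flt (Suc m) (y - \<theta> - u)"
  proof -
    define x where "x = G \<theta> - f' * \<theta> * f"
    have x: "flt m x" using d by (simp add: x_def f_def f'_def)
    have "f * x * f' = y - (f * f') * \<theta> * (f * f')" by (simp add: x_def y_def algebra_simps)
    then have "y - \<theta> - u = (f - 1) * x * f' + x * (f' - 1) + (x - u)"
      by (simp add: ff algebra_simps)
    also have "flt (Suc m) \<dots>"
    proof (intro flt_add)
      show "flt (Suc m) ((f - 1) * x * f')"
        by (rule flt_mult_le[OF flt_mult[OF _ x], of 1 _ 0]) (use flt_ex_1[OF l1] in \<open>auto simp: f_def\<close>)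
      show "flt (Suc m) (x * (f' - 1))"
        by (rule flt_mult_le[OF x, of 1]) (use flt_ex_1[OF flt_uminus[OF l1]] in \<open>auto simp: f'_def\<close>)
      show "flt (Suc m) (x - u)"
        using flt_comp[OF x] by (simp add: u_def x_def f_def f'_def)
    qed
    finally show ?thesis .
  qed
  have rest: "flt (2 * K + m - 1) (y ^ K - \<theta> ^ K - s)"
    unfolding s_def by (rule power_expand_flt[OF flt_\<theta> hm_flt[OF hu] m yu])
  have hs: "hm (letters g n) (2 * k + m) s"
    unfolding s_def
  proof (rule hm_sum)
    fix i assume i: "i \<in> {..<K}"
    have "hm (letters g n) (i * 2 + m + (K - 1 - i) * 2) (\<theta> ^ i * u * \<theta> ^ (K - 1 - i))"
      by (intro hm_mult hm_power \<theta> hu)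
    moreover have "i * 2 + m + (K - 1 - i) * 2 = 2 * k + m" using i by (simp add: K_def)
    ultimately show "hm (letters g n) (2 * k + m) (\<theta> ^ i * u * \<theta> ^ (K - 1 - i))" by metis
  qed
  have word: "cyc0 (nb g n (\<theta> ^ k * u) (monom v))" if v: "set v \<subseteq> letters g n" for v
    unfolding cyc0_def
  proof
    fix w
    have alv: "al g n (pgw G v)" using al_pgw[OF v] .
    have pv: "pol (letters g n) (monom v :: (gen, 'k) ncs)" using pol_monom[OF v] .
    have hv: "hm (letters g n) (wtw v) (monom v :: (gen, 'k) ncs)" using hm_monom[OF v] by simp
    \<comment> \<open>The bracket with \<open>s\<close> lives in a single weight. There the higher
      terms of \<open>y^K\<close> and of the image of \<open>v\<close> are too heavy to contribute,
      so \<open>s\<close> inherits the vanishing from \<open>y^K\<close> and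
      \<open>\<theta>^K\<close>.\<close>
    have "tau w (nb g n s (monom v)) = 0"
    proof (cases "wtw w = 2 * k + m + wtw v - 2")
      case False
      then show ?thesis using tau_hm[OF hm_nb[OF hs hv]] by blast
    next
      case True
      have "y ^ K = f * (G \<theta> ^ K * f')"
        unfolding y_def K_def using power_conj[OF ff(1)] by (simp add: mult.assoc)
      then have "nb g n (y ^ K) (pgw G v) = nb g n (G \<theta> ^ K * f' * f) (pgw G v)"
        using nb_mult_commute[of g n f "G \<theta> ^ K * f'" "pgw G v"] al alv by simp
      also have "G \<theta> ^ K * f' * f = G \<theta> ^ K" using ff(1) by (simp add: mult.assoc)
      finally have "tau w (nb g n (y ^ K) (pgw G v)) = 0"
        using cyc0_power_G[OF v] by (simp add: cyc0_def)
      moreover have "tau w (nb g n (\<theta> ^ K) (pgw G v)) = 0"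
        using \<theta>_central[OF alv] by (simp add: cyc0_def)
      moreover have "tau w (nb g n (y ^ K - \<theta> ^ K - s) (pgw G v)) = 0"
        by (rule tau_flt[OF flt_nb[OF rest conjunct2[OF flt_pgw[OF v]]]]) (use True m in \<open>simp add: K_def\<close>)
      moreover have "tau w (nb g n s (pgw G v - monom v)) = 0"
        by (rule tau_flt[OF flt_nb[OF hm_flt[OF hs] conjunct1[OF flt_pgw[OF v]]]]) (use True m in simp)
      ultimately show ?thesis by simp
    qed
    moreover have "nb g n s (monom v) = of_nat K * nb g n (\<theta> ^ k * u) (monom v)"
    proof -
      have "nb g n (\<theta> ^ i * u * \<theta> ^ (K - 1 - i)) (monom v) = nb g n (\<theta> ^ k * u) (monom v)" if "i < K" for i
      proof -
        have "nb g n (\<theta> ^ i * u * \<theta> ^ (K - 1 - i)) (monom v) = nb g n (\<theta> ^ (K - 1 - i) * (\<theta> ^ i * u)) (monom v)"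
          by (rule nb_mult_commute) (use al alu pol_al[OF pv] in auto)
        also have "\<theta> ^ (K - 1 - i) * (\<theta> ^ i * u) = \<theta> ^ k * u"
          using that by (simp add: K_def flip: mult.assoc power_add)
        finally show ?thesis .
      qed
      then show ?thesis by (simp add: s_def nb_sum)
    qed
    ultimately have "of_nat K * tau w (nb g n (\<theta> ^ k * u) (monom v)) = 0"
      by (simp flip: scl_of_nat)
    then show "tau w (nb g n (\<theta> ^ k * u) (monom v)) = 0"
      by (simp add: K_def del: of_nat_Suc)
  qed
  have pu: "pol (letters g n) (\<theta> ^ k * u)" using pol_\<theta> hm_pol[OF _ hu] by simp
  have "cyc0 (der (Dn (\<theta> ^ k * u)) b)"
    using pol_fin[OF b]
  proof (induction rule: fin_induct)
    case (monom w)
    then have w: "set w \<subseteq> letters g n" using b by (auto simp: pol_def)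
    then show ?case using word[OF w] tau_nb_pol[OF pu pol_monom[OF w]] by (simp add: cyc0_def)
  qed (auto simp: cyc0_def)
  then show ?thesis by (simp add: u_def)
qed

text \<open>The index starts at the first possible error weight 3. As \<open>\<theta>\<close> has
  weight 2, the correction of an error of weight \<open>d + 3\<close> has weight
  \<open>d + 1\<close>, so the corrections converge.\<close>

lemma conj_step:
  assumes l: "lie g n l" and d: "flt (d + 3) (G \<theta> - ex (- l) * \<theta> * ex l)"
  shows "\<exists>l'. lie g n l' \<and> flt (Suc d + 3) (G \<theta> - ex (- l') * \<theta> * ex l') \<and> flt (Suc d) (l' - l)"
proof -
  define x where "x = G \<theta> - ex (- l) * \<theta> * ex l"
  define u where "u = comp (d + 3) x"
  have "prim x"
    using prim_conj[of l \<theta>] l G_lie[OF lie_\<theta>] \<theta>(2) by (simp add: x_def lie_def)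
  then have u: "prim u" unfolding u_def by (rule prim_comp)
  have "al g n x"
    using l lie_\<theta> G_lie[OF lie_\<theta>] by (auto simp: x_def lie_def intro!: al_ex al_simps al_mult)
  then have hu: "hm (letters g n) (d + 3) u" unfolding u_def by (rule hm_comp)
  obtain h where h: "hm (letters g n) (d + 3 - 2) h" "prim h" "u = cm \<theta> h"
    using \<theta>_bracket[OF hu u] leading_central[OF l _ d] unfolding u_def x_def by auto
  have fh: "flt (Suc d) h" using hm_flt[OF h(1)] by simp
  have "flt (Suc d + 3) (ex (- (l + h)) * \<theta> * ex (l + h) - ex (- l) * \<theta> * ex l - u)"
    unfolding h(3) by (rule conj_perturb[OF lie_flt[OF l] fh _ flt_\<theta>]) simp
  moreover have "flt (Suc d + 3) (x - u)"
    using flt_comp[of "d + 3" x] d by (simp add: u_def x_def)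
  ultimately have "flt (Suc d + 3) ((x - u) - (ex (- (l + h)) * \<theta> * ex (l + h) - ex (- l) * \<theta> * ex l - u))"
    by (intro flt_diff[of "Suc d + 3" "x - u"])
  then have "flt (Suc d + 3) (G \<theta> - ex (- (l + h)) * \<theta> * ex (l + h))"
    by (simp add: x_def)
  moreover have "lie g n (l + h)" using l hm_lie[OF h(1,2)] by simp
  ultimately show ?thesis using fh by (intro exI[of _ "l + h"]) simp
qed

lemma conj_exists: "\<exists>l. lie g n l \<and> G \<theta> = ex (- l) * \<theta> * ex l"
proof -
  let ?P = "\<lambda>d l. lie g n l \<and> flt (d + 3) (G \<theta> - ex (- l) * \<theta> * ex l)"
  have ex0: "ex (0 :: (gen, 'k) ncs) = 1"
  proof (rule ncs_eqI)
    fix w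
    have "cf (ex (0 :: (gen, 'k) ncs)) w = (\<Sum>k\<le>length w. if k = 0 then cf 1 w else 0)"
      unfolding ex_def cf_Ncs by (intro sum.cong refl) (auto simp: power_0_left)
    then show "cf (ex (0 :: (gen, 'k) ncs)) w = cf 1 w" by simp
  qed
  have "\<exists>s. \<forall>d. ?P d (s d) \<and> flt (Suc d) (s (Suc d) - s d)"
  proof (rule dependent_nat_choice)
    have "flt 3 (G \<theta> - \<theta>)" using G_gr[OF lie_\<theta> flt_\<theta>] by (simp add: numeral_3_eq_3)
    then show "\<exists>l. ?P 0 l" by (intro exI[of _ 0]) (simp add: ex0)
    show "\<And>l d. ?P d l \<Longrightarrow> \<exists>l'. ?P (Suc d) l' \<and> flt (Suc d) (l' - l)"
      using conj_step by blast
  qed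
  then obtain s where s: "\<And>d. ?P d (s d)" "\<And>d. flt (Suc d) (s (Suc d) - s d)" by blast
  \<comment> \<open>Corrections from step \<open>e\<close> on have weight above \<open>e\<close>, so
    the coefficient at \<open>w\<close> is final at step \<open>wtw w\<close>.\<close>
  define l where "l = Ncs (\<lambda>w. cf (s (wtw w)) w)"
  have stable: "cf (s (e + d)) w = cf (s e) w" if "wtw w \<le> e" for w d e
  proof (induction d)
    case (Suc d)
    have "cf (s (Suc (e + d))) w = cf (s (e + d)) w"
      using s(2)[of "e + d"] that unfolding flt_cong by simp
    then show ?case using Suc by simp
  qed simp
  have ls: "flt (Suc d) (l - s d)" for d
    unfolding flt_cong
  proof (intro allI impI)
    fix w assume "wtw w < Suc d"
    then show "cf l w = cf (s d) w"
      using stable[of w "wtw w" "d - wtw w"] by (simp add: l_def)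
  qed
  have "prim l"
    by (rule prim_limit) (use s(1) ls in \<open>auto simp: lie_def\<close>)
  moreover have "al g n l"
    using s(1) by (auto simp: al_def l_def lie_def)
  ultimately have lie: "lie g n l" by (simp add: lie_def)
  have "flt d (G \<theta> - ex (- l) * \<theta> * ex l)" for d
  proof -
    define h where "h = l - s d"
    have h: "flt (Suc d) h" using ls by (simp add: h_def)
    have "flt (Suc d + 3) (ex (- (s d + h)) * \<theta> * ex (s d + h) - ex (- s d) * \<theta> * ex (s d) - cm \<theta> h)"
      using s(1)[of d] by (intro conj_perturb lie_flt h flt_\<theta>) auto
    moreover have "s d + h = l" by (simp add: h_def)
    ultimately have "flt (Suc d + 3) (ex (- l) * \<theta> * ex l - ex (- s d) * \<theta> * ex (s d) - cm \<theta> h)"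
      by (simp only:)
    then have 1: "flt d (ex (- l) * \<theta> * ex l - ex (- s d) * \<theta> * ex (s d) - cm \<theta> h)"
      by (rule flt_le) simp
    have 2: "flt d (cm \<theta> h)"
      by (intro flt_diff flt_mult_le[OF flt_\<theta> h] flt_mult_le[OF h flt_\<theta>]) auto
    have 3: "flt d (G \<theta> - ex (- s d) * \<theta> * ex (s d))"
      by (rule flt_le[OF conjunct2[OF s(1)[of d]]]) simp
    show ?thesis using flt_diff[OF flt_diff[OF 3 1] 2] by (simp add: algebra_simps)
  qed
  then have "G \<theta> - ex (- l) * \<theta> * ex l = 0" by (rule flt_all_0)
  then show ?thesis using lie by auto
qed

end

end

section \<open>Translation to the raw series of the statement\<close>

lemma raw_simps:
  "smul (cf a) (cf b) = cf (a * b)" "sadd (cf a) (cf b) = cf (a + b)" "ssub (cf a) (cf b) = cf (a - b)"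
  "ssc k (cf a) = cf (scl k a)" "scomm (cf a) (cf b) = cf (cm a b)" "sone = cf 1" "lt c = cf (vr c)"
  by (auto intro!: ext simp: smul_def sadd_def ssub_def ssc_def scomm_def sone_def lt_def cf_mult cf_one cf_vr)

lemma spow_cf: "spow (cf a) k = cf (a ^ k)"
  by (induction k) (auto simp: raw_simps)

lemma sexp_cf: "sexp (cf a) = cf (ex a)"
  by (rule ext) (simp add: sexp_def ex_def spow_cf)

lemma omega_cf: "omega g n = cf (om g n)"
  by (rule ext) (simp add: omega_def om_def raw_simps)

lemma raw_sets: "cf a \<in> filt m \<longleftrightarrow> flt m a" "cf a \<in> Aalg g n \<longleftrightarrow> al g n a" "cf a \<in> Lhat g n \<longleftrightarrow> lie g n a"
  by (auto simp: filt_def flt_def Aalg_def al_def Lhat_def lie_def prim_def)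

lemma cspan_cyc0: "x \<in> cspan g n \<Longrightarrow> cyc0 (Ncs x)"
proof (induction rule: cspan.induct)
  case cs0
  then show ?case by (simp add: cyc0_def tau_def)
next
  case (csc a b)
  have "Ncs (scomm a b) = cm (Ncs a) (Ncs b)"
    using raw_simps(5)[of "Ncs a" "Ncs b"] by simp
  then show ?case using tau_mult_commute[of _ "Ncs a" "Ncs b"] by (simp add: cyc0_def)
next
  case (csa x y)
  have "Ncs (sadd x y) = Ncs x + Ncs y"
    using raw_simps(2)[of "Ncs x" "Ncs y"] by simp
  then show ?case using csa by (simp add: cyc0_def)
next
  case (css x c)
  have "Ncs (ssc c x) = scl c (Ncs x)"
    using raw_simps(4)[of c "Ncs x"] by simp
  then show ?case using css by (simp add: cyc0_def)
qed

text \<open>\<open>tau w\<close> reads coefficients of weight \<open>wtw w\<close> only, so it is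
  continuous and vanishes on the closure of the span of commutators.\<close>

lemma ccl_cyc0:
  assumes "cf a \<in> ccl g n" shows "cyc0 a"
  unfolding cyc0_def
proof
  fix w
  obtain s where s: "s \<in> cspan g n" "ssub (cf a) s \<in> filt (Suc (wtw w))"
    using assms by (auto simp: ccl_def)
  then have "flt (Suc (wtw w)) (a - Ncs s)"
    using raw_simps(3)[of a "Ncs s"] raw_sets(1)[of "a - Ncs s"] by simp
  then have "tau w (a - Ncs s) = 0" by (rule tau_flt) simp
  then show "tau w a = 0" using cspan_cyc0[OF s(1)] by (simp add: cyc0_def)
qed

text \<open>The sum in \<open>ext\<close> is bounded by weight, that in \<open>lin\<close> by the
  support of \<open>a\<close>; words heavier than \<open>w\<close> contribute 0 at \<open>w\<close>
  because their images are at least as heavy.\<close>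

lemma ext_cf:
  assumes a: "pol (letters g n) a"
    and flt: "\<And>v. set v \<subseteq> letters g n \<Longrightarrow> flt (wtw v) (pgw (\<lambda>a. Ncs (F (cf a))) v)"
  shows "ext g n F (cf a) = cf (lin (pgw (\<lambda>a. Ncs (F (cf a)))) a)"
proof
  fix w
  let ?G = "\<lambda>a. Ncs (F (cf a))" and ?U = "{u. set u \<subseteq> letters g n \<and> wtw u \<le> wtw w}"
  have "sprod (map (\<lambda>c. F (lt c)) u) = cf (pgw ?G u)" for u
  proof (induction u)
    case (Cons c u)
    have "smul (F (lt c)) (cf (pgw ?G u)) = cf (?G (vr c) * pgw ?G u)"
      using raw_simps(1)[of "Ncs (F (lt c))" "pgw ?G u"] by (simp add: raw_simps)
    then show ?case using Cons by (simp add: sprod_def)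
  qed (simp add: sprod_def raw_simps)
  then have "ext g n F (cf a) w = (\<Sum>u\<in>?U. cf a u * cf (pgw ?G u) w)"
    by (simp add: ext_def)
  also have "\<dots> = (\<Sum>u | cf a u \<noteq> 0. cf a u * cf (pgw ?G u) w)"
  proof (rule sum.mono_neutral_cong)
    fix u assume "u \<in> {u. cf a u \<noteq> 0} - ?U"
    then have "set u \<subseteq> letters g n" "wtw w < wtw u" using a by (auto simp: pol_def)
    then show "cf a u * cf (pgw ?G u) w = 0" using flt[of u] by (simp add: flt_def)
  qed (use a finite_words[of "letters g n"] in \<open>auto simp: pol_def fin_def\<close>)
  finally show "ext g n F (cf a) w = cf (lin (pgw ?G) a) w" by (simp add: cf_lin)
qed

theorem theorem2p7:
  fixes g n :: nat and F :: "('k::field_char_0) ser \<Rightarrow> 'k ser"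
  assumes bij: "bij_betw F (Lhat g n) (Lhat g n)"
    and add: "\<And>a b. a \<in> Lhat g n \<Longrightarrow> b \<in> Lhat g n \<Longrightarrow> F (sadd a b) = sadd (F a) (F b)"
    and scal: "\<And>c a. a \<in> Lhat g n \<Longrightarrow> F (ssc c a) = ssc c (F a)"
    and lie: "\<And>a b. a \<in> Lhat g n \<Longrightarrow> b \<in> Lhat g n \<Longrightarrow> F (scomm a b) = scomm (F a) (F b)"
    and filt_pres: "\<And>m a. a \<in> Lhat g n \<Longrightarrow> a \<in> filt m \<Longrightarrow> F a \<in> filt m"
    and gr_id: "\<And>m a. a \<in> Lhat g n \<Longrightarrow> a \<in> filt m \<Longrightarrow> ssub (F a) a \<in> filt (Suc m)"
    and necklace: "\<And>a b. a \<in> Aalg g n \<Longrightarrow> b \<in> Aalg g n \<Longrightarrow>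
        ssub (ext g n F (nbr g n a b)) (nbr g n (ext g n F a) (ext g n F b)) \<in> ccl g n"
  shows "(\<forall>j \<in> {1..n}. \<exists>f f'. grouplike g n f \<and> smul f' f = sone \<and> smul f f' = sone
              \<and> F (lt (Z j)) = smul (smul f' (lt (Z j))) f)
       \<and> (\<exists>f f'. grouplike g n f \<and> smul f' f = sone \<and> smul f f' = sone
              \<and> F (omega g n) = smul (smul f' (omega g n)) f)"
proof -
  define G where "G a = Ncs (F (cf a))" for a
  have cfG: "cf (G a) = F (cf a)" for a by (simp add: G_def)
  have G_lie: "lie g n (G a)" if "lie g n a" for a
    using bij_betwE[OF bij] that by (simp add: cfG flip: raw_sets(3))
  have G_gr: "flt (Suc m) (G a - a)" if "lie g n a" "flt m a" for m a
    using gr_id[of "cf a" m] that by (simp add: cfG[symmetric] raw_simps raw_sets)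
  have G_flt: "flt m (G a)" if "lie g n a" "flt m a" for m a
    using filt_pres[of "cf a" m] that by (simp add: cfG[symmetric] raw_sets)
  have G_add: "G (a + b) = G a + G b" if "lie g n a" "lie g n b" for a b
    using add[of "cf a" "cf b"] that by (simp add: cfG[symmetric] raw_simps raw_sets cf_inject)
  have G_cm: "G (cm a b) = cm (G a) (G b)" if "lie g n a" "lie g n b" for a b
    using lie[of "cf a" "cf b"] that by (simp add: cfG[symmetric] raw_simps raw_sets cf_inject)
  have G_0: "G 0 = 0"
    using G_add[of 0 0] by simp
  have G_sum: "G (sum f I) = (\<Sum>i\<in>I. G (f i))" if "\<And>i. i \<in> I \<Longrightarrow> lie g n (f i)"
    for f and I :: "nat set"
    using that by (induction I rule: infinite_finite_induct) (auto simp: G_0 G_add lie_sum)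
  have pg_flt: "flt (wtw v) (pgw G v)" if "set v \<subseteq> letters g n" for v
    using that
  proof (induction v)
    case (Cons c v)
    have "flt (wt c) (G (vr c))"
      using Cons.prems by (intro G_flt lie_vr) (auto simp: flt_def cf_vr)
    then show ?case using Cons flt_mult[of "wt c" "G (vr c)" "wtw v" "pgw G v"] by simp
  qed simp
  have GF: "G = (\<lambda>a. Ncs (F (cf a)))" by (rule ext) (rule G_def)
  have ext_G: "ext g n F (cf a) = cf (lin (pgw G) a)" if "pol (letters g n) a" for a
    unfolding GF by (rule ext_cf[OF that]) (use pg_flt in \<open>simp add: GF\<close>)
  have neck: "cyc0 (lin (pgw G) (nb g n a b) - nb g n (lin (pgw G) a) (lin (pgw G) b))"
    if "pol (letters g n) a" "pol (letters g n) b" for a b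
  proof (rule ccl_cyc0)
    have "nbr g n (cf c) (cf d) = cf (nb g n c d)" for c d :: "(gen, 'k) ncs" by (simp add: nb_def)
    then show "cf (lin (pgw G) (nb g n a b) - nb g n (lin (pgw G) a) (lin (pgw G) b)) \<in> ccl g n"
      using necklace[of "cf a" "cf b"] that ext_G[OF that(1)] ext_G[OF that(2)] ext_G[OF pol_nb[OF that]]
      by (simp add: raw_sets raw_simps pol_al)
  qed
  interpret necklace_aut g n G
    by unfold_locales (use G_lie G_gr neck in auto)
  have final: "\<exists>f f'. grouplike g n f \<and> smul f' f = sone \<and> smul f f' = sone
      \<and> F (cf t) = smul (smul f' (cf t)) f" if t: "\<exists>l. lie g n l \<and> G t = ex (- l) * t * ex l" for t
  proof -
    obtain l where l: "lie g n l" "G t = ex (- l) * t * ex l" using t by blast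
    have "grouplike g n (cf (ex l))"
      unfolding grouplike_def using l(1) by (metis raw_sets(3) sexp_cf)
    moreover have "smul (cf (ex (- l))) (cf (ex l)) = sone" "smul (cf (ex l)) (cf (ex (- l))) = sone"
      using ex_inverse[OF lie_flt[OF l(1)]] by (simp_all add: raw_simps)
    moreover have "F (cf t) = smul (smul (cf (ex (- l))) (cf t)) (cf (ex l))"
      using l(2) by (simp add: raw_simps flip: cfG)
    ultimately show ?thesis by blast
  qed
  have "\<exists>l. lie g n l \<and> G (vr (Z j)) = ex (- l) * vr (Z j) * ex l" if j: "j \<in> {1..n}" for j
  proof (rule conj_exists)
    show "hm (letters g n) 2 (vr (Z j) :: (gen, 'k) ncs)" using j by (intro hm_vr) auto
    show "cyc0 (nb g n (vr (Z j) ^ k) b)" if "al g n b" for k and b :: "(gen, 'k) ncs"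
      by (rule nb_Z_power) (use that j in auto)
    show "\<exists>h. hm (letters g n) (m - 2) h \<and> prim h \<and> u = cm (vr (Z j)) h"
      if "hm (letters g n) m u" "prim u" "2 < m"
        "\<And>k b. pol (letters g n) b \<Longrightarrow> cyc0 (der (Dn (vr (Z j) ^ k * u)) b)" for m and u :: "(gen, 'k) ncs"
      using central_Z_bracket[OF _ _ that] j by simp
  qed simp_all
  then have Z: "\<exists>f f'. grouplike g n f \<and> smul f' f = sone \<and> smul f f' = sone
      \<and> F (lt (Z j)) = smul (smul f' (lt (Z j))) f" if "j \<in> {1..n}" for j
    using final[of "vr (Z j)"] that by (simp add: raw_simps(7))
  have "\<exists>l. lie g n l \<and> G (om g n) = ex (- l) * om g n * ex l"
  proof (rule conj_exists)
    \<comment> \<open>\<open>\<omega>\<close> is a Lie polynomial in the letters, so the Lie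
      homomorphism property lets \<open>F\<close> be computed on it letter by letter.\<close>
    show "lin (pgw G) (om g n) = G (om g n)"
    proof -
      have X: "lie g n (vr (X i) :: (gen, 'k) ncs)" "lie g n (vr (Y i) :: (gen, 'k) ncs)" if "i \<in> {1..g}" for i
        using that by (auto intro!: lie_vr)
      have Z: "lie g n (vr (Z j) :: (gen, 'k) ncs)" if "j \<in> {1..n}" for j
        using that by (auto intro!: lie_vr)
      have "G (om g n) = G (\<Sum>i\<in>{1..g}. cm (vr (X i)) (vr (Y i))) + G (\<Sum>j\<in>{1..n}. vr (Z j))"
        unfolding om_def by (intro G_add lie_sum lie_simps X Z)
      also have "G (\<Sum>i\<in>{1..g}. cm (vr (X i)) (vr (Y i))) = (\<Sum>i\<in>{1..g}. G (cm (vr (X i)) (vr (Y i))))"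
        by (intro G_sum lie_simps X)
      also have "\<dots> = (\<Sum>i\<in>{1..g}. cm (G (vr (X i))) (G (vr (Y i))))"
        by (intro sum.cong refl G_cm X)
      also have "G (\<Sum>j\<in>{1..n}. vr (Z j)) = (\<Sum>j\<in>{1..n}. G (vr (Z j)))"
        by (intro G_sum Z)
      finally have "G (om g n) = (\<Sum>i\<in>{1..g}. cm (G (vr (X i))) (G (vr (Y i)))) + (\<Sum>j\<in>{1..n}. G (vr (Z j)))" .
      moreover have "lin (pgw G) (om g n) = (\<Sum>i\<in>{1..g}. cm (G (vr (X i))) (G (vr (Y i)))) + (\<Sum>j\<in>{1..n}. G (vr (Z j)))"
        unfolding om_def by (simp add: lin_mult_hom pgw_append)
      ultimately show ?thesis by simp
    qed
  qed (auto intro: hm_om prim_om nb_om_power central_om_bracket)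
  then have "\<exists>f f'. grouplike g n f \<and> smul f' f = sone \<and> smul f f' = sone
      \<and> F (omega g n) = smul (smul f' (omega g n)) f"
    using final[of "om g n"] by (simp add: omega_cf)
  then show ?thesis using Z by blast
qed

end
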